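(* Let $d\in\{1,2\}$ and suppose that $\mathscr T_h^{\rm a}\cup\mathscr T_h^{\rm i}\subset\mathscr T_\varepsilon$. Then there exists a constant $C_I$, which depends only on the shape regularity of $\mathscr T_h$, such that for all $y\in\mathscr Y$ and $p\in[1,\infty)$, $$\big\|\nabla(y-I_hy)\big\|_{L^p(\Omega)}\le C_I\Big\{\sum_{T\in\mathscr T_\varepsilon^{\rm c}}|T|\,\big[{\rm h}_T\,{\rm osc}(\nabla y;\omega_T^{\rm c})\big]^p\Big\}^{1/p},$$ where, for $T\in\mathscr T_\varepsilon$, $\omega_T^{\rm c}=\Omega_{\rm c}^\#\cap\bigcup\{T'\in\mathscr T_\varepsilon^\#:T\cap T'\neq\emptyset\}$ and ${\rm h}_T=\max_{x\in T}|h(x)|$. Similarly, for $p=\infty$, $\|\nabla(y-I_hy)\|_{L^\infty(\Omega)}\le C_I\max_{T\in\mathscr T_\varepsilon^{\rm c}}\big[{\rm h}_T\,{\rm osc}(\nabla y;\omega_T^{\rm c})\big]$.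
   Context: Let $N\in\mathbb N$, $\varepsilon=1/N$, $\Omega=(-1,1]^d$, $\mathscr L^\#=\varepsilon\mathbb Z^d$. For $A\subset\mathbb R^d$ let $A^\#=\bigcup_{\xi\in2\mathbb Z^d}(\xi+A)$. $\mathscr U$ is the space of $2\mathbb Z^d$-periodic $u:\mathscr L^\#\to\mathbb R^d$; $y_{\mathsf A}(x)=\mathsf Ax$ for $\mathsf A\in\mathbb R^{d\times d}$; $\mathscr Y=\{y:\mathscr L^\#\to\mathbb R^d:y-y_{\mathsf A}\in\mathscr U\text{ for some }\mathsf A\}$. $\mathscr T_\varepsilon^\#$ is the triangulation of $\mathbb R^d$ (closed elements) with vertex set $\mathscr L^\#$ obtained by $\varepsilon\mathbb Z^d$-translation of a subdivision of $\varepsilon(0,1)^d$ ($d=1$: the interval itself; $d=2$: two triangles separated by a diagonal); $\mathscr T_\varepsilon$ is its restriction to $\Omega$ (elements contained in $\overline\Omega$). Each $v:\mathscr L^\#\to\mathbb R^k$ is identified with its continuous piecewise affine interpolant on $\mathscr T_\varepsilon^\#$. $\mathscr T_h$ is a regular triangulation of $\overline\Omega$ (closed elements, vertices in $\mathscr L^\#$) extending $2\mathbb Z^d$-periodically to a regular triangulation $\mathscr T_h^\#$ of $\mathbb R^d$. $h_T={\rm diam}(T)$ for $T\in\mathscr T_h$, and $h(x)=\max\{h_T:T\in\mathscr T_h,\ x\in T\}$. $I_hy$ is the continuous function, piecewise affine with respect to $\mathscr T_h^\#$, with $I_hy=y$ at all vertices of $\mathscr T_h^\#$. $\mathscr T_h$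 is the disjoint union of $\mathscr T_h^{\rm a},\mathscr T_h^{\rm i},\mathscr T_h^{\rm c}$; $\Omega_{\rm c}$ is the (closed) union of the elements of $\mathscr T_h^{\rm c}$, and $\mathscr T_\varepsilon^{\rm c}=\{T\in\mathscr T_\varepsilon:T\subset\Omega_{\rm c}\}$. $\|\nabla v\|_{L^p}=\|\,|\nabla v|_p\|_{L^p}$ with $|\cdot|_p$ the entrywise $\ell^p$-norm. For measurable $\omega$, ${\rm osc}(\nabla y;\omega)=\varepsilon^{-1}\operatorname{ess\,sup}_{x,x'\in\omega}|\nabla y(x)-\nabla y(x')|$, $|\cdot|$ the Frobenius norm. *)

theory Defs
  imports "HOL-Probability.Essential_Supremum"
begin

section \<open>Lattice, periodicity, deformations\<close>

text \<open>The mesh parameter is \<open>\<epsilon> = 1/N\<close>, and the dimension is \<open>d = CARD('n)\<close>.\<close>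

definition eps :: "nat \<Rightarrow> real" where
  "eps N = 1 / real N"

definition lattice_pts :: "nat \<Rightarrow> (real^'n) set" where
  "lattice_pts N = {x. \<forall>i. \<exists>k::int. x $ i = eps N * of_int k}"

definition periods :: "(real^'n) set" where
  "periods = {x. \<forall>i. \<exists>k::int. x $ i = 2 * of_int k}"

definition periodize :: "(real^'n) set \<Rightarrow> (real^'n) set" where
  "periodize A = (\<Union>\<xi>\<in>periods. (+) \<xi> ` A)"

definition Omega :: "(real^'n) set" where
  "Omega = {x. \<forall>i. -1 < x $ i \<and> x $ i \<le> 1}"

text \<open>Lattice functions are total functions on \<open>real^'n\<close> of which only the values on
  \<open>lattice_pts N\<close> are constrained, and ever used.\<close>

definition displacements :: "nat \<Rightarrow> (real^'n \<Rightarrow> real^'n) set" where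
  "displacements N = {u. \<forall>x\<in>lattice_pts N. \<forall>\<xi>\<in>periods. u (x + \<xi>) = u x}"

definition deformations :: "nat \<Rightarrow> (real^'n \<Rightarrow> real^'n) set" where
  "deformations N = {y. \<exists>A :: real^'n^'n. (\<lambda>x. y x - A *v x) \<in> displacements N}"

section \<open>Triangulations and piecewise affine interpolation\<close>

definition vertices_of :: "(real^'n) set \<Rightarrow> (real^'n) set" where
  "vertices_of T = {v. v extreme_point_of T}"

text \<open>The library's \<open>triangulation\<close> demands finiteness; here it is replaced by local
  finiteness, so that triangulations of the whole space are covered. Only the full-dimensional
  closed elements are members.\<close>

definition regular_triangulation :: "(real^'n) set \<Rightarrow> (real^'n) set set \<Rightarrow> bool" where
  "regular_triangulation S \<T> \<longleftrightarrow>
     (\<forall>T\<in>\<T>. int CARD('n) simplex T) \<and>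
     (\<forall>T\<in>\<T>. \<forall>T'\<in>\<T>. (T \<inter> T') face_of T) \<and>
     (\<forall>B. bounded B \<longrightarrow> finite {T\<in>\<T>. T \<inter> B \<noteq> {}}) \<and>
     \<Union>\<T> = S"

definition pw_affine_interpolant ::
  "(real^'n) set set \<Rightarrow> (real^'n \<Rightarrow> real^'n) \<Rightarrow> (real^'n \<Rightarrow> real^'n) \<Rightarrow> bool" where
  "pw_affine_interpolant \<T> v w \<longleftrightarrow>
     continuous_on UNIV w \<and>
     (\<forall>T\<in>\<T>. \<exists>(A :: real^'n^'n) b. \<forall>x\<in>T. w x = A *v x + b) \<and>
     (\<forall>T\<in>\<T>. \<forall>x\<in>vertices_of T. w x = v x)"

text \<open>Meant for \<open>regular_triangulation UNIV \<T>\<close>, where the interpolant exists and is unique.\<close>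

definition interp :: "(real^'n) set set \<Rightarrow> (real^'n \<Rightarrow> real^'n) \<Rightarrow> real^'n \<Rightarrow> real^'n" where
  "interp \<T> v = (THE w. pw_affine_interpolant \<T> v w)"

text \<open>Subdivisions of the closed unit cube; for \<open>d = 2\<close> both diagonals are admitted.\<close>

definition unit_cube_subdivision :: "(real^'n) set set \<Rightarrow> bool" where
  "unit_cube_subdivision Q \<longleftrightarrow>
     (CARD('n) = 1 \<and> Q = {cbox 0 1}) \<or>
     (\<exists>i j. i \<noteq> j \<and> UNIV = {i, j} \<and>
        (Q = {convex hull {0, 1, axis i 1}, convex hull {0, 1, axis j 1}} \<or>
         Q = {convex hull {axis i 1, axis j 1, 0}, convex hull {axis i 1, axis j 1, 1}}))"

definition fine_mesh_per :: "nat \<Rightarrow> (real^'n) set set \<Rightarrow> (real^'n) set set" where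
  "fine_mesh_per N Q = {(\<lambda>x. z + eps N *\<^sub>R x) ` K | z K. z \<in> lattice_pts N \<and> K \<in> Q}"

definition fine_mesh :: "nat \<Rightarrow> (real^'n) set set \<Rightarrow> (real^'n) set set" where
  "fine_mesh N Q = {T \<in> fine_mesh_per N Q. T \<subseteq> closure Omega}"

definition mesh_per :: "(real^'n) set set \<Rightarrow> (real^'n) set set" where
  "mesh_per Th = {(+) \<xi> ` T | \<xi> T. \<xi> \<in> periods \<and> T \<in> Th}"

definition coarse_mesh :: "nat \<Rightarrow> (real^'n) set set \<Rightarrow> bool" where
  "coarse_mesh N Th \<longleftrightarrow>
     regular_triangulation (closure Omega) Th \<and>
     (\<forall>T\<in>Th. vertices_of T \<subseteq> lattice_pts N) \<and>
     regular_triangulation UNIV (mesh_per Th)"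

definition mesh_size :: "(real^'n) set set \<Rightarrow> real^'n \<Rightarrow> real" where
  "mesh_size Th x = Max (diameter ` {T\<in>Th. x \<in> T})"

definition elt_mesh_size :: "(real^'n) set set \<Rightarrow> (real^'n) set \<Rightarrow> real" where
  "elt_mesh_size Th T = Max ((\<lambda>x. \<bar>mesh_size Th x\<bar>) ` T)"

text \<open>Shape regularity in Ciarlet's sense: the largest ratio of the diameter of an element to the
  diameter of its largest inscribed ball.\<close>

definition inball_diameter :: "(real^'n) set \<Rightarrow> real" where
  "inball_diameter T = Sup {2 * r | r. 0 \<le> r \<and> (\<exists>x. cball x r \<subseteq> T)}"

definition shape_regularity :: "(real^'n) set set \<Rightarrow> real" where
  "shape_regularity Th = Max ((\<lambda>T. diameter T / inball_diameter T) ` Th)"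

section \<open>Gradients, norms, oscillation\<close>

text \<open>At the (null set of) points of non-differentiability the value is arbitrary; it is only
  used under integrals and essential suprema.\<close>

definition grad :: "(real^'n \<Rightarrow> real^'n) \<Rightarrow> real^'n \<Rightarrow> real^'n^'n" where
  "grad w x = jacobian w (at x)"

definition entry_norm :: "real \<Rightarrow> real^'n^'m \<Rightarrow> real" where
  "entry_norm p A = (\<Sum>i\<in>UNIV. \<Sum>j\<in>UNIV. \<bar>A $ i $ j\<bar> powr p) powr (1 / p)"

definition entry_max :: "real^'n^'m \<Rightarrow> real" where
  "entry_max A = Max (range (\<lambda>(i, j). \<bar>A $ i $ j\<bar>))"

text \<open>Power with a positive real exponent on \<open>[0, \<infinity>]\<close>.\<close>

definition epowr :: "ennreal \<Rightarrow> real \<Rightarrow> ennreal" where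
  "epowr a r = (if a = top then top else ennreal (enn2real a powr r))"

definition grad_Lp_norm :: "real \<Rightarrow> (real^'n) set \<Rightarrow> (real^'n \<Rightarrow> real^'n) \<Rightarrow> ennreal" where
  "grad_Lp_norm p S v =
     epowr (\<integral>\<^sup>+x\<in>S. epowr (ennreal (entry_norm p (grad v x))) p \<partial>lebesgue) (1 / p)"

definition grad_Linf_norm :: "(real^'n) set \<Rightarrow> (real^'n \<Rightarrow> real^'n) \<Rightarrow> ennreal" where
  "grad_Linf_norm S v = esssup (lebesgue_on S) (\<lambda>x. ennreal (entry_max (grad v x)))"

text \<open>The norm of \<open>real^'n^'n\<close> is the Frobenius norm. The essential supremum over pairs refers to
  Lebesgue measure on the product space.\<close>

definition osc_grad :: "nat \<Rightarrow> (real^'n \<Rightarrow> real^'n) \<Rightarrow> (real^'n) set \<Rightarrow> ennreal" where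
  "osc_grad N v \<omega> = ennreal (1 / eps N) *
     esssup (lebesgue_on (\<omega> \<times> \<omega>)) (\<lambda>(x, x'). ennreal (norm (grad v x - grad v x')))"

text \<open>In what follows \<open>Thc\<close> is the set of elements of the continuum region.\<close>

definition fine_mesh_c ::
  "nat \<Rightarrow> (real^'n) set set \<Rightarrow> (real^'n) set set \<Rightarrow> (real^'n) set set" where
  "fine_mesh_c N Q Thc = {T \<in> fine_mesh N Q. T \<subseteq> \<Union>Thc}"

definition patch_c ::
  "nat \<Rightarrow> (real^'n) set set \<Rightarrow> (real^'n) set set \<Rightarrow> (real^'n) set \<Rightarrow> (real^'n) set" where
  "patch_c N Q Thc T =
     periodize (\<Union>Thc) \<inter> \<Union>{T' \<in> fine_mesh_per N Q. T \<inter> T' \<noteq> {}}"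

end

theory Submission
  imports Defs
begin

text \<open>
  An element of the atomistic or of the interface region belongs to both meshes, so both interpolants
  agree on it, and the error lives on the elements of the continuum region. Let \<open>T\<close> be such an
  element, of diameter \<open>h\<close>; let \<open>A\<close> be the gradient of the coarse interpolant on \<open>T\<close>, and let \<open>G\<close> be
  the gradient of the fine one, a constant on every fine element. The oscillation bounds the jumps of
  \<open>G\<close>: on two fine elements that touch, \<open>G\<close> differs by at most \<open>\<epsilon>\<close> times the oscillation around either
  of them (lemma \<open>osc_ge\<close>). The oscillation thus plays the role of a second derivative, and
  the theorem is a discrete form of the classical \<open>W\<^sup>2\<^sup>,\<^sup>p\<close> error estimate for nodal interpolation.

  The link between jumps and distances is geometric: points at distance at most \<open>\<epsilon>/6\<close> lie in touching
  fine elements (\<open>near_elements_meet\<close>). A segment in \<open>T\<close> is therefore divided into \<open>m\<close> steps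
  of this size, where \<open>m\<close> is comparable with \<open>h/\<epsilon>\<close>. Adding up jumps along it bounds
  the variation of \<open>G\<close> (\<open>gradient_diff_le\<close>) and the first order Taylor remainder
  (\<open>taylor_remainder_le\<close>) by sums of oscillations at the division points. Because \<open>T\<close> contains a ball of
  radius comparable with \<open>h\<close>, the remainders at its vertices, taken from a point \<open>z\<close>, control \<open>A - G(z)\<close>
  (\<open>gradient_error_le\<close>). With a uniform bound on the oscillation this is already the maximum norm
  estimate (\<open>gradient_error_sup\<close>).

  For finite \<open>p\<close>, and above all for \<open>p = 1\<close>, one must integrate. Near a vertex \<open>v\<close> the division points of
  the segments from \<open>z\<close> to \<open>v\<close> crowd together. Averaging over all \<open>z\<close> in \<open>T\<close> would lose a logarithm when
  \<open>d = 2\<close>; averaging over half the inscribed ball does not: that ball stays away from \<open>v\<close>, so a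
  given point of \<open>T\<close> is met only for division parameters in a range of bounded ratio (\<open>scales_le\<close>). For
  \<open>d \<le> 2\<close> the Jacobians of the corresponding dilations, summed over this range with the weights of the
  Taylor remainder, stay bounded by a multiple of \<open>m\<^sup>2\<close>. It remains to compare \<open>G\<close> at a point of \<open>T\<close>
  with \<open>G\<close> on the ball, by a Poincare inequality along segments (\<open>integral_segments_le\<close>). Jensen's
  inequality gives the powers \<open>p\<close> with a constant independent of \<open>p\<close> (\<open>gradient_error_Lp\<close>).

  The estimates on single elements are integrals over \<open>T\<close> itself and not over a larger patch. As the
  coarse elements do not overlap, and the fine ones do not either, they add up to the right-hand side
  without any count of how many elements meet (\<open>Lp_bound_finite\<close>). Every fine element that meets
  the interior of \<open>T\<close> lies in the continuum region (\<open>F_continuum\<close>) and has a mesh size of at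
  least \<open>h\<close>, so that it does occur on the right-hand side.
\<close>

section \<open>Convexity and integration\<close>

text \<open>The graph of \<open>t \<mapsto> t\<^sup>p\<close> lies above its tangent at \<open>g\<close>.\<close>

lemma Young_powr:
  fixes g t p :: real
  assumes p: "p \<ge> 1" and g: "g > 0" and t: "t \<ge> 0"
  shows "p * g powr (p - 1) * t \<le> t powr p + (p - 1) * g powr p"
proof (cases "p = 1")
  case True
  then show ?thesis using g t by (simp add: powr_one_gt_zero_iff)
next
  case False
  with p have p1: "p > 1" by simp
  let ?q = "p / (p - 1)"
  have "t * g powr (p - 1) \<le> t powr p / p + (g powr (p - 1)) powr ?q / ?q"
    using p1 t by (intro Youngs_inequality) (auto simp: field_simps)
  also have "(g powr (p - 1)) powr ?q = g powr p"
    using p1 by (simp add: powr_powr)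
  finally have "p * (t * g powr (p - 1)) \<le> p * (t powr p / p + g powr p / ?q)"
    using p1 by (intro mult_left_mono) auto
  also have "\<dots> = t powr p + (p - 1) * g powr p"
    using p1 by (simp add: field_simps)
  finally show ?thesis by (simp add: mult_ac)
qed

text \<open>Integrate the tangent inequality at \<open>g\<close>. The hypothesis, that \<open>g\<close> is at most the mean of \<open>f\<close>, is
  multiplied by the total mass, so that it makes sense for integrals with values in \<open>[0, \<infinity>]\<close>.\<close>

lemma Jensen_powr_nn_integral:
  fixes f :: "'a \<Rightarrow> real"
  assumes p: "p \<ge> 1" and g: "g \<ge> 0" and f: "f \<in> borel_measurable M"
    and f0: "\<And>x. f x \<ge> 0"
    and fin: "emeasure M (space M) < \<infinity>"
    and le: "ennreal g * emeasure M (space M) \<le> (\<integral>\<^sup>+x. ennreal (f x) \<partial>M)"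
  shows "ennreal (g powr p) * emeasure M (space M) \<le> (\<integral>\<^sup>+x. ennreal (f x powr p) \<partial>M)"
proof (cases "g = 0")
  case True
  then show ?thesis using p by simp
next
  case False
  with g have g0: "g > 0" by simp
  note f[measurable]
  define a where "a = measure M (space M)"
  have a: "emeasure M (space M) = ennreal a" and a0: "a \<ge> 0"
    using fin by (auto simp: a_def emeasure_eq_ennreal_measure)
  let ?I = "\<integral>\<^sup>+x. ennreal (f x powr p) \<partial>M"
  have gp: "g powr (p - 1) * g = g powr p"
    using g0 by (simp add: powr_diff)
  have "ennreal (p * g powr p * a) = ennreal (p * g powr (p - 1)) * (ennreal g * ennreal a)"
    using p g a0 by (simp add: gp[symmetric] ennreal_mult'[symmetric] mult_ac)
  also have "\<dots> \<le> ennreal (p * g powr (p - 1)) * (\<integral>\<^sup>+x. ennreal (f x) \<partial>M)"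
    using le a by (intro mult_left_mono) auto
  also have "\<dots> = (\<integral>\<^sup>+x. ennreal (p * g powr (p - 1) * f x) \<partial>M)"
    using p g f0 by (subst nn_integral_cmult[symmetric]) (auto simp: ennreal_mult')
  also have "\<dots> \<le> (\<integral>\<^sup>+x. ennreal (f x powr p) + ennreal ((p - 1) * g powr p) \<partial>M)"
    using p Young_powr[OF p g0 f0]
    by (intro nn_integral_mono) (auto simp: ennreal_plus[symmetric] simp del: ennreal_plus intro!: ennreal_leI)
  also have "\<dots> = ?I + ennreal ((p - 1) * g powr p) * ennreal a"
    by (subst nn_integral_add) (auto simp: a)
  also have "\<dots> = ?I + ennreal ((p - 1) * g powr p * a)"
    using p a0 by (simp add: ennreal_mult')
  finally have le': "ennreal (p * g powr p * a) \<le> ?I + ennreal ((p - 1) * g powr p * a)" .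
  have "ennreal (g powr p * a) + ennreal ((p - 1) * g powr p * a) = ennreal (p * g powr p * a)"
  proof (subst ennreal_plus[symmetric])
    show "0 \<le> g powr p * a" "0 \<le> (p - 1) * g powr p * a" using p a0 by auto
    show "ennreal (g powr p * a + (p - 1) * g powr p * a) = ennreal (p * g powr p * a)"
      by (simp add: algebra_simps)
  qed
  with le' have "ennreal (g powr p * a) + ennreal ((p - 1) * g powr p * a)
      \<le> ?I + ennreal ((p - 1) * g powr p * a)" by simp
  then have "ennreal (g powr p * a) \<le> ?I"
    by (simp add: ennreal_add_left_cancel_le add.commute)
  then show ?thesis by (simp add: a ennreal_mult')
qed

lemma Jensen_powr_set:
  fixes f :: "'a \<Rightarrow> real"
  assumes p: "p \<ge> 1" and g: "g \<ge> 0" and f: "f \<in> borel_measurable M"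
    and f0: "\<And>x. f x \<ge> 0" and T: "T \<in> sets M" and t: "emeasure M T = ennreal t"
    and le: "ennreal g * ennreal t \<le> (\<integral>\<^sup>+x. ennreal (indicator T x * f x) \<partial>M)"
  shows "ennreal (g powr p) * ennreal t \<le> (\<integral>\<^sup>+x. ennreal (indicator T x * f x powr p) \<partial>M)"
proof -
  have T': "T \<inter> space M \<in> sets M" using T by auto
  have eq: "(\<integral>\<^sup>+x. ennreal (h x) \<partial>restrict_space M T) = (\<integral>\<^sup>+x. ennreal (indicator T x * h x) \<partial>M)" for h
    unfolding nn_integral_restrict_space[OF T'] by (intro nn_integral_cong) (auto simp: indicator_def)
  have sp: "emeasure (restrict_space M T) (space (restrict_space M T)) = ennreal t"
    using T t T' sets.sets_into_space[OF T]
    by (simp add: emeasure_restrict_space space_restrict_space Int_absorb2)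
  have "f \<in> borel_measurable (restrict_space M T)"
    using f by (rule measurable_restrict_space1)
  from Jensen_powr_nn_integral[OF p g this f0] show ?thesis
    unfolding sp eq using le by simp
qed

lemma Jensen_powr_sum:
  fixes f :: "'a \<Rightarrow> real"
  assumes p: "p \<ge> 1" and I: "finite I" "I \<noteq> {}" and f: "\<And>i. f i \<ge> 0"
  shows "((\<Sum>i\<in>I. f i) / card I) powr p \<le> (\<Sum>i\<in>I. f i powr p) / card I"
proof -
  let ?g = "(\<Sum>i\<in>I. f i) / card I"
  have c: "card I > 0" using I by (simp add: card_gt_0_iff)
  have s0: "0 \<le> (\<Sum>i\<in>I. f i)" using f by (simp add: sum_nonneg)
  have "ennreal ?g * emeasure (count_space I) (space (count_space I))
      \<le> (\<integral>\<^sup>+x. ennreal (f x) \<partial>count_space I)"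
    using I f c s0
    by (simp add: nn_integral_count_space_finite emeasure_count_space ennreal_mult'[symmetric] ennreal_of_nat_eq_real_of_nat)
  from Jensen_powr_nn_integral[OF p _ _ f _ this]
  have "ennreal (?g powr p) * ennreal (card I) \<le> ennreal (\<Sum>i\<in>I. f i powr p)"
    using I f s0
    by (simp add: nn_integral_count_space_finite emeasure_count_space ennreal_of_nat_eq_real_of_nat ennreal_less_top)
  then have "?g powr p * card I \<le> (\<Sum>i\<in>I. f i powr p)"
    by (simp add: ennreal_mult'[symmetric] sum_nonneg)
  then show ?thesis using c by (simp add: field_simps)
qed

lemma nn_integral_sum_cmult:
  assumes "\<And>i. i \<in> I \<Longrightarrow> f i \<in> borel_measurable M"
  shows "(\<integral>\<^sup>+x. (\<Sum>i\<in>I. c i * f i x) \<partial>M) = (\<Sum>i\<in>I. c i * (\<integral>\<^sup>+x. f i x \<partial>M))"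
  using assms by (simp add: nn_integral_sum nn_integral_cmult)

lemma nn_integral_lborel_affine:
  fixes g :: "'a::euclidean_space \<Rightarrow> ennreal"
  assumes g: "g \<in> borel_measurable borel" and c: "c > 0"
  shows "(\<integral>\<^sup>+x. g (t + c *\<^sub>R x) \<partial>lborel) = ennreal ((1 / c) ^ DIM('a)) * (\<integral>\<^sup>+x. g x \<partial>lborel)"
proof -
  note g[measurable]
  have "(\<integral>\<^sup>+x. g x \<partial>lborel) = ennreal (c ^ DIM('a)) * (\<integral>\<^sup>+x. g (t + c *\<^sub>R x) \<partial>lborel)"
    using c by (subst lborel_affine[of c t])
      (simp_all add: nn_integral_density nn_integral_distr nn_integral_cmult)
  then have "ennreal ((1 / c) ^ DIM('a)) * (\<integral>\<^sup>+x. g x \<partial>lborel)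
      = ennreal ((1 / c) ^ DIM('a) * c ^ DIM('a)) * (\<integral>\<^sup>+x. g (t + c *\<^sub>R x) \<partial>lborel)"
    using c by (simp add: ennreal_mult' mult.assoc)
  also have "(1 / c) ^ DIM('a) * c ^ DIM('a) = 1"
    using c by (simp add: power_one_over)
  finally show ?thesis by simp
qed

lemma ennreal_mult_assoc: "0 \<le> a \<Longrightarrow> 0 \<le> b \<Longrightarrow> ennreal a * (ennreal b * X) = ennreal (a * b) * X"
  by (simp add: ennreal_mult' mult.assoc)

section \<open>Piecewise affine maps along segments\<close>

lemma norm_matrix_vector_le: "norm ((A::real^'n^'m) *v x) \<le> norm A * norm x"
proof -
  have "norm (A *v x) = L2_set (\<lambda>i. (A *v x) $ i) UNIV"
    by (simp add: norm_vec_def L2_set_def)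
  also have "\<dots> \<le> L2_set (\<lambda>i. norm (A $ i) * norm x) UNIV"
    unfolding L2_set_def
  proof (intro real_sqrt_le_mono sum_mono)
    fix i
    have "\<bar>(A *v x) $ i\<bar> \<le> norm (A $ i) * norm x"
      by (metis matrix_vector_mul_component Cauchy_Schwarz_ineq2)
    then show "((A *v x) $ i)\<^sup>2 \<le> (norm (A $ i) * norm x)\<^sup>2"
      by (metis abs_le_square_iff abs_of_nonneg norm_ge_zero mult_nonneg_nonneg)
  qed
  also have "\<dots> = norm A * norm x"
    by (simp add: L2_set_left_distrib norm_vec_def)
  finally show ?thesis .
qed

text \<open>The function \<open>f\<close> is affine with gradient \<open>G E\<close> on every cell \<open>E\<close> of \<open>F\<close>, and the cells have size of order
  \<open>e\<close>. The jumps of the gradient from a cell to its neighbours, divided by \<open>e\<close>, are at most \<open>osc\<close> at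
  each point of the cell in \<open>T\<close>, so that \<open>osc\<close> stands for a second derivative.\<close>

locale pw_affine_field =
  fixes T :: "(real^'n) set" and F :: "(real^'n) set set" and f :: "real^'n \<Rightarrow> real^'n"
    and G :: "(real^'n) set \<Rightarrow> real^'n^'n" and osc :: "real^'n \<Rightarrow> real" and e :: real
  assumes convex: "convex T" and e_pos: "e > 0" and cover: "T \<subseteq> \<Union>F"
    and affine: "\<And>E x q. E \<in> F \<Longrightarrow> x \<in> E \<Longrightarrow> q \<in> E \<Longrightarrow> f x - f q = G E *v (x - q)"
    and diam: "\<And>E x q. E \<in> F \<Longrightarrow> x \<in> E \<Longrightarrow> q \<in> E \<Longrightarrow> norm (x - q) \<le> 2 * e"
    and near: "\<And>E E' x x'. E \<in> F \<Longrightarrow> E' \<in> F \<Longrightarrow> x \<in> E \<Longrightarrow> x' \<in> E' \<Longrightarrow> norm (x' - x) \<le> e / 6 \<Longrightarrow>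
        E \<inter> E' \<noteq> {}"
    and jump: "\<And>E E' x. E \<in> F \<Longrightarrow> E' \<in> F \<Longrightarrow> E \<inter> E' \<noteq> {} \<Longrightarrow> x \<in> E \<Longrightarrow> x \<in> T \<Longrightarrow>
        norm (G E' - G E) \<le> e * osc x"
begin

lemma osc_nonneg: "x \<in> T \<Longrightarrow> osc x \<ge> 0"
proof -
  assume x: "x \<in> T"
  with cover obtain E where "E \<in> F" "x \<in> E" by auto
  from jump[of E E x] this x have "0 \<le> e * osc x" by auto
  then show ?thesis using e_pos by (simp add: zero_le_mult_iff)
qed

definition division_pt :: "nat \<Rightarrow> real^'n \<Rightarrow> real^'n \<Rightarrow> nat \<Rightarrow> real^'n" where
  "division_pt m x z j = x + (real j / real m) *\<^sub>R (z - x)"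

lemma division_pt_0 [simp]: "division_pt m x z 0 = x"
  by (simp add: division_pt_def)

lemma division_pt_last: "m > 0 \<Longrightarrow> division_pt m x z m = z"
  by (simp add: division_pt_def)

lemma division_pt_step: "division_pt m x z (Suc j) - division_pt m x z j = (1 / real m) *\<^sub>R (z - x)"
  by (simp add: division_pt_def algebra_simps add_divide_distrib)

lemma division_pt_in:
  assumes "x \<in> T" "z \<in> T" "j \<le> m" "m > 0"
  shows "division_pt m x z j \<in> T"
proof -
  have "division_pt m x z j = (1 - real j / real m) *\<^sub>R x + (real j / real m) *\<^sub>R z"
    by (simp add: division_pt_def algebra_simps)
  also have "\<dots> \<in> T"
    using assms convex by (intro convexD) auto
  finally show ?thesis .
qed

text \<open>A chain of cells along the segment whose first and last members are prescribed, which matters at points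
  that lie in several cells.\<close>

lemma element_path:
  assumes "x \<in> T" "z \<in> T" "E \<in> F" "x \<in> E" "E' \<in> F" "z \<in> E'" "m > 0"
  obtains P where "P 0 = E" "P m = E'" "\<And>j. j \<le> m \<Longrightarrow> P j \<in> F" "\<And>j. j \<le> m \<Longrightarrow> division_pt m x z j \<in> P j"
proof -
  define Q where "Q j = (SOME K. K \<in> F \<and> division_pt m x z j \<in> K)" for j
  have Q: "Q j \<in> F \<and> division_pt m x z j \<in> Q j" if "j \<le> m" for j
  proof -
    have "\<exists>K. K \<in> F \<and> division_pt m x z j \<in> K"
      using division_pt_in[OF assms(1,2) that assms(7)] cover by auto
    then show ?thesis unfolding Q_def by (rule someI_ex)
  qed
  show ?thesis
  proof (rule that)
    show "(Q(0 := E, m := E')) 0 = E" "(Q(0 := E, m := E')) m = E'"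
      using assms by auto
    show "(Q(0 := E, m := E')) j \<in> F" "division_pt m x z j \<in> (Q(0 := E, m := E')) j" if "j \<le> m" for j
      using Q[OF that] assms by (auto simp: division_pt_last)
  qed
qed

lemma path_step_norm:
  assumes "norm (z - x) \<le> real m * e / 6" "m > 0"
  shows "norm (division_pt m x z (Suc j) - division_pt m x z j) \<le> e / 6"
proof -
  have "norm (division_pt m x z (Suc j) - division_pt m x z j) = norm (z - x) / real m"
    unfolding division_pt_step by simp
  also have "\<dots> \<le> (real m * e / 6) / real m"
    using assms by (intro divide_right_mono) auto
  finally show ?thesis using assms by simp
qed

lemma path_jump:
  assumes xz: "x \<in> T" "z \<in> T" "m > 0" "norm (z - x) \<le> real m * e / 6"
    and P: "\<And>j. j \<le> m \<Longrightarrow> P j \<in> F" "\<And>j. j \<le> m \<Longrightarrow> division_pt m x z j \<in> P j"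
    and j: "j < m"
  shows "norm (G (P (Suc j)) - G (P j)) \<le> e * osc (division_pt m x z j)"
proof -
  have "P j \<inter> P (Suc j) \<noteq> {}"
    using path_step_norm[OF xz(4,3), of j] P[of j] P[of "Suc j"] j by (intro near) auto
  then show ?thesis
    using P[of j] P[of "Suc j"] j division_pt_in[OF xz(1,2) _ xz(3)] by (intro jump) auto
qed

lemma path_gradient_diff:
  assumes xz: "x \<in> T" "z \<in> T" "m > 0" "norm (z - x) \<le> real m * e / 6"
    and P: "\<And>j. j \<le> m \<Longrightarrow> P j \<in> F" "\<And>j. j \<le> m \<Longrightarrow> division_pt m x z j \<in> P j"
    and j: "j \<le> m"
  shows "norm (G (P j) - G (P 0)) \<le> e * (\<Sum>i<j. osc (division_pt m x z i))"
  using j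
proof (induction j)
  case (Suc j)
  have "norm (G (P (Suc j)) - G (P 0)) \<le> norm (G (P (Suc j)) - G (P j)) + norm (G (P j) - G (P 0))"
    by (metis diff_add_cancel add_diff_eq norm_triangle_ineq)
  also have "\<dots> \<le> e * osc (division_pt m x z j) + e * (\<Sum>i<j. osc (division_pt m x z i))"
    using Suc path_jump[OF xz P, of j] by (intro add_mono) auto
  finally show ?case by (simp add: algebra_simps)
qed simp

lemma gradient_diff_le:
  assumes xz: "x \<in> T" "z \<in> T" "m > 0" "norm (z - x) \<le> real m * e / 6"
    and E: "E \<in> F" "x \<in> E" "E' \<in> F" "z \<in> E'"
  shows "norm (G E' - G E) \<le> e * (\<Sum>i<m. osc (division_pt m x z i))"
proof -
  obtain P where "P 0 = E" "P m = E'" and P: "\<And>j. j \<le> m \<Longrightarrow> P j \<in> F" "\<And>j. j \<le> m \<Longrightarrow> division_pt m x z j \<in> P j"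
    using element_path[OF xz(1,2) E xz(3)] by blast
  with path_gradient_diff[OF xz P, of m] show ?thesis by simp
qed

text \<open>At a common point \<open>q\<close> of two consecutive cells both affine pieces have the same value. Passing through \<open>q\<close>,
  one sees the jump of the gradient applied to a vector no longer than \<open>2 e\<close>.\<close>

lemma path_step_remainder:
  assumes xz: "x \<in> T" "z \<in> T" "m > 0" "norm (z - x) \<le> real m * e / 6"
    and P: "\<And>j. j \<le> m \<Longrightarrow> P j \<in> F" "\<And>j. j \<le> m \<Longrightarrow> division_pt m x z j \<in> P j"
    and j: "j < m"
  shows "norm (f (division_pt m x z (Suc j)) - f (division_pt m x z j) - G (P j) *v ((1 / real m) *\<^sub>R (z - x)))
     \<le> 2 * e\<^sup>2 * osc (division_pt m x z j)"
proof -
  let ?X = "division_pt m x z"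
  have "P j \<inter> P (Suc j) \<noteq> {}"
    using path_step_norm[OF xz(4,3), of j] P[of j] P[of "Suc j"] j by (intro near) auto
  then obtain q where q: "q \<in> P j" "q \<in> P (Suc j)" by auto
  have 1: "f (?X (Suc j)) - f q = G (P (Suc j)) *v (?X (Suc j) - q)"
    using P[of "Suc j"] j q by (intro affine) auto
  have 2: "f (?X j) - f q = G (P j) *v (?X j - q)"
    using P[of j] j q by (intro affine) auto
  have "f (?X (Suc j)) - f (?X j) - G (P j) *v (?X (Suc j) - ?X j)
      = (f (?X (Suc j)) - f q) - (f (?X j) - f q) - G (P j) *v (?X (Suc j) - ?X j)" by simp
  also have "\<dots> = (G (P (Suc j)) - G (P j)) *v (?X (Suc j) - q)"
    unfolding 1 2 by (simp add: matrix_vector_mult_diff_rdistrib matrix_vector_mult_diff_distrib)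
  also have "norm \<dots> \<le> norm (G (P (Suc j)) - G (P j)) * norm (?X (Suc j) - q)"
    by (rule norm_matrix_vector_le)
  also have "\<dots> \<le> (e * osc (?X j)) * (2 * e)"
    using path_jump[OF xz P j] diam[of "P (Suc j)" "?X (Suc j)" q] P[of "Suc j"] j q
      osc_nonneg[OF division_pt_in[OF xz(1,2) _ xz(3)], of j] e_pos
    by (intro mult_mono) auto
  finally show ?thesis by (simp add: division_pt_step power2_eq_square mult_ac)
qed

text \<open>Discrete Taylor formula. The weight \<open>m - j\<close>, which counts the steps left from the \<open>j\<close>-th division point,
  corresponds to \<open>1 - t\<close> in the integral form of the remainder. The induction is on the number of steps
  taken: one more step costs its own remainder and the change of gradient accumulated so far.\<close>

lemma taylor_remainder_le:
  assumes xz: "x \<in> T" "z \<in> T" "m > 0" "norm (z - x) \<le> real m * e / 6"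
    and E: "E \<in> F" "x \<in> E"
  shows "norm (f z - f x - G E *v (z - x)) \<le> 2 * e\<^sup>2 * (\<Sum>j<m. real (m - j) * osc (division_pt m x z j))"
proof -
  from xz cover obtain E' where E': "E' \<in> F" "z \<in> E'" by auto
  obtain P where P0: "P 0 = E" and P: "\<And>j. j \<le> m \<Longrightarrow> P j \<in> F" "\<And>j. j \<le> m \<Longrightarrow> division_pt m x z j \<in> P j"
    using element_path[OF xz(1,2) E E' xz(3)] by blast
  let ?X = "division_pt m x z"
  define s where "s = (1 / real m) *\<^sub>R (z - x)"
  have o0: "osc (?X j) \<ge> 0" if "j \<le> m" for j
    using osc_nonneg[OF division_pt_in[OF xz(1,2) that xz(3)]] .
  have main: "norm (f (?X k) - f x - G E *v (real k *\<^sub>R s))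
      \<le> 2 * e\<^sup>2 * (\<Sum>j<k. real (k - j) * osc (?X j))" if "k \<le> m" for k
    using that
  proof (induction k)
    case 0
    show ?case by simp
  next
    case (Suc k)
    have "norm (f (?X (Suc k)) - f x - G E *v (real (Suc k) *\<^sub>R s))
        = norm ((f (?X k) - f x - G E *v (real k *\<^sub>R s))
            + ((f (?X (Suc k)) - f (?X k) - G (P k) *v s) + (G (P k) - G (P 0)) *v s))"
      by (simp add: P0 matrix_vector_mult_diff_rdistrib matrix_vector_right_distrib scaleR_add_left
          algebra_simps)
    also have "\<dots> \<le> norm (f (?X k) - f x - G E *v (real k *\<^sub>R s))
        + (norm (f (?X (Suc k)) - f (?X k) - G (P k) *v s) + norm ((G (P k) - G (P 0)) *v s))"
      by (meson add_left_mono norm_triangle_ineq order_trans)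
    also have "\<dots> \<le> 2 * e\<^sup>2 * (\<Sum>j<k. real (k - j) * osc (?X j))
        + (2 * e\<^sup>2 * osc (?X k) + (e * (\<Sum>j<k. osc (?X j))) * (2 * e))"
    proof (intro add_mono)
      show "norm (f (?X k) - f x - G E *v (real k *\<^sub>R s))
          \<le> 2 * e\<^sup>2 * (\<Sum>j<k. real (k - j) * osc (?X j))"
        using Suc by auto
      show "norm (f (?X (Suc k)) - f (?X k) - G (P k) *v s) \<le> 2 * e\<^sup>2 * osc (?X k)"
        using path_step_remainder[OF xz P, of k] Suc.prems by (auto simp: s_def)
      have "norm ((G (P k) - G (P 0)) *v s) \<le> norm (G (P k) - G (P 0)) * norm s"
        by (rule norm_matrix_vector_le)
      also have "\<dots> \<le> (e * (\<Sum>j<k. osc (?X j))) * (2 * e)"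
      proof (intro mult_mono)
        show "norm (G (P k) - G (P 0)) \<le> e * (\<Sum>j<k. osc (?X j))"
          using path_gradient_diff[OF xz P, of k] Suc.prems by auto
        show "norm s \<le> 2 * e"
          using path_step_norm[OF xz(4,3), of 0] e_pos unfolding division_pt_step s_def by linarith
        show "0 \<le> e * (\<Sum>j<k. osc (?X j))"
          using o0 Suc.prems e_pos by (intro mult_nonneg_nonneg sum_nonneg) auto
      qed auto
      finally show "norm ((G (P k) - G (P 0)) *v s) \<le> (e * (\<Sum>j<k. osc (?X j))) * (2 * e)" .
    qed
    also have "\<dots> = 2 * e\<^sup>2 * ((\<Sum>j<k. real (k - j) * osc (?X j)) + (\<Sum>j<k. osc (?X j)) + osc (?X k))"
      by (simp add: power2_eq_square algebra_simps)
    also have "(\<Sum>j<k. real (k - j) * osc (?X j)) + (\<Sum>j<k. osc (?X j))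
        = (\<Sum>j<k. real (Suc k - j) * osc (?X j))"
      unfolding sum.distrib[symmetric] by (intro sum.cong) (auto simp: algebra_simps of_nat_diff)
    finally show ?case by simp
  qed
  from main[of m] show ?thesis using xz(3) by (simp add: division_pt_last s_def)
qed

end

section \<open>Interpolation error on one element\<close>

text \<open>On differences of points of the hull, \<open>norm (M *v _)\<close> is convex in either point and thus largest at the
  vertices. The ball supplies the differences \<open>2 r e\<^sub>j\<close>, whose images are multiples of the columns.\<close>

lemma norm_matrix_le_inball:
  fixes M :: "real^'n^'n"
  assumes V: "\<And>v v'. v \<in> V \<Longrightarrow> v' \<in> V \<Longrightarrow> norm (M *v (v - v')) \<le> S"
    and ball: "cball x0 r \<subseteq> convex hull V" and r: "r > 0"
  shows "norm M \<le> (real CARD('n))\<^sup>2 * (S / (2 * r))"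
proof -
  have conv: "convex {x. norm (M *v (x - a)) \<le> S}" for a
  proof -
    have "{x. norm (M *v (x - a)) \<le> S} = (\<lambda>x. M *v x) -` cball (M *v a) S"
      by (auto simp: dist_norm matrix_vector_mult_diff_distrib norm_minus_commute)
    then show ?thesis
      by (simp add: convex_linear_vimage)
  qed
  have 1: "norm (M *v (x - v)) \<le> S" if "x \<in> convex hull V" "v \<in> V" for x v
  proof -
    have "convex hull V \<subseteq> {x. norm (M *v (x - v)) \<le> S}"
      using V that(2) conv by (intro hull_minimal) auto
    with that show ?thesis by auto
  qed
  have 2: "norm (M *v (x - y)) \<le> S" if "x \<in> convex hull V" "y \<in> convex hull V" for x y
  proof -
    have "norm (M *v (v - x)) \<le> S" if "v \<in> V" for v
      using 1[OF \<open>x \<in> convex hull V\<close> that]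
      by (metis matrix_vector_mult_diff_distrib norm_minus_commute)
    then have "convex hull V \<subseteq> {y. norm (M *v (y - x)) \<le> S}"
      using conv by (intro hull_minimal) auto
    then have "norm (M *v (y - x)) \<le> S" using that by auto
    then show ?thesis by (metis matrix_vector_mult_diff_distrib norm_minus_commute)
  qed
  have entry: "\<bar>M $ i $ j\<bar> \<le> S / (2 * r)" for i j
  proof -
    have in_ball: "x0 + r *\<^sub>R axis j 1 \<in> cball x0 r" "x0 - r *\<^sub>R axis j 1 \<in> cball x0 r"
      using r by (auto simp: dist_norm)
    have "\<bar>(M *v ((x0 + r *\<^sub>R axis j 1) - (x0 - r *\<^sub>R axis j 1))) $ i\<bar>
        \<le> norm (M *v ((x0 + r *\<^sub>R axis j 1) - (x0 - r *\<^sub>R axis j 1)))"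
      by (rule component_le_norm_cart)
    also have "\<dots> \<le> S"
      using in_ball ball by (intro 2) auto
    also have "(x0 + r *\<^sub>R axis j 1) - (x0 - r *\<^sub>R axis j 1) = (2 * r) *\<^sub>R axis j 1"
      by (simp add: algebra_simps flip: scaleR_2)
    also have "(M *v ((2 * r) *\<^sub>R axis j 1)) $ i = 2 * r * M $ i $ j"
      by (simp add: matrix_vector_mult_scaleR matrix_vector_mul_component inner_axis)
    finally show ?thesis using r by (simp add: abs_mult field_simps)
  qed
  have "norm M \<le> (\<Sum>i\<in>UNIV. norm (M $ i))"
    by (simp add: norm_vec_def L2_set_le_sum)
  also have "\<dots> \<le> (\<Sum>i\<in>(UNIV::'n set). \<Sum>j\<in>(UNIV::'n set). S / (2 * r))"
    by (intro sum_mono order_trans[OF norm_le_l1_cart] entry)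
  finally show ?thesis by (simp add: power2_eq_square)
qed

text \<open>An element \<open>T\<close> with vertices \<open>V\<close>, diameter at most \<open>h\<close> and inscribed radius \<open>r\<close>, together with the gradient
  \<open>A\<close> of the affine map that interpolates \<open>f\<close> at \<open>V\<close>.\<close>

locale coarse_element = pw_affine_field T F f G osc e
  for T :: "(real^'n) set" and F f G osc e +
  fixes V :: "(real^'n) set" and x0 r h \<kappa> and A :: "real^'n^'n"
  assumes dim: "CARD('n) \<in> {1, 2}"
    and finite_V: "finite V" and card_V: "card V \<le> 3" and T_hull: "T = convex hull V"
    and V_far: "\<And>v. v \<in> V \<Longrightarrow> v \<notin> ball x0 r"
    and inball: "cball x0 r \<subseteq> T" and r_pos: "r > 0"
    and diam_T: "\<And>x y. x \<in> T \<Longrightarrow> y \<in> T \<Longrightarrow> norm (x - y) \<le> h"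
    and e_le_h: "e \<le> h" and shape: "h \<le> \<kappa> * r" and kappa: "\<kappa> \<ge> 1"
    and A: "\<And>v v'. v \<in> V \<Longrightarrow> v' \<in> V \<Longrightarrow> A *v (v - v') = f v - f v'"
    and osc_meas: "osc \<in> borel_measurable borel"
    and osc_nonneg': "\<And>x. osc x \<ge> 0"
begin

lemma h_pos: "h > 0" using e_pos e_le_h by simp

text \<open>Dividing any segment of \<open>T\<close> into this many parts gives steps no longer than \<open>e / 6\<close>.\<close>

definition m :: nat where "m = nat \<lceil>6 * h / e\<rceil>"

lemma m_pos: "m > 0" and m_ge: "6 * h \<le> real m * e" and m_le: "real m * e \<le> 7 * h"
proof -
  have "0 < 6 * h / e" using h_pos e_pos by simp
  then have c: "real m = of_int \<lceil>6 * h / e\<rceil>" unfolding m_def by simp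
  have "6 * h / e \<le> real m" unfolding c by (rule le_of_int_ceiling)
  then show "6 * h \<le> real m * e" using e_pos by (simp add: field_simps)
  then show "m > 0" using h_pos by (cases "m = 0") auto
  have "real m \<le> 6 * h / e + 1" unfolding c by (rule of_int_ceiling_le_add_one)
  then have "real m * e \<le> 6 * h + e" using e_pos by (simp add: field_simps)
  then show "real m * e \<le> 7 * h" using e_le_h by simp
qed

lemma step_ok: "x \<in> T \<Longrightarrow> z \<in> T \<Longrightarrow> norm (z - x) \<le> real m * e / 6"
  using diam_T[of z x] m_ge by simp

lemma V_subset: "V \<subseteq> T" unfolding T_hull by (rule hull_subset)

text \<open>The bound of the Taylor remainder from \<open>z\<close>, added over all vertices and indexed by the number \<open>k\<close> of steps
  that separate a division point from the vertex.\<close>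

definition vertex_remainders :: "real^'n \<Rightarrow> real" where
  "vertex_remainders z = (\<Sum>v\<in>V. 2 * e\<^sup>2 * (\<Sum>k=1..m. real k * osc (v + (real k / real m) *\<^sub>R (z - v))))"

lemma vertex_remainders_nonneg: "vertex_remainders z \<ge> 0"
  unfolding vertex_remainders_def using osc_nonneg' by (intro sum_nonneg mult_nonneg_nonneg) auto

lemma remainder_le:
  assumes "z \<in> T" "E \<in> F" "z \<in> E" "v \<in> V"
  shows "norm (f v - f z - G E *v (v - z))
    \<le> 2 * e\<^sup>2 * (\<Sum>k=1..m. real k * osc (v + (real k / real m) *\<^sub>R (z - v)))"
proof -
  have v: "v \<in> T" using assms V_subset by auto
  have "norm (f v - f z - G E *v (v - z)) \<le> 2 * e\<^sup>2 * (\<Sum>j<m. real (m - j) * osc (division_pt m z v j))"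
    using assms v m_pos step_ok by (intro taylor_remainder_le) auto
  also have "(\<Sum>j<m. real (m - j) * osc (division_pt m z v j))
      = (\<Sum>k=1..m. real k * osc (v + (real k / real m) *\<^sub>R (z - v)))"
  proof (rule sum.reindex_bij_witness[of _ "\<lambda>k. m - k" "\<lambda>j. m - j"])
    fix j assume j: "j \<in> {..<m}"
    have "v + (real (m - j) / real m) *\<^sub>R (z - v) = division_pt m z v j"
      using j by (simp add: division_pt_def of_nat_diff diff_divide_distrib algebra_simps)
    then show "real (m - j) * osc (v + (real (m - j) / real m) *\<^sub>R (z - v))
        = real (m - j) * osc (division_pt m z v j)" by simp
  qed auto
  finally show ?thesis .
qed

text \<open>On the difference of two vertices \<open>A\<close> reproduces the difference of the values of \<open>f\<close>, hence
  \<open>A - G E\<close> maps it to the difference of the two Taylor remainders.\<close>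

lemma gradient_error_le:
  assumes z: "z \<in> T" "E \<in> F" "z \<in> E"
  shows "norm (A - G E) \<le> 2 * vertex_remainders z / r"
proof -
  define R where "R v = f v - f z - G E *v (v - z)" for v
  define b where "b v = 2 * e\<^sup>2 * (\<Sum>k=1..m. real k * osc (v + (real k / real m) *\<^sub>R (z - v)))" for v
  have Rb: "norm (R v) \<le> b v" if "v \<in> V" for v
    unfolding R_def b_def using remainder_le[OF z that] .
  have b0: "b v \<ge> 0" for v
    unfolding b_def using osc_nonneg' by (intro sum_nonneg mult_nonneg_nonneg) auto
  have "norm ((A - G E) *v (v - v')) \<le> vertex_remainders z" if v: "v \<in> V" "v' \<in> V" for v v'
  proof (cases "v = v'")
    case True
    then show ?thesis using vertex_remainders_nonneg by simp
  next
    case False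
    have "(A - G E) *v (v - v') = R v - R v'"
      using A[OF v] by (simp add: R_def matrix_vector_mult_diff_rdistrib matrix_vector_mult_diff_distrib)
    also have "norm \<dots> \<le> norm (R v) + norm (R v')"
      by (rule norm_triangle_ineq4)
    also have "\<dots> \<le> b v + b v'" using Rb v by (intro add_mono) auto
    also have "\<dots> = (\<Sum>u\<in>{v, v'}. b u)" using False by simp
    also have "\<dots> \<le> (\<Sum>u\<in>V. b u)" using v finite_V b0 by (intro sum_mono2) auto
    finally show ?thesis by (simp add: vertex_remainders_def b_def)
  qed
  then have "norm (A - G E) \<le> (real CARD('n))\<^sup>2 * (vertex_remainders z / (2 * r))"
    using inball r_pos unfolding T_hull by (intro norm_matrix_le_inball) auto
  also have "\<dots> \<le> 4 * (vertex_remainders z / (2 * r))"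
    using dim vertex_remainders_nonneg[of z] r_pos by (intro mult_right_mono) auto
  finally show ?thesis by simp
qed

lemma gradient_error_sup:
  assumes z: "z \<in> T" "E \<in> F" "z \<in> E" and M: "\<And>x. osc x \<le> M"
  shows "norm (A - G E) \<le> 588 * \<kappa> * h * M"
proof -
  have M0: "M \<ge> 0" using M[of z] osc_nonneg'[of z] by linarith
  have "vertex_remainders z \<le> (\<Sum>v\<in>V. 2 * e\<^sup>2 * (\<Sum>k=1..m. real m * M))"
    unfolding vertex_remainders_def using M osc_nonneg' M0
    by (intro sum_mono mult_left_mono mult_mono) auto
  also have "\<dots> = real (card V) * (2 * (real m * e)\<^sup>2 * M)"
    by (simp add: power2_eq_square mult_ac)
  also have "\<dots> \<le> 3 * (2 * (7 * h)\<^sup>2 * M)"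
  proof -
    have "(real m * e)\<^sup>2 \<le> (7 * h)\<^sup>2"
      using m_le e_pos by (intro power_mono) auto
    then have "2 * (real m * e)\<^sup>2 * M \<le> 2 * (7 * h)\<^sup>2 * M"
      using M0 by (intro mult_right_mono) auto
    then show ?thesis
      by (rule mult_mono[rotated]) (use card_V M0 in auto)
  qed
  also have "\<dots> = 294 * h\<^sup>2 * M" by (simp add: power2_eq_square)
  finally have vertex_remainders: "vertex_remainders z \<le> 294 * h\<^sup>2 * M" .
  have "norm (A - G E) \<le> 2 * vertex_remainders z / r" by (rule gradient_error_le[OF z])
  also have "\<dots> \<le> 2 * (294 * h\<^sup>2 * M) / r"
    using vertex_remainders r_pos by (intro divide_right_mono mult_left_mono) auto
  also have "\<dots> = 588 * (h / r) * h * M" by (simp add: power2_eq_square)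
  also have "\<dots> \<le> 588 * \<kappa> * h * M"
    using shape r_pos h_pos M0 by (intro mult_right_mono) (auto simp: field_simps)
  finally show ?thesis .
qed

text \<open>Half the inscribed ball: its points have distance at least \<open>r / 2\<close> from every vertex.\<close>

definition core_ball where "core_ball = cball x0 (r / 2)"

lemma core_ball_subset: "core_ball \<subseteq> T"
  using inball r_pos unfolding core_ball_def by (auto simp: subset_iff)

text \<open>The summation is over those \<open>k\<close> for which \<open>w\<close> is the point at fraction \<open>k / m\<close> of the way from \<open>v\<close> to some
  point of the ball. Since distances from \<open>v\<close> to the ball range between \<open>r / 2\<close> and \<open>h\<close>, two
  such \<open>k\<close> differ by a factor of at most \<open>2 \<kappa>\<close>. For \<open>d = 1\<close> at most \<open>m\<close> terms equal to \<open>m\<close> are added. For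
  \<open>d = 2\<close> one adds \<open>m\<^sup>2 / k\<close> over a range of bounded ratio, which is at most the number of terms times
  the largest one; over the full range the harmonic sum would be a logarithm.\<close>

lemma scales_le:
  assumes v: "v \<in> V"
  shows "(\<Sum>k=1..m. real k * (real m / real k) ^ CARD('n) * indicator core_ball (v + (real m / real k) *\<^sub>R (w - v)))
    \<le> 2 * \<kappa> * (real m)\<^sup>2 * indicator T w"
proof -
  define J where "J = {k\<in>{1..m}. v + (real m / real k) *\<^sub>R (w - v) \<in> core_ball}"
  have fin: "finite J" unfolding J_def by auto
  have eq: "(\<Sum>k=1..m. real k * (real m / real k) ^ CARD('n) * indicator core_ball (v + (real m / real k) *\<^sub>R (w - v)))
      = (\<Sum>k\<in>J. real k * (real m / real k) ^ CARD('n))"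
    unfolding J_def by (rule sum.mono_neutral_cong_right) (auto simp: indicator_def)
  show ?thesis
  proof (cases "J = {}")
    case True
    then show ?thesis using eq kappa by (simp add: indicator_def)
  next
    case False
    \<comment> \<open>the smallest admissible scale, to which all the others are compared\<close>
    define k0 where "k0 = Min J"
    have k0: "k0 \<in> J" unfolding k0_def using False fin by simp
    have k0_le: "k0 \<le> k" if "k \<in> J" for k unfolding k0_def using fin that by simp
    have k0_pos: "k0 \<ge> 1" using k0 by (auto simp: J_def)
    have w: "w \<in> T"
    proof -
      let ?z = "v + (real m / real k0) *\<^sub>R (w - v)"
      have z: "?z \<in> T" using k0 core_ball_subset by (auto simp: J_def)
      have "w = (1 - real k0 / real m) *\<^sub>R v + (real k0 / real m) *\<^sub>R ?z"
        using k0_pos m_pos by (simp add: algebra_simps)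
      also have "\<dots> \<in> T"
        using v V_subset z k0 convex by (intro convexD) (auto simp: J_def)
      finally show ?thesis .
    qed
    have range: "r / 2 \<le> real m / real k * norm (w - v)" "real m / real k * norm (w - v) \<le> h"
      if k: "k \<in> J" for k
    proof -
      let ?z = "v + (real m / real k) *\<^sub>R (w - v)"
      have z: "?z \<in> core_ball" using k by (auto simp: J_def)
      have n: "norm (?z - v) = real m / real k * norm (w - v)"
        by simp
      have "norm (?z - v) \<le> h" using z core_ball_subset v V_subset by (intro diam_T) auto
      then show "real m / real k * norm (w - v) \<le> h" using n by simp
      have "r \<le> dist x0 v" using V_far[OF v] by (simp add: not_less)
      also have "\<dots> \<le> dist x0 ?z + dist ?z v" by (rule dist_triangle)
      also have "dist x0 ?z \<le> r / 2" using z by (simp add: core_ball_def)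
      finally have "r / 2 \<le> dist ?z v" by simp
      then show "r / 2 \<le> real m / real k * norm (w - v)" using n by (simp add: dist_norm)
    qed
    have kk: "real k \<le> 2 * \<kappa> * real k0" if k: "k \<in> J" for k
    proof -
      have kp: "k \<ge> 1" using k by (auto simp: J_def)
      have "r / 2 * real k \<le> real m * norm (w - v)"
        using range(1)[OF k] kp by (simp add: field_simps)
      also have "\<dots> \<le> h * real k0"
        using range(2)[OF k0] k0_pos by (simp add: field_simps)
      also have "\<dots> \<le> \<kappa> * r * real k0"
        using shape by (intro mult_right_mono) auto
      finally have "r * (real k) \<le> r * (2 * \<kappa> * real k0)" by (simp add: mult_ac)
      then show ?thesis using r_pos by simp
    qed
    have m2: "real m \<le> (real m)\<^sup>2 * 1" "0 \<le> (real m)\<^sup>2" using m_pos by (auto simp: power2_eq_square)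
    have "(\<Sum>k\<in>J. real k * (real m / real k) ^ CARD('n)) \<le> 2 * \<kappa> * (real m)\<^sup>2"
    proof (cases "CARD('n) = 1")
      case True
      have "(\<Sum>k\<in>J. real k * (real m / real k) ^ CARD('n)) = (\<Sum>k\<in>J. real m)"
        using True by (intro sum.cong) (auto simp: J_def)
      also have "\<dots> \<le> real m * real m"
      proof -
        have "card J \<le> card {1..m}" unfolding J_def by (intro card_mono) auto
        then show ?thesis by (simp add: mult_right_mono)
      qed
      also have "\<dots> \<le> 2 * \<kappa> * (real m)\<^sup>2"
        using kappa m2 mult_right_mono[of 1 "2 * \<kappa>" "(real m)\<^sup>2"] by (simp add: power2_eq_square)
      finally show ?thesis .
    next
      case False
      with dim have d: "CARD('n) = 2" by auto
      have "(\<Sum>k\<in>J. real k * (real m / real k) ^ CARD('n)) = (\<Sum>k\<in>J. (real m)\<^sup>2 * (1 / real k))"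
        using d by (intro sum.cong) (auto simp: J_def power2_eq_square)
      also have "\<dots> \<le> (\<Sum>k\<in>J. (real m)\<^sup>2 * (1 / real k0))"
        using k0_le k0_pos by (intro sum_mono mult_left_mono frac_le) auto
      also have "\<dots> = real (card J) * ((real m)\<^sup>2 / real k0)" by simp
      also have "\<dots> \<le> (2 * \<kappa> * real k0) * ((real m)\<^sup>2 / real k0)"
      proof (intro mult_right_mono)
        have "J \<subseteq> {1..nat \<lfloor>2 * \<kappa> * real k0\<rfloor>}"
          using kk by (auto simp: J_def le_nat_floor)
        then have "card J \<le> card {1..nat \<lfloor>2 * \<kappa> * real k0\<rfloor>}" by (intro card_mono) auto
        then have "real (card J) \<le> real (nat \<lfloor>2 * \<kappa> * real k0\<rfloor>)" by simp
        also have "\<dots> \<le> 2 * \<kappa> * real k0" using kappa by (intro of_nat_floor) auto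
        finally show "real (card J) \<le> 2 * \<kappa> * real k0" .
      qed auto
      also have "\<dots> = 2 * \<kappa> * (real m)\<^sup>2" using k0_pos by simp
      finally show ?thesis .
    qed
    then show ?thesis using eq w by simp
  qed
qed

lemma T_borel [measurable]: "T \<in> sets borel" and T_compact: "compact T"
proof -
  show "compact T" unfolding T_hull using finite_V by (simp add: compact_convex_hull finite_imp_compact)
  then show "T \<in> sets borel" by (intro borel_compact)
qed

lemma core_ball_borel [measurable]: "core_ball \<in> sets borel"
  unfolding core_ball_def by simp

lemma vertex_remainders_measurable [measurable]: "vertex_remainders \<in> borel_measurable borel"
proof -
  note osc_meas[measurable]
  show ?thesis unfolding vertex_remainders_def by measurable
qed

text \<open>For each vertex \<open>v\<close> and each \<open>k\<close>, substitute \<open>w = v + (k / m) (z - v)\<close>. The Jacobians are the powers that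
  \<open>scales_le\<close> sums.\<close>

lemma integral_vertex_remainders_le:
  "(\<integral>\<^sup>+z. ennreal (indicator core_ball z * vertex_remainders z) \<partial>lborel)
    \<le> ennreal (588 * \<kappa> * h\<^sup>2) * (\<integral>\<^sup>+w. ennreal (indicator T w * osc w) \<partial>lborel)"
proof -
  note osc_meas[measurable]
  define Q where "Q v k w = indicator core_ball (v + (real m / real k) *\<^sub>R (w - v)) * osc w" for v w and k :: nat
  have [measurable]: "Q v k \<in> borel_measurable borel" for v k
    unfolding Q_def by measurable
  have Q0: "Q v k w \<ge> 0" for v k w unfolding Q_def using osc_nonneg' by simp
  let ?I = "\<integral>\<^sup>+w. ennreal (indicator T w * osc w) \<partial>lborel"
  have one: "(\<Sum>k=1..m. ennreal (real k) * (\<integral>\<^sup>+z. ennreal (indicator core_ball z * osc (v + (real k / real m) *\<^sub>R (z - v))) \<partial>lborel))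
      \<le> ennreal (2 * \<kappa> * (real m)\<^sup>2) * ?I" if v: "v \<in> V" for v
  proof -
    have "(\<integral>\<^sup>+z. ennreal (indicator core_ball z * osc (v + (real k / real m) *\<^sub>R (z - v))) \<partial>lborel)
        = ennreal ((real m / real k) ^ CARD('n)) * (\<integral>\<^sup>+w. ennreal (Q v k w) \<partial>lborel)"
      if k: "k \<in> {1..m}" for k
    proof -
      let ?c = "real k / real m"
      have "ennreal (indicator core_ball z * osc (v + ?c *\<^sub>R (z - v))) = ennreal (Q v k ((v - ?c *\<^sub>R v) + ?c *\<^sub>R z))" for z
      proof -
        have eq: "(v - ?c *\<^sub>R v) + ?c *\<^sub>R z = v + ?c *\<^sub>R (z - v)" by (simp add: algebra_simps)
        show ?thesis using k m_pos unfolding Q_def eq by simp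
      qed
      then show ?thesis
        using k m_pos nn_integral_lborel_affine[of "\<lambda>w. ennreal (Q v k w)" ?c "v - ?c *\<^sub>R v"] by simp
    qed
    then have "(\<Sum>k=1..m. ennreal (real k) * (\<integral>\<^sup>+z. ennreal (indicator core_ball z * osc (v + (real k / real m) *\<^sub>R (z - v))) \<partial>lborel))
        = (\<Sum>k=1..m. \<integral>\<^sup>+w. ennreal (real k * (real m / real k) ^ CARD('n) * Q v k w) \<partial>lborel)"
      by (intro sum.cong) (auto simp: nn_integral_cmult[symmetric] ennreal_mult' mult.assoc)
    also have "\<dots> = (\<integral>\<^sup>+w. (\<Sum>k=1..m. ennreal (real k * (real m / real k) ^ CARD('n) * Q v k w)) \<partial>lborel)"
      by (rule nn_integral_sum[symmetric]) simp
    also have "\<dots> \<le> (\<integral>\<^sup>+w. ennreal (2 * \<kappa> * (real m)\<^sup>2) * ennreal (indicator T w * osc w) \<partial>lborel)"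
    proof (rule nn_integral_mono)
      fix w
      have "(\<Sum>k=1..m. ennreal (real k * (real m / real k) ^ CARD('n) * Q v k w))
          = ennreal (\<Sum>k=1..m. real k * (real m / real k) ^ CARD('n) * Q v k w)"
        using Q0 by (intro sum_ennreal) auto
      also have "(\<Sum>k=1..m. real k * (real m / real k) ^ CARD('n) * Q v k w)
          = (\<Sum>k=1..m. real k * (real m / real k) ^ CARD('n) * indicator core_ball (v + (real m / real k) *\<^sub>R (w - v))) * osc w"
        unfolding sum_distrib_right Q_def by (simp add: mult_ac)
      also have "ennreal \<dots> \<le> ennreal ((2 * \<kappa> * (real m)\<^sup>2 * indicator T w) * osc w)"
        using osc_nonneg' scales_le[OF v] by (intro ennreal_leI mult_right_mono) auto
      also have "\<dots> = ennreal (2 * \<kappa> * (real m)\<^sup>2) * ennreal (indicator T w * osc w)"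
        using kappa osc_nonneg' by (subst ennreal_mult'[symmetric]) (auto simp: mult_ac)
      finally show "(\<Sum>k=1..m. ennreal (real k * (real m / real k) ^ CARD('n) * Q v k w))
          \<le> ennreal (2 * \<kappa> * (real m)\<^sup>2) * ennreal (indicator T w * osc w)" .
    qed
    also have "\<dots> = ennreal (2 * \<kappa> * (real m)\<^sup>2) * ?I"
      by (rule nn_integral_cmult) simp
    finally show ?thesis .
  qed
  have "(\<integral>\<^sup>+z. ennreal (indicator core_ball z * vertex_remainders z) \<partial>lborel)
      = (\<integral>\<^sup>+z. (\<Sum>v\<in>V. ennreal (2 * e\<^sup>2) * (\<Sum>k=1..m. ennreal (real k) * ennreal (indicator core_ball z * osc (v + (real k / real m) *\<^sub>R (z - v))))) \<partial>lborel)"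
  proof (rule nn_integral_cong)
    fix z
    have "indicator core_ball z * vertex_remainders z = (\<Sum>v\<in>V. 2 * e\<^sup>2 * (\<Sum>k=1..m. real k * (indicator core_ball z * osc (v + (real k / real m) *\<^sub>R (z - v)))))"
      unfolding vertex_remainders_def by (simp add: sum_distrib_left mult_ac)
    then show "ennreal (indicator core_ball z * vertex_remainders z) = (\<Sum>v\<in>V. ennreal (2 * e\<^sup>2) * (\<Sum>k=1..m. ennreal (real k) * ennreal (indicator core_ball z * osc (v + (real k / real m) *\<^sub>R (z - v)))))"
      using osc_nonneg'
      by (simp add: sum_ennreal[symmetric] ennreal_mult' sum_nonneg del: sum_ennreal)
  qed
  also have "\<dots> = (\<Sum>v\<in>V. ennreal (2 * e\<^sup>2) * (\<Sum>k=1..m. ennreal (real k) * (\<integral>\<^sup>+z. ennreal (indicator core_ball z * osc (v + (real k / real m) *\<^sub>R (z - v))) \<partial>lborel)))"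
    by (simp add: nn_integral_sum nn_integral_cmult)
  also have "\<dots> \<le> (\<Sum>v\<in>V. ennreal (2 * e\<^sup>2) * (ennreal (2 * \<kappa> * (real m)\<^sup>2) * ?I))"
    using one by (intro sum_mono mult_left_mono) auto
  also have "\<dots> = ennreal (real (card V) * (2 * e\<^sup>2 * (2 * \<kappa> * (real m)\<^sup>2))) * ?I"
    using kappa by (simp only: ennreal_mult_assoc sum_constant ennreal_of_nat_eq_real_of_nat
        mult_nonneg_nonneg zero_le_power2 of_nat_0_le_iff zero_le_numeral)
  also have "\<dots> \<le> ennreal (588 * \<kappa> * h\<^sup>2) * ?I"
  proof (intro mult_right_mono ennreal_leI)
    have "(real m * e)\<^sup>2 \<le> (7 * h)\<^sup>2"
      using m_le e_pos by (intro power_mono) auto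
    then have "4 * \<kappa> * (real m * e)\<^sup>2 \<le> 4 * \<kappa> * (7 * h)\<^sup>2"
      using kappa by (intro mult_left_mono) auto
    then have "real (card V) * (4 * \<kappa> * (real m * e)\<^sup>2) \<le> 3 * (4 * \<kappa> * (7 * h)\<^sup>2)"
      using card_V kappa by (intro mult_mono) auto
    then show "real (card V) * (2 * e\<^sup>2 * (2 * \<kappa> * (real m)\<^sup>2)) \<le> 588 * \<kappa> * h\<^sup>2"
      by (simp add: power2_eq_square mult_ac)
  qed auto
  finally show ?thesis .
qed

text \<open>At the division point one of \<open>x\<close> and \<open>z\<close> has weight at least one half. Integrating over that variable first,
  the substitution costs a factor of at most \<open>2\<^sup>d\<close>.\<close>

lemma integral_segments_le:
  fixes \<phi> :: "real^'n \<Rightarrow> ennreal"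
  assumes [measurable]: "\<phi> \<in> borel_measurable borel" and i: "i < m"
  shows "(\<integral>\<^sup>+x. \<integral>\<^sup>+z. indicator T x * indicator core_ball z * \<phi> (division_pt m x z i) \<partial>lborel \<partial>lborel)
    \<le> 4 * emeasure lborel T * (\<integral>\<^sup>+w. \<phi> w \<partial>lborel)"
proof -
  define t where "t = real i / real m"
  have t: "0 \<le> t" "t < 1" using i m_pos by (auto simp: t_def)
  have division_pt: "division_pt m x z i = (1 - t) *\<^sub>R x + t *\<^sub>R z" for x z
    by (simp add: division_pt_def t_def algebra_simps)
  have half: "(1 / c) ^ CARD('n) \<le> 4" if "c \<ge> 1 / 2" for c :: real
  proof -
    have "1 / c \<le> 2" using that by (simp add: field_simps)
    then have "(1 / c) ^ CARD('n) \<le> 2 ^ CARD('n)" using that by (intro power_mono) auto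
    then show ?thesis using dim by auto
  qed
  have scale: "(\<integral>\<^sup>+x. \<phi> (a + c *\<^sub>R x) \<partial>lborel) \<le> 4 * (\<integral>\<^sup>+w. \<phi> w \<partial>lborel)" if c: "c \<ge> 1 / 2" for a c
  proof -
    have "(\<integral>\<^sup>+x. \<phi> (a + c *\<^sub>R x) \<partial>lborel) = ennreal ((1 / c) ^ CARD('n)) * (\<integral>\<^sup>+w. \<phi> w \<partial>lborel)"
      using c nn_integral_lborel_affine[of \<phi> c a] by simp
    also have "\<dots> \<le> ennreal 4 * (\<integral>\<^sup>+w. \<phi> w \<partial>lborel)"
      using half[OF c] by (intro mult_right_mono ennreal_leI) auto
    finally show ?thesis by simp
  qed
  show ?thesis
  proof (cases "t \<le> 1 / 2")
    case True
    have "(\<integral>\<^sup>+x. \<integral>\<^sup>+z. indicator T x * indicator core_ball z * \<phi> (division_pt m x z i) \<partial>lborel \<partial>lborel)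
      = (\<integral>\<^sup>+z. \<integral>\<^sup>+x. indicator T x * indicator core_ball z * \<phi> (division_pt m x z i) \<partial>lborel \<partial>lborel)"
      unfolding division_pt by (rule lborel_pair.Fubini') measurable
    also have "\<dots> \<le> (\<integral>\<^sup>+z. indicator core_ball z * (4 * (\<integral>\<^sup>+w. \<phi> w \<partial>lborel)) \<partial>lborel)"
    proof (rule nn_integral_mono)
      fix z
      have "(\<integral>\<^sup>+x. indicator T x * indicator core_ball z * \<phi> (division_pt m x z i) \<partial>lborel)
          \<le> (\<integral>\<^sup>+x. indicator core_ball z * \<phi> (t *\<^sub>R z + (1 - t) *\<^sub>R x) \<partial>lborel)"
        by (intro nn_integral_mono) (auto simp: division_pt indicator_def add.commute)
      also have "\<dots> = indicator core_ball z * (\<integral>\<^sup>+x. \<phi> (t *\<^sub>R z + (1 - t) *\<^sub>R x) \<partial>lborel)"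
        by (rule nn_integral_cmult) measurable
      also have "\<dots> \<le> indicator core_ball z * (4 * (\<integral>\<^sup>+w. \<phi> w \<partial>lborel))"
        using True by (intro mult_left_mono scale) auto
      finally show "(\<integral>\<^sup>+x. indicator T x * indicator core_ball z * \<phi> (division_pt m x z i) \<partial>lborel)
          \<le> indicator core_ball z * (4 * (\<integral>\<^sup>+w. \<phi> w \<partial>lborel))" .
    qed
    also have "\<dots> = emeasure lborel core_ball * (4 * (\<integral>\<^sup>+w. \<phi> w \<partial>lborel))"
      by (subst nn_integral_multc) auto
    also have "\<dots> \<le> emeasure lborel T * (4 * (\<integral>\<^sup>+w. \<phi> w \<partial>lborel))"
      using core_ball_subset by (intro mult_right_mono emeasure_mono) auto
    finally show ?thesis by (simp add: mult_ac)
  next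
    case False
    have "(\<integral>\<^sup>+x. \<integral>\<^sup>+z. indicator T x * indicator core_ball z * \<phi> (division_pt m x z i) \<partial>lborel \<partial>lborel)
        \<le> (\<integral>\<^sup>+x. indicator T x * (4 * (\<integral>\<^sup>+w. \<phi> w \<partial>lborel)) \<partial>lborel)"
    proof (rule nn_integral_mono)
      fix x
      have "(\<integral>\<^sup>+z. indicator T x * indicator core_ball z * \<phi> (division_pt m x z i) \<partial>lborel)
          \<le> (\<integral>\<^sup>+z. indicator T x * \<phi> ((1 - t) *\<^sub>R x + t *\<^sub>R z) \<partial>lborel)"
        by (intro nn_integral_mono) (auto simp: division_pt indicator_def)
      also have "\<dots> = indicator T x * (\<integral>\<^sup>+z. \<phi> ((1 - t) *\<^sub>R x + t *\<^sub>R z) \<partial>lborel)"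
        by (rule nn_integral_cmult) measurable
      also have "\<dots> \<le> indicator T x * (4 * (\<integral>\<^sup>+w. \<phi> w \<partial>lborel))"
        using False by (intro mult_left_mono scale) auto
      finally show "(\<integral>\<^sup>+z. indicator T x * indicator core_ball z * \<phi> (division_pt m x z i) \<partial>lborel)
          \<le> indicator T x * (4 * (\<integral>\<^sup>+w. \<phi> w \<partial>lborel))" .
    qed
    also have "\<dots> = emeasure lborel T * (4 * (\<integral>\<^sup>+w. \<phi> w \<partial>lborel))"
      by (subst nn_integral_multc) auto
    finally show ?thesis by (simp add: mult_ac)
  qed
qed

definition \<tau> where "\<tau> = measure lborel T"
definition \<beta> where "\<beta> = measure lborel core_ball"

lemma
  shows T_vol: "emeasure lborel T = ennreal \<tau>" and core_ball_vol: "emeasure lborel core_ball = ennreal \<beta>"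
    and tau_pos: "\<tau> > 0" and beta_pos: "\<beta> > 0" and tau_le: "\<tau> \<le> 4 * \<kappa>\<^sup>2 * \<beta>"
proof -
  have finT: "emeasure lborel T < \<infinity>" using T_compact emeasure_compact_finite by blast
  show T: "emeasure lborel T = ennreal \<tau>" using finT by (simp add: \<tau>_def emeasure_eq_ennreal_measure)
  have "emeasure lborel core_ball \<le> emeasure lborel T" using core_ball_subset by (intro emeasure_mono) auto
  with finT have "emeasure lborel core_ball < \<infinity>" by (rule le_less_trans[rotated])
  then show core_ball: "emeasure lborel core_ball = ennreal \<beta>" by (simp add: \<beta>_def emeasure_eq_ennreal_measure)
  have le: "\<beta> \<le> \<tau>" using \<open>emeasure lborel core_ball \<le> emeasure lborel T\<close> T core_ball
    by (simp add: ennreal_le_iff \<tau>_def)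
  let ?u = "unit_ball_vol (real CARD('n))"
  have u: "?u > 0" by simp
  have b: "\<beta> = ?u * (r / 2) ^ CARD('n)"
    unfolding \<beta>_def core_ball_def using r_pos content_cball[of "r / 2" x0] by simp
  then show pos: "\<beta> > 0" using r_pos by simp
  with le show "\<tau> > 0" by simp
  have "T \<subseteq> cball x0 h"
  proof
    fix x assume "x \<in> T"
    moreover have "x0 \<in> T" using inball r_pos by auto
    ultimately show "x \<in> cball x0 h" using diam_T[of x0 x] by (simp add: dist_norm)
  qed
  then have "\<tau> \<le> measure lborel (cball x0 h)"
    unfolding \<tau>_def using emeasure_compact_finite[of "cball x0 h"]
    by (intro measure_mono_fmeasurable) (auto simp: fmeasurable_def)
  also have "\<dots> = ?u * h ^ CARD('n)"
    using h_pos content_cball[of h x0] by simp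
  also have "\<dots> \<le> ?u * ((2 * \<kappa>) * (r / 2)) ^ CARD('n)"
    using shape h_pos u by (intro mult_left_mono power_mono) auto
  also have "\<dots> = (2 * \<kappa>) ^ CARD('n) * \<beta>"
    unfolding power_mult_distrib b by simp
  also have "\<dots> \<le> 4 * \<kappa>\<^sup>2 * \<beta>"
  proof (rule mult_right_mono)
    have "(2 * \<kappa>) ^ CARD('n) \<le> (2 * \<kappa>) ^ 2"
      using dim kappa by (intro power_increasing) auto
    then show "(2 * \<kappa>) ^ CARD('n) \<le> 4 * \<kappa>\<^sup>2" by (simp add: power2_eq_square)
  qed (use pos in auto)
  finally show "\<tau> \<le> 4 * \<kappa>\<^sup>2 * \<beta>" .
qed

text \<open>Compare \<open>A\<close> with \<open>G E\<close> by way of the gradient at a variable point \<open>z\<close> of the ball, and integrate over \<open>z\<close>.\<close>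

lemma gradient_error_split:
  assumes x: "x \<in> T" "E \<in> F" "x \<in> E"
  shows "ennreal (norm (A - G E)) * ennreal \<beta>
    \<le> ennreal (1176 * \<kappa>\<^sup>2 * h) * (\<integral>\<^sup>+w. ennreal (indicator T w * osc w) \<partial>lborel)
      + (\<integral>\<^sup>+z. ennreal (indicator core_ball z * (e * (\<Sum>i<m. osc (division_pt m x z i)))) \<partial>lborel)"
proof -
  note osc_meas[measurable]
  let ?g = "norm (A - G E)"
  have "ennreal ?g * ennreal \<beta> = (\<integral>\<^sup>+z. ennreal ?g * indicator core_ball z \<partial>lborel)"
    by (simp add: nn_integral_cmult_indicator core_ball_vol)
  also have "\<dots> \<le> (\<integral>\<^sup>+z. ennreal (2 / r) * ennreal (indicator core_ball z * vertex_remainders z)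
      + ennreal (indicator core_ball z * (e * (\<Sum>i<m. osc (division_pt m x z i)))) \<partial>lborel)"
  proof (rule nn_integral_mono)
    fix z
    show "ennreal ?g * indicator core_ball z \<le> ennreal (2 / r) * ennreal (indicator core_ball z * vertex_remainders z)
      + ennreal (indicator core_ball z * (e * (\<Sum>i<m. osc (division_pt m x z i))))"
    proof (cases "z \<in> core_ball")
      case True
      then have z: "z \<in> T" using core_ball_subset by auto
      with cover obtain E' where E': "E' \<in> F" "z \<in> E'" by auto
      have "?g \<le> norm (A - G E') + norm (G E' - G E)"
        by (metis diff_add_cancel add_diff_eq norm_triangle_ineq)
      also have "\<dots> \<le> 2 * vertex_remainders z / r + e * (\<Sum>i<m. osc (division_pt m x z i))"
        using gradient_error_le[OF z E'] gradient_diff_le[OF x(1) z m_pos step_ok[OF x(1) z] x(2,3) E']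
        by (rule add_mono)
      finally have "ennreal ?g \<le> ennreal (2 * vertex_remainders z / r + e * (\<Sum>i<m. osc (division_pt m x z i)))"
        by (rule ennreal_leI)
      also have "\<dots> = ennreal (2 / r) * ennreal (vertex_remainders z) + ennreal (e * (\<Sum>i<m. osc (division_pt m x z i)))"
        using r_pos vertex_remainders_nonneg[of z] e_pos osc_nonneg'
        by (subst ennreal_plus) (auto simp: ennreal_mult'[symmetric] sum_nonneg)
      finally show ?thesis using True by simp
    qed simp
  qed
  also have "\<dots> = ennreal (2 / r) * (\<integral>\<^sup>+z. ennreal (indicator core_ball z * vertex_remainders z) \<partial>lborel)
      + (\<integral>\<^sup>+z. ennreal (indicator core_ball z * (e * (\<Sum>i<m. osc (division_pt m x z i)))) \<partial>lborel)"
    unfolding division_pt_def by (subst nn_integral_add) (auto simp: nn_integral_cmult)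
  also have "ennreal (2 / r) * (\<integral>\<^sup>+z. ennreal (indicator core_ball z * vertex_remainders z) \<partial>lborel)
      \<le> ennreal (2 / r) * (ennreal (588 * \<kappa> * h\<^sup>2) * (\<integral>\<^sup>+w. ennreal (indicator T w * osc w) \<partial>lborel))"
    by (intro mult_left_mono integral_vertex_remainders_le) auto
  also have "\<dots> = ennreal (2 / r * (588 * \<kappa> * h\<^sup>2)) * (\<integral>\<^sup>+w. ennreal (indicator T w * osc w) \<partial>lborel)"
    using r_pos kappa by (intro ennreal_mult_assoc) auto
  also have "\<dots> \<le> ennreal (1176 * \<kappa>\<^sup>2 * h) * (\<integral>\<^sup>+w. ennreal (indicator T w * osc w) \<partial>lborel)"
  proof (intro mult_right_mono ennreal_leI)
    have "2 / r * (588 * \<kappa> * h\<^sup>2) = 1176 * \<kappa> * h * (h / r)"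
      by (simp add: power2_eq_square)
    also have "\<dots> \<le> 1176 * \<kappa> * h * \<kappa>"
      using shape r_pos kappa h_pos by (intro mult_left_mono) (auto simp: field_simps)
    finally show "2 / r * (588 * \<kappa> * h\<^sup>2) \<le> 1176 * \<kappa>\<^sup>2 * h"
      by (simp add: power2_eq_square mult_ac)
  qed auto
  finally show ?thesis by (simp add: add_right_mono)
qed

lemma average_le:
  "e * (\<Sum>i<m. osc (division_pt m x z i)) \<le> 7 * h * ((\<Sum>i<m. osc (division_pt m x z i)) / real m)"
proof -
  have "e * (\<Sum>i<m. osc (division_pt m x z i)) = (real m * e) * ((\<Sum>i<m. osc (division_pt m x z i)) / real m)"
    using m_pos by simp
  also have "\<dots> \<le> 7 * h * ((\<Sum>i<m. osc (division_pt m x z i)) / real m)"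
    using m_le osc_nonneg' by (intro mult_right_mono divide_nonneg_nonneg sum_nonneg) auto
  finally show ?thesis .
qed

text \<open>The two terms of the preceding estimate after Jensen's inequality: the first comes from the mean of
  \<open>osc\<close> over \<open>T\<close>, the second from its mean over the segments that join \<open>x\<close> to the ball.\<close>

definition \<Gamma> :: "real \<Rightarrow> real^'n \<Rightarrow> ennreal" where
  "\<Gamma> p x = ennreal (1 / \<tau>) * (\<integral>\<^sup>+w. ennreal (indicator T w * (9408 * \<kappa>^4 * h * osc w) powr p) \<partial>lborel)
     + ennreal ((14 * h) powr p / (real m * \<beta>))
       * (\<Sum>i<m. \<integral>\<^sup>+z. ennreal (indicator core_ball z * osc (division_pt m x z i) powr p) \<partial>lborel)"

lemma gradient_error_powr_le:
  assumes p: "p \<ge> 1" and x: "x \<in> T" "E \<in> F" "x \<in> E"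
  shows "ennreal (norm (A - G E) powr p) \<le> \<Gamma> p x"
proof -
  note osc_meas[measurable]
  let ?g = "norm (A - G E)"
  let ?D = "\<lambda>z. e * (\<Sum>i<m. osc (division_pt m x z i))"
  let ?I1 = "ennreal (1176 * \<kappa>\<^sup>2 * h) * (\<integral>\<^sup>+w. ennreal (indicator T w * osc w) \<partial>lborel)"
  let ?I2 = "\<integral>\<^sup>+z. ennreal (indicator core_ball z * ?D z) \<partial>lborel"
  have D0: "?D z \<ge> 0" for z using e_pos osc_nonneg' by (intro mult_nonneg_nonneg sum_nonneg) auto
  have [measurable]: "(\<lambda>z. osc (division_pt m x z i)) \<in> borel_measurable borel" for i
    unfolding division_pt_def by measurable
  have cancel: "a \<le> ennreal (1 / c) * b" if "a * ennreal c \<le> b" "c > 0" for a b c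
  proof -
    have "a = ennreal (1 / c) * (a * ennreal c)"
    proof -
      have "ennreal (1 / c) * (a * ennreal c) = (ennreal (1 / c) * ennreal c) * a" by (simp add: mult_ac)
      also have "ennreal (1 / c) * ennreal c = 1" using that(2) by (simp add: ennreal_mult'[symmetric])
      finally show ?thesis by simp
    qed
    also have "\<dots> \<le> ennreal (1 / c) * b" using that(1) by (rule mult_left_mono) simp
    finally show ?thesis .
  qed
  \<comment> \<open>one of the two terms accounts for at least half of the bound\<close>
  consider "ennreal ?g * ennreal \<beta> \<le> 2 * ?I1" | "ennreal ?g * ennreal \<beta> \<le> 2 * ?I2"
  proof -
    have "?I1 + ?I2 \<le> 2 * max ?I1 ?I2" by (simp add: mult_2 add_mono)
    with gradient_error_split[OF x] have "ennreal ?g * ennreal \<beta> \<le> 2 * max ?I1 ?I2" by (rule order_trans)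
    then show ?thesis using that by (auto simp: max_def split: if_splits)
  qed
  then show ?thesis
  proof cases
    case 1
    \<comment> \<open>pass from the volume of the ball to that of \<open>T\<close>, where \<open>osc\<close> is averaged\<close>
    have "ennreal ?g * ennreal \<tau> \<le> ennreal ?g * ennreal (4 * \<kappa>\<^sup>2 * \<beta>)"
      by (intro mult_left_mono ennreal_leI tau_le) auto
    also have "\<dots> = ennreal (4 * \<kappa>\<^sup>2) * (ennreal ?g * ennreal \<beta>)"
      by (subst ennreal_mult') (simp_all only: mult_ac zero_le_power2 mult_nonneg_nonneg zero_le_numeral)
    also have "\<dots> \<le> ennreal (4 * \<kappa>\<^sup>2) * (2 * ?I1)"
      using 1 by (rule mult_left_mono) simp
    also have "\<dots> = ennreal (4 * \<kappa>\<^sup>2) * (ennreal 2 * ?I1)" by simp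
    also have "\<dots> = ennreal (4 * \<kappa>\<^sup>2 * (2 * (1176 * \<kappa>\<^sup>2 * h))) * (\<integral>\<^sup>+w. ennreal (indicator T w * osc w) \<partial>lborel)"
      using h_pos by (simp only: ennreal_mult_assoc mult_nonneg_nonneg zero_le_power2 zero_le_numeral less_imp_le)
    also have "4 * \<kappa>\<^sup>2 * (2 * (1176 * \<kappa>\<^sup>2 * h)) = 9408 * \<kappa>^4 * h"
      by (simp add: power2_eq_square power4_eq_xxxx)
    also have "ennreal (9408 * \<kappa>^4 * h) * (\<integral>\<^sup>+w. ennreal (indicator T w * osc w) \<partial>lborel)
        = (\<integral>\<^sup>+w. ennreal (indicator T w * (9408 * \<kappa>^4 * h * osc w)) \<partial>lborel)"
      using kappa h_pos osc_nonneg'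
      by (subst nn_integral_cmult[symmetric])
        (auto intro!: nn_integral_cong simp: ennreal_mult'[symmetric] mult_ac)
    finally have "ennreal ?g * ennreal \<tau> \<le> (\<integral>\<^sup>+w. ennreal (indicator T w * (9408 * \<kappa>^4 * h * osc w)) \<partial>lborel)" .
    then have "ennreal (?g powr p) * ennreal \<tau>
        \<le> (\<integral>\<^sup>+w. ennreal (indicator T w * (9408 * \<kappa>^4 * h * osc w) powr p) \<partial>lborel)"
      using kappa h_pos osc_nonneg' by (intro Jensen_powr_set p T_vol) auto
    from cancel[OF this tau_pos] show ?thesis unfolding \<Gamma>_def by (rule order_trans) simp
  next
    case 2
    have "ennreal ?g * ennreal \<beta> \<le> ennreal 2 * ?I2" using 2 by simp
    also have "ennreal 2 * ?I2 = (\<integral>\<^sup>+z. ennreal (indicator core_ball z * (2 * ?D z)) \<partial>lborel)"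
    proof (subst nn_integral_cmult[symmetric])
      have "ennreal 2 * ennreal (indicator core_ball z * ?D z) = ennreal (indicator core_ball z * (2 * ?D z))" for z
        by (subst ennreal_mult'[symmetric]) (simp_all only: mult_ac zero_le_numeral)
      then show "(\<integral>\<^sup>+z. ennreal 2 * ennreal (indicator core_ball z * ?D z) \<partial>lborel)
          = (\<integral>\<^sup>+z. ennreal (indicator core_ball z * (2 * ?D z)) \<partial>lborel)" by (simp only:)
    qed measurable
    finally have "ennreal (?g powr p) * ennreal \<beta>
        \<le> (\<integral>\<^sup>+z. ennreal (indicator core_ball z * (2 * ?D z) powr p) \<partial>lborel)"
      using D0 by (intro Jensen_powr_set p core_ball_vol) auto
    also have "\<dots> \<le> (\<integral>\<^sup>+z. ennreal ((14 * h) powr p / real m)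
        * (\<Sum>i<m. ennreal (indicator core_ball z * osc (division_pt m x z i) powr p)) \<partial>lborel)"
    proof (rule nn_integral_mono)
      fix z
      let ?s = "\<Sum>i<m. osc (division_pt m x z i)"
      have s0: "?s \<ge> 0" using osc_nonneg' by (intro sum_nonneg) auto
      have "(2 * ?D z) powr p \<le> (14 * h * (?s / real m)) powr p"
        using average_le[of x z] D0[of z] p by (intro powr_mono2) auto
      also have "\<dots> = (14 * h) powr p * (?s / real m) powr p"
        by (rule powr_mult)
      also have "\<dots> \<le> (14 * h) powr p * ((\<Sum>i<m. osc (division_pt m x z i) powr p) / real m)"
        using Jensen_powr_sum[OF p, of "{..<m}" "\<lambda>i. osc (division_pt m x z i)"] osc_nonneg' m_pos
        by (intro mult_left_mono) (auto simp: lessThan_empty_iff)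
      finally have "indicator core_ball z * (2 * ?D z) powr p
          \<le> (14 * h) powr p / real m * (\<Sum>i<m. indicator core_ball z * osc (division_pt m x z i) powr p)"
        by (simp add: indicator_def)
      then have "ennreal (indicator core_ball z * (2 * ?D z) powr p)
          \<le> ennreal ((14 * h) powr p / real m * (\<Sum>i<m. indicator core_ball z * osc (division_pt m x z i) powr p))"
        by (rule ennreal_leI)
      also have "\<dots> = ennreal ((14 * h) powr p / real m)
        * (\<Sum>i<m. ennreal (indicator core_ball z * osc (division_pt m x z i) powr p))"
        by (subst sum_ennreal, simp, rule ennreal_mult', simp)
      finally show "ennreal (indicator core_ball z * (2 * ?D z) powr p)
          \<le> ennreal ((14 * h) powr p / real m)
            * (\<Sum>i<m. ennreal (indicator core_ball z * osc (division_pt m x z i) powr p))" .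
    qed
    also have "\<dots> = ennreal ((14 * h) powr p / real m)
        * (\<integral>\<^sup>+z. (\<Sum>i<m. ennreal (indicator core_ball z * osc (division_pt m x z i) powr p)) \<partial>lborel)"
      by (rule nn_integral_cmult) measurable
    also have "(\<integral>\<^sup>+z. (\<Sum>i<m. ennreal (indicator core_ball z * osc (division_pt m x z i) powr p)) \<partial>lborel)
        = (\<Sum>i<m. \<integral>\<^sup>+z. ennreal (indicator core_ball z * osc (division_pt m x z i) powr p) \<partial>lborel)"
      by (rule nn_integral_sum) measurable
    finally have "ennreal (?g powr p) \<le> ennreal (1 / \<beta>) * (ennreal ((14 * h) powr p / real m)
        * (\<Sum>i<m. \<integral>\<^sup>+z. ennreal (indicator core_ball z * osc (division_pt m x z i) powr p) \<partial>lborel))"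
      using beta_pos by (rule cancel)
    also have "\<dots> = ennreal ((14 * h) powr p / (real m * \<beta>))
        * (\<Sum>i<m. \<integral>\<^sup>+z. ennreal (indicator core_ball z * osc (division_pt m x z i) powr p) \<partial>lborel)"
      using beta_pos by (subst ennreal_mult_assoc) (auto simp: mult_ac)
    finally show ?thesis unfolding \<Gamma>_def by (rule order_trans) simp
  qed
qed

lemma \<Gamma>_measurable [measurable]: "\<Gamma> p \<in> borel_measurable borel"
proof -
  note osc_meas[measurable]
  show ?thesis unfolding \<Gamma>_def division_pt_def by measurable
qed

text \<open>The numerical factors combine to a single \<open>p\<close>-th power, by \<open>c \<le> c\<^sup>p\<close> for \<open>c \<ge> 1\<close> and
  \<open>a\<^sup>p + b\<^sup>p \<le> (a + b)\<^sup>p\<close>; this keeps the constant uniform in \<open>p\<close>.\<close>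

lemma integral_\<Gamma>_le:
  assumes p: "p \<ge> 1"
  shows "(\<integral>\<^sup>+x. indicator T x * \<Gamma> p x \<partial>lborel)
    \<le> ennreal ((9632 * \<kappa>^4 * h) powr p) * (\<integral>\<^sup>+w. ennreal (indicator T w * osc w powr p) \<partial>lborel)"
proof -
  note osc_meas[measurable]
  let ?I = "\<integral>\<^sup>+w. ennreal (indicator T w * osc w powr p) \<partial>lborel"
  let ?J = "\<lambda>i x. \<integral>\<^sup>+z. ennreal (indicator core_ball z * osc (division_pt m x z i) powr p) \<partial>lborel"
  have [measurable]: "?J i \<in> borel_measurable borel" for i
    unfolding division_pt_def by measurable
  have k: "(9408 * \<kappa>^4 * h) > 0" using kappa h_pos by simp
  have first: "(\<integral>\<^sup>+w. ennreal (indicator T w * (9408 * \<kappa>^4 * h * osc w) powr p) \<partial>lborel)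
      = ennreal ((9408 * \<kappa>^4 * h) powr p) * ?I"
    using k osc_nonneg' kappa h_pos
    by (subst nn_integral_cmult[symmetric])
      (auto intro!: nn_integral_cong simp: ennreal_mult'[symmetric] powr_mult mult_ac)
  have second: "(\<integral>\<^sup>+x. indicator T x * ?J i x \<partial>lborel) \<le> ennreal (4 * \<tau>) * ?I" if i: "i < m" for i
  proof -
    let ?\<phi> = "\<lambda>w. ennreal (indicator T w * osc w powr p)"
    have "(\<integral>\<^sup>+x. indicator T x * ?J i x \<partial>lborel)
        = (\<integral>\<^sup>+x. \<integral>\<^sup>+z. indicator T x * indicator core_ball z * ?\<phi> (division_pt m x z i) \<partial>lborel \<partial>lborel)"
    proof (rule nn_integral_cong)
      fix x
      show "indicator T x * ?J i x = (\<integral>\<^sup>+z. indicator T x * indicator core_ball z * ?\<phi> (division_pt m x z i) \<partial>lborel)"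
      proof (cases "x \<in> T")
        case True
        have "division_pt m x z i \<in> T" if "z \<in> core_ball" for z
          using True that core_ball_subset i m_pos by (intro division_pt_in) auto
        then show ?thesis using True by (auto intro!: nn_integral_cong simp: indicator_def)
      qed simp
    qed
    also have "\<dots> \<le> 4 * emeasure lborel T * (\<integral>\<^sup>+w. ?\<phi> w \<partial>lborel)"
      using i by (intro integral_segments_le) measurable
    finally show ?thesis using tau_pos by (simp add: T_vol ennreal_mult')
  qed
  have "(\<integral>\<^sup>+x. indicator T x * \<Gamma> p x \<partial>lborel)
      = (\<integral>\<^sup>+x. ennreal (1 / \<tau>) * (ennreal ((9408 * \<kappa>^4 * h) powr p) * ?I) * indicator T x
        + ennreal ((14 * h) powr p / (real m * \<beta>)) * (\<Sum>i<m. indicator T x * ?J i x) \<partial>lborel)"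
    unfolding \<Gamma>_def first by (intro nn_integral_cong) (simp add: algebra_simps sum_distrib_left)
  also have "\<dots> = (\<integral>\<^sup>+x. ennreal (1 / \<tau>) * (ennreal ((9408 * \<kappa>^4 * h) powr p) * ?I) * indicator T x \<partial>lborel)
      + (\<integral>\<^sup>+x. ennreal ((14 * h) powr p / (real m * \<beta>)) * (\<Sum>i<m. indicator T x * ?J i x) \<partial>lborel)"
    by (rule nn_integral_add) measurable
  also have "(\<integral>\<^sup>+x. ennreal (1 / \<tau>) * (ennreal ((9408 * \<kappa>^4 * h) powr p) * ?I) * indicator T x \<partial>lborel)
      = ennreal (1 / \<tau>) * (ennreal ((9408 * \<kappa>^4 * h) powr p) * ?I) * ennreal \<tau>"
    by (subst nn_integral_cmult_indicator) (auto simp: T_vol)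
  also have "(\<integral>\<^sup>+x. ennreal ((14 * h) powr p / (real m * \<beta>)) * (\<Sum>i<m. indicator T x * ?J i x) \<partial>lborel)
      = ennreal ((14 * h) powr p / (real m * \<beta>)) * (\<integral>\<^sup>+x. (\<Sum>i<m. indicator T x * ?J i x) \<partial>lborel)"
    by (rule nn_integral_cmult) measurable
  also have "(\<integral>\<^sup>+x. (\<Sum>i<m. indicator T x * ?J i x) \<partial>lborel)
      = (\<Sum>i<m. (\<integral>\<^sup>+x. indicator T x * ?J i x \<partial>lborel))"
    by (rule nn_integral_sum) measurable
  also have "ennreal (1 / \<tau>) * (ennreal ((9408 * \<kappa>^4 * h) powr p) * ?I) * ennreal \<tau>
      = (ennreal (1 / \<tau>) * ennreal \<tau>) * (ennreal ((9408 * \<kappa>^4 * h) powr p) * ?I)"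
    by (simp only: mult_ac)
  also have "ennreal (1 / \<tau>) * ennreal \<tau> = 1"
    using tau_pos by (simp add: ennreal_mult'[symmetric])
  also have "ennreal ((14 * h) powr p / (real m * \<beta>)) * (\<Sum>i<m. (\<integral>\<^sup>+x. indicator T x * ?J i x \<partial>lborel))
      \<le> ennreal ((14 * h) powr p / (real m * \<beta>)) * (\<Sum>i<m. ennreal (4 * \<tau>) * ?I)"
    using second by (intro mult_left_mono sum_mono) auto
  also have "\<dots> = ennreal ((14 * h) powr p / (real m * \<beta>)) * (ennreal (real m) * (ennreal (4 * \<tau>) * ?I))"
    by (simp add: ennreal_of_nat_eq_real_of_nat)
  also have "\<dots> = ennreal ((14 * h) powr p / (real m * \<beta>) * (real m * (4 * \<tau>))) * ?I"
    using tau_pos beta_pos by (subst ennreal_mult_assoc, simp, simp, subst ennreal_mult_assoc) auto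
  also have "\<dots> \<le> ennreal ((14 * h) powr p * (16 * \<kappa>\<^sup>2)) * ?I"
  proof (intro mult_right_mono ennreal_leI)
    have "(14 * h) powr p / (real m * \<beta>) * (real m * (4 * \<tau>)) = (14 * h) powr p * (4 * (\<tau> / \<beta>))"
      using m_pos beta_pos by (simp add: field_simps)
    also have "\<dots> \<le> (14 * h) powr p * (16 * \<kappa>\<^sup>2)"
      using tau_le beta_pos by (intro mult_left_mono) (auto simp: field_simps)
    finally show "(14 * h) powr p / (real m * \<beta>) * (real m * (4 * \<tau>)) \<le> (14 * h) powr p * (16 * \<kappa>\<^sup>2)" .
  qed auto
  also have "1 * (ennreal ((9408 * \<kappa>^4 * h) powr p) * ?I) + ennreal ((14 * h) powr p * (16 * \<kappa>\<^sup>2)) * ?I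
      = ennreal ((9408 * \<kappa>^4 * h) powr p + (14 * h) powr p * (16 * \<kappa>\<^sup>2)) * ?I"
    by (simp add: distrib_right)
  also have "\<dots> \<le> ennreal ((9632 * \<kappa>^4 * h) powr p) * ?I"
  proof (intro mult_right_mono ennreal_leI)
    have "1 \<le> 16 * \<kappa>\<^sup>2" using one_le_power[OF kappa, of 2] by linarith
    then have "16 * \<kappa>\<^sup>2 \<le> (16 * \<kappa>\<^sup>2) powr p"
      using p powr_mono[of 1 p "16 * \<kappa>\<^sup>2"] by simp
    then have "(14 * h) powr p * (16 * \<kappa>\<^sup>2) \<le> (14 * h) powr p * (16 * \<kappa>\<^sup>2) powr p"
      by (intro mult_left_mono) auto
    also have "\<dots> = (14 * h * (16 * \<kappa>\<^sup>2)) powr p"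
      by (rule powr_mult[symmetric])
    also have "\<dots> \<le> (224 * \<kappa>^4 * h) powr p"
    proof (intro powr_mono2)
      have "\<kappa>\<^sup>2 \<le> \<kappa>^4" using kappa by (intro power_increasing) auto
      then show "14 * h * (16 * \<kappa>\<^sup>2) \<le> 224 * \<kappa>^4 * h" using h_pos by simp
    qed (use p h_pos in auto)
    finally have "(9408 * \<kappa>^4 * h) powr p + (14 * h) powr p * (16 * \<kappa>\<^sup>2)
        \<le> (9408 * \<kappa>^4 * h) powr p + (224 * \<kappa>^4 * h) powr p" by simp
    also have "\<dots> \<le> (9408 * \<kappa>^4 * h + 224 * \<kappa>^4 * h) powr p"
    proof -
      have superadd: "a powr p + b powr p \<le> (a + b) powr p" if "a > 0" "b > 0" for a b :: real
      proof -
        have "a * a powr (p - 1) + b * b powr (p - 1) \<le> a * (a + b) powr (p - 1) + b * (a + b) powr (p - 1)"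
          using that p by (intro add_mono mult_left_mono powr_mono2) auto
        also have "\<dots> = (a + b) * (a + b) powr (p - 1)" by (simp add: algebra_simps)
        finally show ?thesis using that by (simp add: powr_diff)
      qed
      show ?thesis using kappa h_pos by (intro superadd) auto
    qed
    finally show "(9408 * \<kappa>^4 * h) powr p + (14 * h) powr p * (16 * \<kappa>\<^sup>2) \<le> (9632 * \<kappa>^4 * h) powr p"
      by (simp add: algebra_simps)
  qed auto
  finally show ?thesis by (simp add: add_left_mono)
qed

lemma gradient_error_Lp:
  assumes "p \<ge> 1"
  shows "\<exists>g. g \<in> borel_measurable borel \<and>
    (\<forall>x\<in>T. \<forall>E\<in>F. x \<in> E \<longrightarrow> ennreal (norm (A - G E) powr p) \<le> g x) \<and>
    (\<integral>\<^sup>+x. indicator T x * g x \<partial>lborel)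
      \<le> ennreal ((9632 * \<kappa>^4 * h) powr p) * (\<integral>\<^sup>+w. ennreal (indicator T w * osc w powr p) \<partial>lborel)"
  using assms \<Gamma>_measurable gradient_error_powr_le integral_\<Gamma>_le
  by (intro exI[of _ "\<Gamma> p"]) auto

end

section \<open>Regular triangulations and their interpolants\<close>

lemma simplex_vertices:
  fixes T :: "(real^'n) set"
  assumes "int CARD('n) simplex T"
  shows "finite (vertices_of T)" "\<not> affine_dependent (vertices_of T)"
    "card (vertices_of T) = CARD('n) + 1" "T = convex hull (vertices_of T)"
proof -
  obtain C where C: "finite C" "\<not> affine_dependent C" "int (card C) = int CARD('n) + 1" "T = convex hull C"
    using assms by (auto simp: simplex)
  have "vertices_of T = C"
    unfolding vertices_of_def C(4) using extreme_point_of_convex_hull_affine_independent[OF C(2)] by auto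
  with C show "finite (vertices_of T)" "\<not> affine_dependent (vertices_of T)"
    "card (vertices_of T) = CARD('n) + 1" "T = convex hull (vertices_of T)" by auto
qed

lemma simplex_interior:
  fixes T :: "(real^'n) set"
  assumes "int CARD('n) simplex T"
  shows "interior T \<noteq> {}"
proof -
  have "T \<noteq> {}"
    using simplex_vertices(3,4)[OF assms] by (metis card.empty convex_hull_eq_empty nat_arith.rule0 add_is_0 one_neq_zero)
  then have "rel_interior T \<noteq> {}"
    using convex_simplex[OF assms] by (simp add: rel_interior_eq_empty)
  moreover have "aff_dim T = int DIM(real^'n)"
    using aff_dim_simplex[OF assms] by simp
  ultimately show ?thesis by (simp add: interior_rel_interior_gen)
qed

lemma simplex_closure_interior:
  fixes T :: "(real^'n) set"
  assumes "int CARD('n) simplex T"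
  shows "closure (interior T) = T"
  using convex_closure_interior[OF convex_simplex[OF assms] simplex_interior[OF assms]]
    closed_simplex[OF assms] by simp

lemma affine_eq_on_hull:
  fixes A A' :: "real^'n^'m"
  assumes "\<And>x. x \<in> W \<Longrightarrow> A *v x + b = A' *v x + b'" "x \<in> convex hull W"
  shows "A *v x + b = A' *v x + b'"
proof -
  have "convex {x. A *v x + b = A' *v x + b'}"
  proof -
    have "{x. A *v x + b = A' *v x + b'} = (\<lambda>x. (A - A') *v x) -` {b' - b}"
      by (auto simp: matrix_vector_mult_diff_rdistrib algebra_simps)
    then show ?thesis by (simp add: convex_linear_vimage)
  qed
  then have "convex hull W \<subseteq> {x. A *v x + b = A' *v x + b'}"
    using assms(1) by (intro hull_minimal) auto
  then show ?thesis using assms(2) by auto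
qed

lemma affine_independent_interpolation:
  fixes C :: "(real^'n) set" and v :: "real^'n \<Rightarrow> real^'m"
  assumes C: "\<not> affine_dependent C"
  shows "\<exists>(A :: real^'n^'m) b. \<forall>x\<in>C. A *v x + b = v x"
proof (cases "C = {}")
  case False
  then obtain a where a: "a \<in> C" by auto
  let ?D = "(\<lambda>x. -a + x) ` (C - {a})"
  have "independent ?D" using C a by (simp add: affine_dependent_iff_dependent2)
  then obtain g where g: "linear g" "\<And>d. d \<in> ?D \<Longrightarrow> g d = v (a + d) - v a"
    using linear_independent_extend[of ?D "\<lambda>d. v (a + d) - v a"] by blast
  have "matrix g *v x + (v a - g a) = v x" if x: "x \<in> C" for x
  proof (cases "x = a")
    case True
    then show ?thesis using g(1) by (simp add: matrix_works)
  next
    case False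
    have "g x - g a = g (-a + x)" using linear_diff[OF g(1), of x a] by simp
    also have "\<dots> = v (a + (-a + x)) - v a" using x False by (intro g(2)) auto
    finally show ?thesis using g(1) by (simp add: matrix_works algebra_simps)
  qed
  then show ?thesis by blast
qed auto

lemma regular_triangulationD:
  assumes "regular_triangulation S \<T>"
  shows "T \<in> \<T> \<Longrightarrow> int CARD('n) simplex (T :: (real^'n) set)"
    "T \<in> \<T> \<Longrightarrow> T' \<in> \<T> \<Longrightarrow> (T \<inter> T') face_of T"
    "bounded B \<Longrightarrow> finite {T\<in>\<T>. T \<inter> B \<noteq> {}}"
    "\<Union>\<T> = S"
  using assms by (auto simp: regular_triangulation_def)

text \<open>A face that reaches the interior of an element is the whole element. Applied to the intersection of the
  two elements, this gives one inclusion, and then the other.\<close>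

lemma triangulation_interiors_disjoint:
  fixes \<T> :: "(real^'n) set set"
  assumes tri: "regular_triangulation S \<T>" and T: "T \<in> \<T>" "T' \<in> \<T>"
    and meet: "interior T \<inter> T' \<noteq> {}"
  shows "T = T'"
proof -
  note D = regular_triangulationD[OF tri]
  have sub: "K \<subseteq> K'" if "K \<in> \<T>" "K' \<in> \<T>" "interior K \<inter> K' \<noteq> {}" for K K'
  proof -
    have "(K \<inter> K') \<inter> rel_interior K \<noteq> {}"
    proof -
      obtain x where "x \<in> interior K" "x \<in> K'" using \<open>interior K \<inter> K' \<noteq> {}\<close> by auto
      then have "x \<in> rel_interior K" "x \<in> K"
        using interior_subset_rel_interior[of K] interior_subset[of K] by auto
      then show ?thesis using \<open>x \<in> K'\<close> by auto
    qed
    then have "K \<subseteq> K \<inter> K'"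
      using subset_of_face_of[OF D(2)[OF that(1,2)] order_refl] by simp
    then show ?thesis by auto
  qed
  have 1: "T \<subseteq> T'" by (rule sub[OF T meet])
  then have "interior T \<subseteq> interior T'" by (rule interior_mono)
  moreover have "interior T \<noteq> {}" using D(1)[OF T(1)] by (rule simplex_interior)
  ultimately have "interior T' \<inter> T \<noteq> {}" using interior_subset[of T] by auto
  then have "T' \<subseteq> T" by (rule sub[OF T(2,1)])
  with 1 show ?thesis by auto
qed

text \<open>The affine pieces on two elements agree on the common face: it is the convex hull of its extreme points
  (Krein-Milman), and these are vertices of both elements. Near a given point only finitely many closed
  elements matter, so the glued function is continuous.\<close>

lemma interpolant_exists:
  fixes \<T> :: "(real^'n) set set" and v :: "real^'n \<Rightarrow> real^'n"
  assumes tri: "regular_triangulation UNIV \<T>"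
  shows "\<exists>w. pw_affine_interpolant \<T> v w"
proof -
  note D = regular_triangulationD[OF tri]
  have "\<exists>(A::real^'n^'n) b. \<forall>x\<in>vertices_of T. A *v x + b = v x" if "T \<in> \<T>" for T
    using affine_independent_interpolation[OF simplex_vertices(2)[OF D(1)[OF that]]] .
  then obtain A :: "(real^'n) set \<Rightarrow> real^'n^'n" and b where
    Ab: "\<And>T x. T \<in> \<T> \<Longrightarrow> x \<in> vertices_of T \<Longrightarrow> A T *v x + b T = v x" by metis
  have agree: "A T *v x + b T = A T' *v x + b T'" if T: "T \<in> \<T>" "T' \<in> \<T>" and x: "x \<in> T" "x \<in> T'" for T T' x
  proof -
    have comp: "compact (T \<inter> T')" "convex (T \<inter> T')"
      using T by (auto intro!: compact_Int convex_Int intro: compact_simplex convex_simplex D(1))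
    define W where "W = {u. u extreme_point_of (T \<inter> T')}"
    have ext: "A T *v u + b T = A T' *v u + b T'" if u: "u \<in> W" for u
    proof -
      have "u extreme_point_of T" "u extreme_point_of T'"
        using u extreme_point_of_face[OF D(2)[OF T(1,2)], of u]
          extreme_point_of_face[OF D(2)[OF T(2,1)], of u] by (simp_all add: W_def Int_commute)
      then show ?thesis using Ab T by (simp add: vertices_of_def)
    qed
    have "x \<in> convex hull W"
      using x Krein_Milman_Minkowski[OF comp] unfolding W_def by blast
    with ext show ?thesis by (rule affine_eq_on_hull)
  qed
  define K where "K x = (SOME T. T \<in> \<T> \<and> x \<in> T)" for x
  have K: "K x \<in> \<T> \<and> x \<in> K x" for x
  proof -
    have "x \<in> \<Union>\<T>" using D(4) by simp
    then have "\<exists>T. T \<in> \<T> \<and> x \<in> T" by blast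
    then show ?thesis unfolding K_def by (rule someI_ex)
  qed
  define w where "w x = A (K x) *v x + b (K x)" for x
  have w: "w x = A T *v x + b T" if "T \<in> \<T>" "x \<in> T" for T x
    unfolding w_def using K[of x] that by (metis agree)
  have "continuous (at x0) w" for x0
  proof -
    let ?S = "{T\<in>\<T>. T \<inter> ball x0 1 \<noteq> {}}"
    have "continuous_on (\<Union>T\<in>?S. T) w"
    proof (rule continuous_on_closed_Union)
      show "finite ?S" by (rule D(3)) simp
      show "closed T" if "T \<in> ?S" for T using that D(1) closed_simplex by blast
      show "continuous_on T w" if T: "T \<in> ?S" for T
      proof -
        have "continuous_on T (\<lambda>x. A T *v x + b T)"
          by (intro continuous_intros matrix_vector_mult_linear_continuous_on)
        then show ?thesis using w T by (auto cong: continuous_on_cong)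
      qed
    qed
    moreover have "ball x0 1 \<subseteq> (\<Union>T\<in>?S. T)" using K by blast
    ultimately have "continuous_on (ball x0 1) w" by (rule continuous_on_subset)
    then show ?thesis by (simp add: continuous_on_eq_continuous_at)
  qed
  then have "continuous_on UNIV w" by (simp add: continuous_at_imp_continuous_on)
  moreover have "\<forall>T\<in>\<T>. \<forall>x\<in>vertices_of T. w x = v x"
  proof (intro ballI)
    fix T x assume T: "T \<in> \<T>" "x \<in> vertices_of T"
    then have "x \<in> T" by (simp add: vertices_of_def extreme_point_of_def)
    then show "w x = v x" using w[OF T(1)] Ab[OF T] by simp
  qed
  ultimately have "pw_affine_interpolant \<T> v w"
    unfolding pw_affine_interpolant_def using w by blast
  then show ?thesis by blast
qed

lemma interpolant_unique:
  fixes \<T> :: "(real^'n) set set" and v :: "real^'n \<Rightarrow> real^'n"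
  assumes tri: "regular_triangulation UNIV \<T>"
    and w: "pw_affine_interpolant \<T> v w" and w': "pw_affine_interpolant \<T> v w'"
  shows "w = w'"
proof
  fix x
  note D = regular_triangulationD[OF tri]
  obtain T where T: "T \<in> \<T>" "x \<in> T" using D(4) by auto
  have "\<exists>(A :: real^'n^'n) b. \<forall>x\<in>T. w x = A *v x + b" "\<exists>(A :: real^'n^'n) b. \<forall>x\<in>T. w' x = A *v x + b"
    using w w' T(1) by (simp_all add: pw_affine_interpolant_def)
  then obtain A A' :: "real^'n^'n" and b b' where
    A: "\<And>x. x \<in> T \<Longrightarrow> w x = A *v x + b" and A': "\<And>x. x \<in> T \<Longrightarrow> w' x = A' *v x + b'"
    by auto
  have sub: "vertices_of T \<subseteq> T" by (auto simp: vertices_of_def extreme_point_of_def)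
  have "w u = w' u" if "u \<in> vertices_of T" for u
    using w w' T that unfolding pw_affine_interpolant_def by simp
  then have "A *v u + b = A' *v u + b'" if "u \<in> vertices_of T" for u
    using that A[of u] A'[of u] sub by auto
  then have "A *v x + b = A' *v x + b'"
    using T(2) simplex_vertices(4)[OF D(1)[OF T(1)]] affine_eq_on_hull[of "vertices_of T"] by blast
  then show "w x = w' x" using A A' T by simp
qed

lemma interp_interpolant:
  assumes "regular_triangulation UNIV \<T>"
  shows "pw_affine_interpolant \<T> v (interp \<T> v)"
  unfolding interp_def
  using interpolant_exists[OF assms] interpolant_unique[OF assms] by (metis theI)

section \<open>The fine mesh\<close>

text \<open>The fine elements are the cells cut out by the hyperplanes on which a functional \<open>l\<close> in \<open>L\<close> takes a
  multiple of \<open>e\<close> as its value: the coordinates and, in the plane, one functional that is constant along the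
  diagonals.\<close>

definition cell :: "real \<Rightarrow> (real^'n) set \<Rightarrow> (real^'n \<Rightarrow> int) \<Rightarrow> (real^'n) set" where
  "cell e L c = {x. \<forall>l\<in>L. e * of_int (c l) \<le> l \<bullet> x \<and> l \<bullet> x \<le> e * (of_int (c l) + 1)}"

lemma convex_cell: "convex (cell e L c)"
proof -
  have "cell e L c = (\<Inter>l\<in>L. {x. l \<bullet> x \<ge> e * of_int (c l)} \<inter> {x. l \<bullet> x \<le> e * (of_int (c l) + 1)})"
    by (auto simp: cell_def)
  then show ?thesis
    by (auto intro!: convex_INT convex_Int convex_halfspace_le convex_halfspace_ge)
qed

text \<open>Each slab of the second cell meets the first cell in all of it, in one of its two bounding hyperplanes,
  or not at all. In each case this is a face, and faces are closed under intersection.\<close>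

lemma cell_Int_face:
  assumes e: "e > 0" and L: "L \<noteq> {}"
  shows "(cell e L c \<inter> cell e L c') face_of cell e L c"
proof -
  let ?T = "cell e L c"
  define F where "F l = {x\<in>?T. e * of_int (c' l) \<le> l \<bullet> x \<and> l \<bullet> x \<le> e * (of_int (c' l) + 1)}" for l
  have F: "F l face_of ?T" if l: "l \<in> L" for l
  proof -
    have T: "e * of_int (c l) \<le> l \<bullet> x \<and> l \<bullet> x \<le> e * (of_int (c l) + 1)" if "x \<in> ?T" for x
      using that l by (auto simp: cell_def)
    consider "c' l = c l" | "c' l = c l + 1" | "c' l = c l - 1" | "c' l \<ge> c l + 2" | "c' l \<le> c l - 2"
      by linarith
    then show ?thesis
    proof cases
      case 1
      then have "F l = ?T" using T by (auto simp: F_def)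
      then show ?thesis by (simp add: face_of_refl convex_cell)
    next
      case 2
      have "F l = ?T \<inter> {x. l \<bullet> x = e * (of_int (c l) + 1)}"
        using T 2 e by (auto simp: F_def algebra_simps intro: antisym)
      then show ?thesis
        using T by (simp add: face_of_Int_supporting_hyperplane_le convex_cell)
    next
      case 3
      have "F l = ?T \<inter> {x. l \<bullet> x = e * of_int (c l)}"
      proof -
        have "e * of_int (c' l) = e * of_int (c l) - e" by (simp add: 3 algebra_simps)
        then show ?thesis using T e by (force simp: F_def distrib_left)
      qed
      then show ?thesis
        using T by (simp add: face_of_Int_supporting_hyperplane_ge convex_cell)
    next
      case 4
      have False if "x \<in> F l" for x
      proof -
        have "e * of_int (c' l) \<le> e * (of_int (c l) + 1)" using that T[of x] by (auto simp: F_def)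
        then show False using 4 e by simp
      qed
      then have "F l = {}" by blast
      then show ?thesis by simp
    next
      case 5
      have False if "x \<in> F l" for x
      proof -
        have "e * of_int (c l) \<le> e * (of_int (c' l) + 1)" using that T[of x] by (auto simp: F_def)
        then show False using 5 e by simp
      qed
      then have "F l = {}" by blast
      then show ?thesis by simp
    qed
  qed
  have "?T \<inter> cell e L c' = \<Inter> (F ` L)"
    using L by (auto simp: F_def cell_def)
  then show ?thesis
    using face_of_Inter[of "F ` L" ?T] L F by auto
qed

lemma cell_affine_image:
  assumes e: "e > 0" and z: "\<And>l. l \<in> L \<Longrightarrow> l \<bullet> z = e * of_int (k l)"
  shows "(\<lambda>x. z + e *\<^sub>R x) ` cell 1 L c = cell e L (\<lambda>l. c l + k l)"
proof
  show "(\<lambda>x. z + e *\<^sub>R x) ` cell 1 L c \<subseteq> cell e L (\<lambda>l. c l + k l)"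
  proof (rule image_subsetI)
    fix x assume x: "x \<in> cell 1 L c"
    have "e * of_int (c l + k l) \<le> l \<bullet> (z + e *\<^sub>R x) \<and> l \<bullet> (z + e *\<^sub>R x) \<le> e * (of_int (c l + k l) + 1)"
      if l: "l \<in> L" for l
    proof -
      have "of_int (c l) \<le> l \<bullet> x" "l \<bullet> x \<le> of_int (c l) + 1" using x l by (auto simp: cell_def)
      then have "e * of_int (c l) \<le> e * (l \<bullet> x)" "e * (l \<bullet> x) \<le> e * (of_int (c l) + 1)"
        using e by (auto intro!: mult_left_mono)
      then show ?thesis using z[OF l] by (simp add: inner_add_right algebra_simps)
    qed
    then show "z + e *\<^sub>R x \<in> cell e L (\<lambda>l. c l + k l)" by (auto simp: cell_def)
  qed
  show "cell e L (\<lambda>l. c l + k l) \<subseteq> (\<lambda>x. z + e *\<^sub>R x) ` cell 1 L c"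
  proof
    fix x assume x: "x \<in> cell e L (\<lambda>l. c l + k l)"
    let ?x = "(1 / e) *\<^sub>R (x - z)"
    have "of_int (c l) \<le> l \<bullet> ?x \<and> l \<bullet> ?x \<le> of_int (c l) + 1" if l: "l \<in> L" for l
    proof -
      have "e * of_int (c l + k l) \<le> l \<bullet> x" "l \<bullet> x \<le> e * (of_int (c l + k l) + 1)"
        using x l by (auto simp: cell_def)
      then have "e * of_int (c l) \<le> l \<bullet> (x - z)" "l \<bullet> (x - z) \<le> e * (of_int (c l) + 1)"
        using z[OF l] by (auto simp: inner_diff_right algebra_simps)
      moreover have "l \<bullet> ?x = (l \<bullet> (x - z)) / e" by (simp only: inner_scaleR_right) simp
      ultimately show ?thesis using e by (simp only:) (simp add: field_simps)
    qed
    then have "?x \<in> cell 1 L c" by (auto simp: cell_def)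
    moreover have "x = z + e *\<^sub>R ?x" using e by simp
    ultimately show "x \<in> (\<lambda>x. z + e *\<^sub>R x) ` cell 1 L c" by blast
  qed
qed

text \<open>That each vertex lies on a hyperplane of every family is what makes nearby cells share a vertex.\<close>

locale cell_mesh =
  fixes e :: real and L :: "(real^'n) set" and \<M> :: "(real^'n) set set"
  assumes e_pos: "e > 0" and finite_L: "finite L" and axes: "\<And>i. axis i 1 \<in> L"
    and norm_L: "\<And>l. l \<in> L \<Longrightarrow> norm l \<le> 3 / 2"
    and dim: "CARD('n) \<in> {1, 2}"
    and cells: "\<And>T. T \<in> \<M> \<Longrightarrow> \<exists>c. T = cell e L c"
    and simplices: "\<And>T. T \<in> \<M> \<Longrightarrow> int CARD('n) simplex T"
    and vertex_values: "\<And>T v l. T \<in> \<M> \<Longrightarrow> v \<in> vertices_of T \<Longrightarrow> l \<in> L \<Longrightarrow> \<exists>k::int. l \<bullet> v = e * of_int k"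
    and cover: "\<Union>\<M> = UNIV"
begin

lemma regular: "regular_triangulation UNIV \<M>"
proof -
  have ne: "L \<noteq> {}" using axes by auto
  have face: "(T \<inter> T') face_of T" if "T \<in> \<M>" "T' \<in> \<M>" for T T'
    using cells[OF that(1)] cells[OF that(2)] cell_Int_face[OF e_pos ne] by auto
  have fin: "finite {T\<in>\<M>. T \<inter> B \<noteq> {}}" if B: "bounded B" for B
  proof -
    obtain R where R: "\<And>x. x \<in> B \<Longrightarrow> norm x \<le> R" using B by (auto simp: bounded_iff)
    define m where "m = \<lceil>3 / 2 * R / e\<rceil> + 1"
    have "{T\<in>\<M>. T \<inter> B \<noteq> {}} \<subseteq> cell e L ` (L \<rightarrow>\<^sub>E {-m..m})"
    proof
      fix T assume "T \<in> {T\<in>\<M>. T \<inter> B \<noteq> {}}"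
      then obtain x c where T: "T = cell e L c" and x: "x \<in> T" "x \<in> B"
        using cells by blast
      have "c l \<in> {-m..m}" if l: "l \<in> L" for l
      proof -
        have "\<bar>l \<bullet> x\<bar> \<le> norm l * norm x" by (rule Cauchy_Schwarz_ineq2)
        also have "\<dots> \<le> 3 / 2 * R" using norm_L[OF l] R[OF x(2)] by (intro mult_mono) auto
        finally have lx: "\<bar>l \<bullet> x\<bar> \<le> 3 / 2 * R" .
        have "e * of_int (c l) \<le> l \<bullet> x" "l \<bullet> x \<le> e * (of_int (c l) + 1)"
          using x(1) l by (auto simp: T cell_def)
        with lx have "of_int (c l) * e \<le> 3 / 2 * R" "- (3 / 2 * R) \<le> (of_int (c l) + 1) * e"
          by (auto simp: mult.commute)
        then have "of_int (c l) \<le> 3 / 2 * R / e" "- (3 / 2 * R / e) \<le> of_int (c l) + 1"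
          using e_pos by (auto simp: field_simps)
        then show ?thesis unfolding m_def by (auto; linarith)
      qed
      then have "restrict c L \<in> L \<rightarrow>\<^sub>E {-m..m}" by auto
      moreover have "T = cell e L (restrict c L)" by (simp add: T cell_def)
      ultimately show "T \<in> cell e L ` (L \<rightarrow>\<^sub>E {-m..m})" by blast
    qed
    moreover have "finite (cell e L ` (L \<rightarrow>\<^sub>E {-m..m}))"
      by (intro finite_imageI finite_PiE finite_L) auto
    ultimately show ?thesis by (rule finite_subset)
  qed
  show ?thesis
    unfolding regular_triangulation_def using face fin simplices cover by blast
qed

lemma functional_diff_le:
  assumes "T \<in> \<M>" "x \<in> T" "q \<in> T" "l \<in> L"
  shows "\<bar>l \<bullet> (x - q)\<bar> \<le> e"
proof -
  obtain c where c: "T = cell e L c" using cells[OF assms(1)] by auto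
  have "e * of_int (c l) \<le> l \<bullet> x \<and> l \<bullet> x \<le> e * of_int (c l) + e"
    "e * of_int (c l) \<le> l \<bullet> q \<and> l \<bullet> q \<le> e * of_int (c l) + e"
    using assms by (auto simp: c cell_def distrib_left)
  then show ?thesis unfolding inner_diff_right by linarith
qed

lemma diam_le:
  assumes "T \<in> \<M>" "x \<in> T" "q \<in> T"
  shows "norm (x - q) \<le> 2 * e"
proof -
  have "norm (x - q) \<le> (\<Sum>i\<in>UNIV. \<bar>(x - q) $ i\<bar>)" by (rule norm_le_l1_cart)
  also have "\<dots> \<le> (\<Sum>i\<in>(UNIV::'n set). e)"
  proof (rule sum_mono)
    fix i :: 'n
    have "\<bar>axis i 1 \<bullet> (x - q)\<bar> \<le> e" using functional_diff_le[OF assms axes] .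
    then show "\<bar>(x - q) $ i\<bar> \<le> e" by (simp add: inner_axis')
  qed
  also have "\<dots> \<le> 2 * e" using dim e_pos by auto
  finally show ?thesis .
qed

text \<open>The point \<open>x\<close> has a barycentric coordinate of at least \<open>1 / 3\<close> at some vertex \<open>v\<close> of \<open>T\<close>, hence every \<open>l\<close>
  differs by at most \<open>2 e / 3\<close> between \<open>x\<close> and \<open>v\<close>. From \<open>x\<close> to \<open>x'\<close> it changes by at most \<open>e / 4\<close>. Since
  \<open>l \<bullet> v\<close> is a multiple of \<open>e\<close>, a difference below \<open>e\<close> forces \<open>v\<close> into the slab of \<open>T'\<close>, for every \<open>l\<close>.\<close>

lemma near_elements_meet:
  assumes T: "T \<in> \<M>" "T' \<in> \<M>" and x: "x \<in> T" "x' \<in> T'" and near: "norm (x' - x) \<le> e / 6"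
  shows "T \<inter> T' \<noteq> {}"
proof -
  let ?V = "vertices_of T"
  note V = simplex_vertices[OF simplices[OF T(1)]]
  have "x \<in> convex hull ?V" using V(4) x(1) by simp
  then obtain u where u: "\<And>v. v \<in> ?V \<Longrightarrow> u v \<ge> 0" "sum u ?V = 1" "(\<Sum>v\<in>?V. u v *\<^sub>R v) = x"
    using V(1) by (auto simp: convex_hull_finite)
  have "\<exists>v\<in>?V. u v \<ge> 1 / 3"
  proof (rule ccontr)
    assume "\<not> (\<exists>v\<in>?V. u v \<ge> 1 / 3)"
    moreover have "?V \<noteq> {}" using V(3) by auto
    ultimately have "sum u ?V < (\<Sum>v\<in>?V. 1 / 3)" using V(1) by (intro sum_strict_mono) auto
    also have "\<dots> \<le> 1" using V(3) dim by auto
    finally show False using u(2) by simp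
  qed
  then obtain v where v: "v \<in> ?V" "u v \<ge> 1 / 3" by auto
  have vT: "w \<in> T" if "w \<in> ?V" for w using that by (simp add: vertices_of_def extreme_point_of_def)
  obtain c' where c': "T' = cell e L c'" using cells[OF T(2)] by auto
  have "e * of_int (c' l) \<le> l \<bullet> v \<and> l \<bullet> v \<le> e * (of_int (c' l) + 1)" if l: "l \<in> L" for l
  proof -
    have "x - v = (\<Sum>w\<in>?V. u w *\<^sub>R w) - (\<Sum>w\<in>?V. u w) *\<^sub>R v" using u by simp
    also have "\<dots> = (\<Sum>w\<in>?V. u w *\<^sub>R (w - v))"
      by (simp add: scaleR_sum_left scaleR_diff_right sum_subtractf)
    finally have "\<bar>l \<bullet> (x - v)\<bar> = \<bar>\<Sum>w\<in>?V. u w * (l \<bullet> (w - v))\<bar>"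
      by (simp add: inner_sum_right)
    also have "\<dots> = \<bar>\<Sum>w\<in>?V - {v}. u w * (l \<bullet> (w - v))\<bar>"
      using V(1) v(1) by (simp add: sum.remove)
    also have "\<dots> \<le> (\<Sum>w\<in>?V - {v}. \<bar>u w * (l \<bullet> (w - v))\<bar>)" by (rule sum_abs)
    also have "\<dots> \<le> (\<Sum>w\<in>?V - {v}. u w * e)"
    proof (rule sum_mono)
      fix w assume "w \<in> ?V - {v}"
      then have "\<bar>l \<bullet> (w - v)\<bar> \<le> e" "u w \<ge> 0"
        using functional_diff_le[OF T(1) vT vT l] v(1) u(1) by auto
      then show "\<bar>u w * (l \<bullet> (w - v))\<bar> \<le> u w * e" by (simp add: abs_mult mult_left_mono)
    qed
    also have "\<dots> = (1 - u v) * e"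
      using V(1) v(1) u(2) by (simp add: sum_distrib_right[symmetric] sum_diff1)
    also have "\<dots> \<le> 2 / 3 * e" using v(2) e_pos by (intro mult_right_mono) auto
    finally have 1: "\<bar>l \<bullet> (x - v)\<bar> \<le> 2 / 3 * e" .
    have "\<bar>l \<bullet> (x' - x)\<bar> \<le> norm l * norm (x' - x)" by (rule Cauchy_Schwarz_ineq2)
    also have "\<dots> \<le> 3 / 2 * (e / 6)" using norm_L[OF l] near by (intro mult_mono) auto
    finally have 2: "\<bar>l \<bullet> x' - l \<bullet> x\<bar> \<le> e / 4" by (simp add: inner_diff_right)
    have "\<bar>l \<bullet> x' - l \<bullet> v\<bar> < e" using 1 2 e_pos unfolding inner_diff_right by linarith
    moreover obtain k :: int where k: "l \<bullet> v = e * of_int k" using vertex_values[OF T(1) v(1) l] by auto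
    ultimately have d: "l \<bullet> x' < e * (of_int k + 1)" "e * (of_int k - 1) < l \<bullet> x'"
      by (auto simp: algebra_simps)
    have "e * of_int (c' l) \<le> l \<bullet> x'" "l \<bullet> x' \<le> e * (of_int (c' l) + 1)"
      using x(2) l by (auto simp: c' cell_def)
    with d have "e * of_int (c' l) < e * (of_int k + 1)" "e * (of_int k - 1) < e * (of_int (c' l) + 1)"
      by linarith+
    then have "c' l \<le> k" "k \<le> c' l + 1" using e_pos by simp_all
    then show ?thesis unfolding k using e_pos by simp
  qed
  then have "v \<in> T'" by (simp add: c' cell_def)
  with vT[OF v(1)] show ?thesis by auto
qed

end

lemma simplex_hull:
  fixes C :: "(real^'n) set"
  assumes "\<not> affine_dependent C" "card C = CARD('n) + 1"
  shows "int CARD('n) simplex (convex hull C)" "vertices_of (convex hull C) = C"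
  using assms extreme_point_of_convex_hull_affine_independent[OF assms(1)]
  by (auto simp: vertices_of_def intro: simplex_convex_hull)

context
  fixes i j :: "'n::finite"
  assumes ij: "i \<noteq> j" and UNIV_ij: "UNIV = {i, j}"
begin

lemma vec2_eq_iff: "(x :: real^'n) = y \<longleftrightarrow> x $ i = y $ i \<and> x $ j = y $ j"
proof -
  have "(\<forall>k. P k) \<longleftrightarrow> P i \<and> P j" for P :: "'n \<Rightarrow> bool"
    using UNIV_ij by (metis UNIV_I empty_iff insert_iff)
  then show ?thesis by (simp add: vec_eq_iff)
qed

lemma inner2: "(x :: real^'n) \<bullet> y = x $ i * y $ i + x $ j * y $ j"
  using ij by (simp add: inner_vec_def UNIV_ij)

lemma axis2 [simp]: "axis i (1::real) $ i = 1" "axis i (1::real) $ j = 0" "axis j (1::real) $ j = 1" "axis j (1::real) $ i = 0"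
  using ij by (auto simp: axis_def)

lemma in_hull3I:
  fixes x :: "'a::real_vector"
  assumes "x = u *\<^sub>R a + v *\<^sub>R b + w *\<^sub>R c" "u \<ge> 0" "v \<ge> 0" "w \<ge> 0" "u + v + w = 1"
  shows "x \<in> convex hull {a, b, c}"
  unfolding convex_hull_3 using assms by blast

lemma hull_diagonal: "convex hull {0, 1, axis i 1} = {x :: real^'n. 0 \<le> x $ j \<and> x $ j \<le> x $ i \<and> x $ i \<le> 1}"
proof -
  have "x \<in> convex hull {0, 1, axis i 1}" if x: "0 \<le> x $ j" "x $ j \<le> x $ i" "x $ i \<le> 1" for x :: "real^'n"
  proof -
    have "x = (1 - x $ i) *\<^sub>R 0 + (x $ j) *\<^sub>R 1 + (x $ i - x $ j) *\<^sub>R axis i 1"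
      by (simp add: vec2_eq_iff)
    then show ?thesis by (rule in_hull3I) (use x in auto)
  qed
  moreover have "0 \<le> x $ j \<and> x $ j \<le> x $ i \<and> x $ i \<le> 1" if "x \<in> convex hull {0, 1, axis i 1}" for x :: "real^'n"
    using that by (auto simp: convex_hull_3)
  ultimately show ?thesis by blast
qed

lemma hull_lower: "convex hull {axis i 1, axis j 1, 0} = {x :: real^'n. 0 \<le> x $ i \<and> 0 \<le> x $ j \<and> x $ i + x $ j \<le> 1}"
proof -
  have "x \<in> convex hull {axis i 1, axis j 1, 0}" if x: "0 \<le> x $ i" "0 \<le> x $ j" "x $ i + x $ j \<le> 1" for x :: "real^'n"
  proof -
    have "x = (x $ i) *\<^sub>R axis i 1 + (x $ j) *\<^sub>R axis j 1 + (1 - x $ i - x $ j) *\<^sub>R 0"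
      by (simp add: vec2_eq_iff)
    then show ?thesis by (rule in_hull3I) (use x in auto)
  qed
  moreover have "0 \<le> x $ i \<and> 0 \<le> x $ j \<and> x $ i + x $ j \<le> 1" if "x \<in> convex hull {axis i 1, axis j 1, 0}" for x :: "real^'n"
    using that by (auto simp: convex_hull_3)
  ultimately show ?thesis by blast
qed

lemma hull_upper: "convex hull {axis i 1, axis j 1, 1} = {x :: real^'n. x $ i \<le> 1 \<and> x $ j \<le> 1 \<and> x $ i + x $ j \<ge> 1}"
proof -
  have "x \<in> convex hull {axis i 1, axis j 1, 1}" if x: "x $ i \<le> 1" "x $ j \<le> 1" "x $ i + x $ j \<ge> 1" for x :: "real^'n"
  proof -
    have "x = (1 - x $ j) *\<^sub>R axis i 1 + (1 - x $ i) *\<^sub>R axis j 1 + (x $ i + x $ j - 1) *\<^sub>R 1"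
      by (simp add: vec2_eq_iff)
    then show ?thesis by (rule in_hull3I) (use x in auto)
  qed
  moreover have "x $ i \<le> 1 \<and> x $ j \<le> 1 \<and> x $ i + x $ j \<ge> 1" if "x \<in> convex hull {axis i 1, axis j 1, 1}" for x :: "real^'n"
    using that by (auto simp: convex_hull_3)
  ultimately show ?thesis by blast
qed

text \<open>The hypothesis says that the determinant of the edge vectors at \<open>a\<close> does not vanish.\<close>

lemma affine_independent_triangle:
  fixes a b c :: "real^'n"
  assumes det: "(b $ i - a $ i) * (c $ j - a $ j) \<noteq> (b $ j - a $ j) * (c $ i - a $ i)"
  shows "\<not> affine_dependent {a, b, c}" "card {a, b, c} = CARD('n) + 1"
proof -
  have ne: "a \<noteq> b" "a \<noteq> c" "b \<noteq> c" using det by auto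
  have card: "CARD('n) = 2" using ij by (simp add: UNIV_ij)
  show "card {a, b, c} = CARD('n) + 1" using ne card by simp
  show "\<not> affine_dependent {a, b, c}"
  proof
    assume "affine_dependent {a, b, c}"
    then obtain U where U: "sum U {a, b, c} = 0" "\<exists>v\<in>{a, b, c}. U v \<noteq> 0" "(\<Sum>v\<in>{a, b, c}. U v *\<^sub>R v) = 0"
      by (subst (asm) affine_dependent_explicit_finite) auto
    have s: "U a = - U b - U c" using U(1) ne by simp
    have "U b *\<^sub>R (b - a) + U c *\<^sub>R (c - a) = 0"
      using U(3) ne by (simp add: s algebra_simps)
    then have e: "U b * (b $ i - a $ i) + U c * (c $ i - a $ i) = 0" "U b * (b $ j - a $ j) + U c * (c $ j - a $ j) = 0"
      by (simp_all add: vec2_eq_iff)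
    let ?D = "(b $ i - a $ i) * (c $ j - a $ j) - (b $ j - a $ j) * (c $ i - a $ i)"
    have "U b * ?D = (U b * (b $ i - a $ i) + U c * (c $ i - a $ i)) * (c $ j - a $ j)
        - (U b * (b $ j - a $ j) + U c * (c $ j - a $ j)) * (c $ i - a $ i)" by (simp add: algebra_simps)
    then have "U b = 0" using e det by simp
    have "U c * ?D = (U b * (b $ j - a $ j) + U c * (c $ j - a $ j)) * (b $ i - a $ i)
        - (U b * (b $ i - a $ i) + U c * (c $ i - a $ i)) * (b $ j - a $ j)" by (simp add: algebra_simps)
    then have "U c = 0" using e det by simp
    with \<open>U b = 0\<close> s U(2) show False by auto
  qed
qed

end

text \<open>The properties of the subdivided unit cube that scaled lattice translates inherit.\<close>

locale reference_cells =
  fixes L :: "(real^'n) set" and Q :: "(real^'n) set set"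
  assumes dim: "CARD('n) \<in> {1, 2}" and finite_L: "finite L" and axes: "\<forall>i. axis i 1 \<in> L"
    and norm_L: "\<forall>l\<in>L. norm l \<le> 3 / 2" and integral: "\<forall>l\<in>L. \<forall>i. l $ i \<in> \<int>"
    and cells: "\<forall>K\<in>Q. \<exists>c. K = cell 1 L c"
    and hulls: "\<forall>K\<in>Q. \<exists>C. K = convex hull C \<and> \<not> affine_dependent C \<and> card C = CARD('n) + 1 \<and>
      (\<forall>v\<in>C. \<forall>i. v $ i \<in> \<int>)"
    and cover: "\<Union>Q = cbox 0 1"

lemma reference_cells_interval:
  assumes card: "CARD('n) = 1"
  shows "reference_cells (range (\<lambda>i. axis i 1)) {cbox 0 1 :: (real^'n) set}"
proof -
  obtain i :: 'n where U: "UNIV = {i}" using card by (auto simp: card_1_singleton_iff)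
  have all: "(\<forall>k. P k) \<longleftrightarrow> P i" for P :: "'n \<Rightarrow> bool"
    using U by (metis UNIV_I singletonD)
  have cell: "cbox 0 1 = cell 1 (range (\<lambda>i. axis i 1)) (\<lambda>_. 0 :: int)"
    by (auto simp: cell_def mem_box_cart inner_axis')
  have hull: "cbox 0 1 = convex hull {0, 1 :: real^'n}"
  proof -
    have "x \<in> convex hull {0, 1}" if "x \<in> cbox 0 1" for x :: "real^'n"
    proof -
      have "x = (1 - x $ i) *\<^sub>R 0 + (x $ i) *\<^sub>R 1" by (simp add: vec_eq_iff all)
      moreover have "0 \<le> x $ i" "x $ i \<le> 1" using that by (auto simp: mem_box_cart)
      ultimately have "\<exists>u v. x = u *\<^sub>R 0 + v *\<^sub>R 1 \<and> 0 \<le> u \<and> 0 \<le> v \<and> u + v = 1"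
        by (intro exI[of _ "1 - x $ i"] exI[of _ "x $ i"]) auto
      then show ?thesis by (auto simp: convex_hull_2)
    qed
    moreover have "x \<in> cbox 0 1" if "x \<in> convex hull {0, 1}" for x :: "real^'n"
      using that by (auto simp: convex_hull_2 mem_box_cart)
    ultimately show ?thesis by blast
  qed
  have "(0 :: real^'n) \<noteq> 1" by (simp add: vec_eq_iff)
  then have "\<not> affine_dependent {0, 1 :: real^'n} \<and> card {0, 1 :: real^'n} = CARD('n) + 1 \<and> (\<forall>v\<in>{0, 1 :: real^'n}. \<forall>i. v $ i \<in> \<int>)"
    using card by simp
  then have C: "\<exists>C. cbox 0 1 = convex hull C \<and> \<not> affine_dependent C \<and> card C = CARD('n) + 1 \<and> (\<forall>v\<in>C. \<forall>i. (v :: real^'n) $ i \<in> \<int>)"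
    using hull by metis
  show ?thesis
  proof
    show "\<forall>l\<in>range (\<lambda>i. axis i 1 :: real^'n). norm l \<le> 3 / 2" by auto
    show "\<forall>l\<in>range (\<lambda>i. axis i 1 :: real^'n). \<forall>k. l $ k \<in> \<int>" by (auto simp: axis_def)
  qed (use card cell C in auto)
qed

lemma reference_cells_triangles:
  assumes ij: "i \<noteq> j" and U: "UNIV = {i, j :: 'n}"
    and Q: "Q = {convex hull {0, 1, axis i 1}, convex hull {0, 1, axis j 1}} \<or>
         Q = {convex hull {axis i 1, axis j 1, 0}, convex hull {axis i 1, axis j 1, 1 :: real^'n}}"
  shows "\<exists>L. reference_cells L Q"
proof -
  have ji: "j \<noteq> i" and U': "UNIV = {j, i}" using ij U by auto
  have all: "(\<forall>k. P k) \<longleftrightarrow> P i \<and> P j" for P :: "'n \<Rightarrow> bool"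
    using U by (metis UNIV_I empty_iff insert_iff)
  note [simp] = axis2[OF ij U]
  have card: "CARD('n) = 2" using ij by (simp add: U)
  have box: "cbox 0 1 = {x :: real^'n. 0 \<le> x $ i \<and> x $ i \<le> 1 \<and> 0 \<le> x $ j \<and> x $ j \<le> 1}"
    by (auto simp: mem_box_cart all)
  note tri = affine_independent_triangle[OF ij U]
  have norm: "norm l \<le> 3 / 2" if "l $ i * l $ i + l $ j * l $ j \<le> 2" for l :: "real^'n"
  proof -
    have "(norm l)\<^sup>2 \<le> (3 / 2)\<^sup>2" using that unfolding power2_norm_eq_inner inner2[OF ij U] by (simp add: power2_eq_square)
    then show ?thesis by (rule power2_le_imp_le) simp
  qed
  from Q show ?thesis
  proof
    assume Q: "Q = {convex hull {0, 1, axis i 1}, convex hull {0, 1, axis j 1}}"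
    define d :: "real^'n" where "d = axis i 1 - axis j 1"
    let ?L = "{axis i 1, axis j 1, d}"
    have d: "d $ i = 1" "d $ j = -1" by (auto simp: d_def)
    have ne: "axis i 1 \<noteq> d" "axis j 1 \<noteq> d" using d by (auto simp: vec2_eq_iff[OF ij U])
    have 1: "convex hull {0, 1, axis i 1} = cell 1 ?L (\<lambda>_. 0)"
      unfolding hull_diagonal[OF ij U] by (auto simp: cell_def inner2[OF ij U] d)
    have 2: "convex hull {0, 1, axis j 1} = cell 1 ?L (\<lambda>l. if l = d then -1 else 0)"
      unfolding hull_diagonal[OF ji U'] using ne by (auto simp: cell_def inner2[OF ij U] d)
    have "\<Union>Q = cbox 0 1"
      unfolding Q hull_diagonal[OF ij U] hull_diagonal[OF ji U'] box by auto
    moreover have "\<exists>C. K = convex hull C \<and> \<not> affine_dependent C \<and> card C = CARD('n) + 1 \<and> (\<forall>v\<in>C. \<forall>i. v $ i \<in> \<int>)"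
      if "K \<in> Q" for K
    proof -
      have "K = convex hull {0, 1, axis i 1} \<or> K = convex hull {0, 1, axis j 1}" using that Q by auto
      then show ?thesis
        using tri[of 1 0 "axis i 1"] tri[of 1 0 "axis j 1"]
        by (elim disjE) (intro exI conjI, assumption, auto simp: all)+
    qed
    moreover have "\<forall>k. axis k 1 \<in> ?L" "\<forall>l\<in>?L. \<forall>k. l $ k \<in> \<int>" by (simp_all add: all d)
    moreover have "\<forall>l\<in>?L. norm l \<le> 3 / 2" by (intro ballI norm) (auto simp: d)
    moreover have "\<forall>K\<in>Q. \<exists>c. K = cell 1 ?L c" using Q 1 2 by blast
    ultimately have "reference_cells ?L Q"
      using card by unfold_locales simp_all
    then show ?thesis by blast
  next
    assume Q: "Q = {convex hull {axis i 1, axis j 1, 0}, convex hull {axis i 1, axis j 1, 1}}"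
    define d :: "real^'n" where "d = axis i 1 + axis j 1"
    let ?L = "{axis i 1, axis j 1, d}"
    have d: "d $ i = 1" "d $ j = 1" by (auto simp: d_def)
    have ne: "axis i 1 \<noteq> d" "axis j 1 \<noteq> d" using d by (auto simp: vec2_eq_iff[OF ij U])
    have 1: "convex hull {axis i 1, axis j 1, 0} = cell 1 ?L (\<lambda>_. 0)"
      unfolding hull_lower[OF ij U] by (auto simp: cell_def inner2[OF ij U] d)
    have 2: "convex hull {axis i 1, axis j 1, 1} = cell 1 ?L (\<lambda>l. if l = d then 1 else 0)"
      unfolding hull_upper[OF ij U] using ne by (auto simp: cell_def inner2[OF ij U] d)
    have "\<Union>Q = cbox 0 1"
      unfolding Q hull_lower[OF ij U] hull_upper[OF ij U] box by auto
    moreover have "\<exists>C. K = convex hull C \<and> \<not> affine_dependent C \<and> card C = CARD('n) + 1 \<and> (\<forall>v\<in>C. \<forall>i. v $ i \<in> \<int>)"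
      if "K \<in> Q" for K
    proof -
      have "K = convex hull {axis i 1, axis j 1, 0} \<or> K = convex hull {axis i 1, axis j 1, 1}" using that Q by auto
      then show ?thesis
        using tri[of "axis j 1" "axis i 1" 0] tri[of "axis j 1" "axis i 1" 1]
        by (elim disjE) (intro exI conjI, assumption, auto simp: all)+
    qed
    moreover have "\<forall>k. axis k 1 \<in> ?L" "\<forall>l\<in>?L. \<forall>k. l $ k \<in> \<int>" by (simp_all add: all d)
    moreover have "\<forall>l\<in>?L. norm l \<le> 3 / 2" by (intro ballI norm) (auto simp: d)
    moreover have "\<forall>K\<in>Q. \<exists>c. K = cell 1 ?L c" using Q 1 2 by blast
    ultimately have "reference_cells ?L Q"
      using card by unfold_locales simp_all
    then show ?thesis by blast
  qed
qed

lemma unit_cube_subdivision_reference_cells: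
  fixes Q :: "(real^'n) set set"
  assumes "unit_cube_subdivision Q"
  shows "\<exists>L. reference_cells L Q"
  using assms unfolding unit_cube_subdivision_def
proof (elim disjE exE conjE)
  assume "CARD('n) = 1" "Q = {cbox 0 1}"
  then show ?thesis using reference_cells_interval by blast
next
  fix i j :: 'n
  assume "i \<noteq> j" "UNIV = {i, j}" "Q = {convex hull {0, 1, axis i 1}, convex hull {0, 1, axis j 1}}"
  then show ?thesis by (intro reference_cells_triangles) auto
next
  fix i j :: 'n
  assume "i \<noteq> j" "UNIV = {i, j}" "Q = {convex hull {axis i 1, axis j 1, 0}, convex hull {axis i 1, axis j 1, 1}}"
  then show ?thesis by (intro reference_cells_triangles) auto
qed

lemma eps_pos: "N \<ge> 1 \<Longrightarrow> eps N > 0"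
  by (simp add: eps_def)

lemma affine_independent_affine_image:
  fixes C :: "'a::euclidean_space set"
  assumes "\<not> affine_dependent C" "e \<noteq> 0"
  shows "\<not> affine_dependent ((\<lambda>x. z + e *\<^sub>R x) ` C)" "card ((\<lambda>x. z + e *\<^sub>R x) ` C) = card C"
proof -
  have inj: "inj (\<lambda>x :: 'a. e *\<^sub>R x)" using assms(2) by (auto simp: inj_def)
  have inj': "inj_on (\<lambda>x. z + e *\<^sub>R x) C" using assms(2) by (auto simp: inj_on_def)
  show c: "card ((\<lambda>x. z + e *\<^sub>R x) ` C) = card C" by (rule card_image[OF inj'])
  have img: "(\<lambda>x. z + e *\<^sub>R x) ` C = (+) z ` ((\<lambda>x. e *\<^sub>R x) ` C)" by auto
  have "aff_dim ((\<lambda>x. z + e *\<^sub>R x) ` C) = aff_dim C"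
    unfolding img using inj by (simp add: aff_dim_translation_eq aff_dim_injective_linear_image)
  then show "\<not> affine_dependent ((\<lambda>x. z + e *\<^sub>R x) ` C)"
    using assms c by (simp add: affine_independent_iff_card)
qed

context reference_cells
begin

context
  fixes N :: nat
  assumes N: "N \<ge> 1"
begin

lemma
  shows cell_mesh_fine_mesh: "cell_mesh (eps N) L (fine_mesh_per N Q)"
    and lattice_pt_is_vertex: "p \<in> lattice_pts N \<Longrightarrow> \<exists>T\<in>fine_mesh_per N Q. p \<in> vertices_of T"
proof -
  let ?e = "eps N"
  let ?\<phi> = "\<lambda>z x. z + ?e *\<^sub>R x"
  note e = eps_pos[OF N]
  have int: "\<exists>k::int. l \<bullet> z = ?e * of_int k" if "l \<in> L" "z \<in> lattice_pts N" for l z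
  proof -
    have "\<forall>i. \<exists>k::int. z $ i = ?e * of_int k" using that by (simp add: lattice_pts_def)
    then obtain k :: "'n \<Rightarrow> int" where k: "\<And>i. z $ i = ?e * of_int (k i)" by metis
    have "l \<bullet> z = ?e * (\<Sum>i\<in>UNIV. l $ i * of_int (k i))"
      by (simp add: inner_vec_def k sum_distrib_left mult_ac)
    moreover have "(\<Sum>i\<in>UNIV. l $ i * of_int (k i)) \<in> \<int>"
      using integral that by (intro Ints_sum Ints_mult) auto
    ultimately show ?thesis by (auto elim: Ints_cases)
  qed
  have lattice_shift: "z + ?e *\<^sub>R v \<in> lattice_pts N" "z - ?e *\<^sub>R v \<in> lattice_pts N"
    if z: "z \<in> lattice_pts N" and v: "\<forall>i. v $ i \<in> \<int>" for z v :: "real^'n"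
  proof -
    have "\<exists>k::int. z $ i + ?e * v $ i = ?e * of_int k" "\<exists>k::int. z $ i - ?e * v $ i = ?e * of_int k" for i
    proof -
      obtain a :: int where a: "z $ i = ?e * of_int a" using z by (auto simp: lattice_pts_def)
      obtain b :: int where b: "v $ i = of_int b" using v by (auto elim: Ints_cases)
      show "\<exists>k::int. z $ i + ?e * v $ i = ?e * of_int k" by (rule exI[of _ "a + b"]) (simp add: a b algebra_simps)
      show "\<exists>k::int. z $ i - ?e * v $ i = ?e * of_int k" by (rule exI[of _ "a - b"]) (simp add: a b algebra_simps)
    qed
    then show "z + ?e *\<^sub>R v \<in> lattice_pts N" "z - ?e *\<^sub>R v \<in> lattice_pts N" by (auto simp: lattice_pts_def)
  qed
  have vert: "\<exists>C. C \<noteq> {} \<and> (\<forall>v\<in>C. \<forall>i. v $ i \<in> \<int>) \<and>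
      (\<forall>z. int CARD('n) simplex (?\<phi> z ` K) \<and> vertices_of (?\<phi> z ` K) = ?\<phi> z ` C)"
    if K: "K \<in> Q" for K
  proof -
    obtain C where C: "K = convex hull C" "\<not> affine_dependent C" "card C = CARD('n) + 1" "\<forall>v\<in>C. \<forall>i. v $ i \<in> \<int>"
      using hulls K by blast
    have e0: "?e \<noteq> 0" using e by simp
    have "int CARD('n) simplex (?\<phi> z ` K) \<and> vertices_of (?\<phi> z ` K) = ?\<phi> z ` C" for z
    proof -
      have img: "?\<phi> z ` K = convex hull (?\<phi> z ` C)" unfolding C(1) by (simp only: convex_hull_affinity)
      have "card (?\<phi> z ` C) = CARD('n) + 1"
        unfolding affine_independent_affine_image(2)[OF C(2) e0] by (rule C(3))
      from simplex_hull[OF affine_independent_affine_image(1)[OF C(2) e0] this] show ?thesis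
        unfolding img by blast
    qed
    moreover have "C \<noteq> {}" using C(3) by auto
    ultimately show ?thesis using C(4) by blast
  qed
  show "cell_mesh ?e L (fine_mesh_per N Q)"
  proof
    show "?e > 0" "finite L" "axis i 1 \<in> L" "CARD('n) \<in> {1, 2}" for i using dim finite_L axes e by auto
    show "norm l \<le> 3 / 2" if "l \<in> L" for l using norm_L that by auto
    fix T assume "T \<in> fine_mesh_per N Q"
    then obtain z K where T: "T = ?\<phi> z ` K" and z: "z \<in> lattice_pts N" and K: "K \<in> Q"
      by (auto simp: fine_mesh_per_def)
    obtain c where c: "K = cell 1 L c" using cells K by blast
    have "\<forall>l\<in>L. \<exists>k::int. l \<bullet> z = ?e * of_int k" using int z by blast
    then obtain k :: "real^'n \<Rightarrow> int" where k: "\<And>l. l \<in> L \<Longrightarrow> l \<bullet> z = ?e * of_int (k l)" by metis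
    show "\<exists>c. T = cell ?e L c" unfolding T c using cell_affine_image[OF e k] by blast
    obtain C where C: "\<forall>v\<in>C. \<forall>i. v $ i \<in> \<int>" "int CARD('n) simplex T" "vertices_of T = ?\<phi> z ` C"
      using vert[OF K] unfolding T by blast
    show "int CARD('n) simplex T" by (rule C(2))
    show "\<exists>k::int. l \<bullet> v = ?e * of_int k" if vl: "v \<in> vertices_of T" "l \<in> L" for v l
    proof -
      obtain w where "w \<in> C" "v = ?\<phi> z w" using vl(1) C(3) by auto
      then have "v \<in> lattice_pts N" using lattice_shift z C(1) by auto
      then show ?thesis using int vl by blast
    qed
  next
    show "\<Union>(fine_mesh_per N Q) = UNIV"
    proof -
      have "x \<in> \<Union>(fine_mesh_per N Q)" for x :: "real^'n"
      proof -
        define z :: "real^'n" where "z = (\<chi> i. ?e * of_int \<lfloor>x $ i / ?e\<rfloor>)"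
        have z: "z \<in> lattice_pts N" by (auto simp: lattice_pts_def z_def)
        let ?w = "(1 / ?e) *\<^sub>R (x - z)"
        have "?w $ i = x $ i / ?e - of_int \<lfloor>x $ i / ?e\<rfloor>" for i
          using e by (simp add: z_def field_simps)
        then have "0 \<le> ?w $ i \<and> ?w $ i \<le> 1" for i
          by (simp only:) linarith
        then have "?w \<in> cbox 0 1" by (simp add: mem_box_cart)
        then obtain K where "K \<in> Q" "?w \<in> K" using cover by (metis UnionE)
        moreover have "x = ?\<phi> z ?w" using e by simp
        ultimately show ?thesis using z unfolding fine_mesh_per_def by blast
      qed
      then show ?thesis by blast
    qed
  qed
  show "\<exists>T\<in>fine_mesh_per N Q. p \<in> vertices_of T" if p: "p \<in> lattice_pts N"
  proof -
    have "(0 :: real^'n) \<in> \<Union>Q" unfolding cover by (simp add: mem_box_cart)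
    then obtain K where K: "K \<in> Q" by blast
    obtain C where C: "C \<noteq> {}" "\<forall>v\<in>C. \<forall>i. v $ i \<in> \<int>" "\<And>z. vertices_of (?\<phi> z ` K) = ?\<phi> z ` C"
      using vert[OF K] by metis
    from C(1) obtain v where v: "v \<in> C" by blast
    let ?z = "p - ?e *\<^sub>R v"
    have "?z \<in> lattice_pts N" using C(2) v by (intro lattice_shift(2) p) auto
    then have "?\<phi> ?z ` K \<in> fine_mesh_per N Q" using K by (auto simp: fine_mesh_per_def)
    moreover have "p \<in> vertices_of (?\<phi> ?z ` K)" using C(3) v by (auto intro: image_eqI[of _ _ v])
    ultimately show ?thesis by blast
  qed
qed

end

end

section \<open>The two interpolants on a coupled mesh\<close>

text \<open>A nonempty open set is not negligible.\<close>

lemma AE_lebesgue_open_witness: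
  fixes U :: "'a::euclidean_space set"
  assumes "AE x in lebesgue. P x" "open U" "U \<noteq> {}"
  shows "\<exists>x\<in>U. P x"
proof (rule ccontr)
  assume none: "\<not> (\<exists>x\<in>U. P x)"
  obtain N where N: "N \<in> null_sets lebesgue" "{x. \<not> P x} \<subseteq> N"
    using assms(1) unfolding eventually_ae_filter by auto
  then have "U \<subseteq> N" using none by auto
  then have "negligible U"
    using N(1) negligible_iff_null_sets negligible_subset by blast
  then show False using open_not_negligible[OF assms(2,3)] by simp
qed

lemma grad_affine:
  assumes U: "open U" "x \<in> U" and w: "\<And>z. z \<in> U \<Longrightarrow> w z = A *v z + b"
  shows "grad w x = A"
proof -
  have "((\<lambda>z. A *v z + b) has_derivative (\<lambda>z. A *v z)) (at x)"
    by (auto intro!: derivative_eq_intros bounded_linear_imp_has_derivative matrix_vector_mul_bounded_linear)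
  then have "(w has_derivative (\<lambda>z. A *v z)) (at x)"
    using U by (rule has_derivative_transform_within_open) (simp add: w)
  then have "frechet_derivative w (at x) = (\<lambda>z. A *v z)"
    by (metis frechet_derivative_at)
  then show ?thesis by (simp add: grad_def jacobian_def)
qed

lemma closure_Omega: "closure (Omega :: (real^'n) set) = cbox (-1) 1"
proof
  have "Omega \<subseteq> cbox (-1) (1 :: real^'n)" by (auto simp: Omega_def mem_box_cart less_imp_le)
  then show "closure Omega \<subseteq> cbox (-1) (1 :: real^'n)" by (rule closure_minimal) (rule closed_cbox)
  have "box (-1) (1 :: real^'n) \<subseteq> Omega" by (auto simp: Omega_def mem_box_cart less_imp_le)
  then have "closure (box (-1) (1 :: real^'n)) \<subseteq> closure Omega" by (rule closure_mono)
  moreover have "box (-1) (1 :: real^'n) \<noteq> {}"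
  proof -
    have "0 \<in> box (-1) (1 :: real^'n)" by (simp add: mem_box_cart)
    then show ?thesis by blast
  qed
  ultimately show "cbox (-1) (1 :: real^'n) \<subseteq> closure Omega" by (simp add: closure_box)
qed

lemma Omega_borel: "Omega \<in> sets (borel :: (real^'n) measure)"
proof -
  have "Omega = (\<Inter>i. {x :: real^'n. x $ i > -1} \<inter> {x. x $ i \<le> 1})"
    by (auto simp: Omega_def)
  also have "\<dots> \<in> sets borel"
    by (intro sets.finite_INT sets.Int)
      (auto intro: borel_open borel_closed open_halfspace_component_gt_cart closed_halfspace_component_le_cart)
  finally show ?thesis .
qed

text \<open>A ball whose diameter exceeds half of the supremum over all inscribed balls is good enough; this accounts
  for the factor \<open>4\<close>.\<close>

lemma inball_of_shape:
  fixes T :: "(real^'n) set"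
  assumes T: "compact T" "interior T \<noteq> {}" and shape: "diameter T / inball_diameter T \<le> \<kappa>"
  obtains x r where "cball x r \<subseteq> T" "r > 0" "diameter T \<le> max 1 (4 * \<kappa>) * r"
proof -
  let ?S = "{2 * r | r. 0 \<le> r \<and> (\<exists>x. cball x r \<subseteq> T)}"
  have bdd: "bdd_above ?S"
  proof (rule bdd_aboveI)
    fix s assume "s \<in> ?S"
    then obtain r x where r: "s = 2 * r" "0 \<le> r" "cball x r \<subseteq> T" by auto
    have "diameter (cball x r) \<le> diameter T"
      using r(3) T(1) by (intro diameter_subset compact_imp_bounded)
    then show "s \<le> diameter T" using r by simp
  qed
  obtain x0 where "x0 \<in> interior T" using T(2) by auto
  then obtain r0 where r0: "r0 > 0" "cball x0 r0 \<subseteq> T" by (auto simp: mem_interior_cball)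
  then have mem: "2 * r0 \<in> ?S" by (intro CollectI exI[of _ r0]) auto
  define s where "s = inball_diameter T"
  have "2 * r0 \<le> s" unfolding s_def inball_diameter_def using mem bdd by (rule cSup_upper)
  with r0 have s: "s > 0" by simp
  then have "s / 2 < Sup ?S" by (simp add: s_def inball_diameter_def)
  then obtain t where "t \<in> ?S" "s / 2 < t" using less_cSup_iff[OF _ bdd] mem by blast
  then obtain r x where r: "s / 2 < 2 * r" "cball x r \<subseteq> T" by auto
  have "r > 0" using r s by simp
  moreover have "diameter T \<le> max 1 (4 * \<kappa>) * r"
  proof -
    have le: "diameter T \<le> \<kappa> * s" using shape s by (simp add: s_def field_simps)
    have "0 \<le> diameter T" using T(1) by (intro diameter_ge_0 compact_imp_bounded)
    with le s have "\<kappa> \<ge> 0" by (metis mult_less_0_iff not_le order_trans)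
    then have "\<kappa> * s \<le> \<kappa> * (4 * r)" using r by (intro mult_left_mono) auto
    also have "\<dots> \<le> max 1 (4 * \<kappa>) * r" using \<open>r > 0\<close> by simp
    finally show ?thesis using le by simp
  qed
  ultimately show ?thesis using that r(2) by blast
qed

locale coupled_mesh = reference_cells L Q
  for L :: "(real^'n) set" and Q :: "(real^'n) set set" +
  fixes N :: nat and Th Tha Thi Thc :: "(real^'n) set set" and \<kappa> :: real and y :: "real^'n \<Rightarrow> real^'n"
  assumes N: "N \<ge> 1" and coarse: "coarse_mesh N Th"
    and split: "Th = Tha \<union> Thi \<union> Thc" "Tha \<inter> Thc = {}" "Thi \<inter> Thc = {}"
    and fine: "Tha \<union> Thi \<subseteq> fine_mesh N Q" and shape: "shape_regularity Th \<le> \<kappa>"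
begin

abbreviation e where "e \<equiv> eps N"
abbreviation M where "M \<equiv> fine_mesh_per N Q"
abbreviation yf where "yf \<equiv> interp M y"
abbreviation Iy where "Iy \<equiv> interp (mesh_per Th) y"

sublocale M: cell_mesh e L M
  using N by (rule cell_mesh_fine_mesh)

lemmas M_simplex = M.simplices
lemmas Th_regular = coarse[unfolded coarse_mesh_def, THEN conjunct1]

lemma Th_simplex: "T \<in> Th \<Longrightarrow> int CARD('n) simplex T"
  using regular_triangulationD(1)[OF Th_regular] .

lemma Th_cover: "\<Union>Th = cbox (-1) 1"
  using regular_triangulationD(4)[OF Th_regular] closure_Omega by simp

lemma finite_Th: "finite Th"
proof -
  have "finite {T\<in>Th. T \<inter> cbox (-1) 1 \<noteq> {}}"
    by (rule regular_triangulationD(3)[OF Th_regular]) simp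
  moreover have "{T\<in>Th. T \<inter> cbox (-1) 1 \<noteq> {}} = Th"
    using Th_cover Th_simplex simplex_interior interior_subset by blast
  ultimately show ?thesis by simp
qed

lemma Thc_subset: "Thc \<subseteq> Th" using split by auto

text \<open>Gradients of the fine and of the coarse interpolant on an element, read off from the affine representation
  there, which is unique because elements have interior points.\<close>

definition G :: "(real^'n) set \<Rightarrow> real^'n^'n" where
  "G E = (SOME A. \<exists>b. \<forall>x\<in>E. yf x = A *v x + b)"

definition GI :: "(real^'n) set \<Rightarrow> real^'n^'n" where
  "GI T = (SOME A. \<exists>b. \<forall>x\<in>T. Iy x = A *v x + b)"

lemma yf_interpolant: "pw_affine_interpolant M y yf"
  by (rule interp_interpolant[OF M.regular])

lemma Iy_interpolant: "pw_affine_interpolant (mesh_per Th) y Iy"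
  using coarse by (intro interp_interpolant) (simp add: coarse_mesh_def)

lemma yf_affine: "E \<in> M \<Longrightarrow> \<exists>b. \<forall>x\<in>E. yf x = G E *v x + b"
proof -
  assume E: "E \<in> M"
  have "\<exists>A b. \<forall>x\<in>E. yf x = A *v x + b"
    using yf_interpolant E unfolding pw_affine_interpolant_def by simp
  then show ?thesis unfolding G_def by (rule someI_ex)
qed

lemma Th_subset_mesh_per: "Th \<subseteq> mesh_per Th"
proof
  fix T assume "T \<in> Th"
  moreover have "(0 :: real^'n) \<in> periods" by (auto simp: periods_def intro: exI[of _ 0])
  ultimately have "(+) 0 ` T \<in> mesh_per Th" unfolding mesh_per_def by blast
  then show "T \<in> mesh_per Th" by simp
qed

lemma Iy_affine: "T \<in> Th \<Longrightarrow> \<exists>b. \<forall>x\<in>T. Iy x = GI T *v x + b"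
proof -
  assume "T \<in> Th"
  then have T: "T \<in> mesh_per Th" using Th_subset_mesh_per by auto
  have "\<exists>A b. \<forall>x\<in>T. Iy x = A *v x + b"
    using Iy_interpolant T unfolding pw_affine_interpolant_def by simp
  then show ?thesis unfolding GI_def by (rule someI_ex)
qed

lemma yf_diff: "E \<in> M \<Longrightarrow> x \<in> E \<Longrightarrow> q \<in> E \<Longrightarrow> yf x - yf q = G E *v (x - q)"
  using yf_affine[of E] by (metis add_diff_cancel_right matrix_vector_mult_diff_distrib)

lemma Iy_diff: "T \<in> Th \<Longrightarrow> x \<in> T \<Longrightarrow> q \<in> T \<Longrightarrow> Iy x - Iy q = GI T *v (x - q)"
  using Iy_affine[of T] by (metis add_diff_cancel_right matrix_vector_mult_diff_distrib)

lemma vertices_subset: "vertices_of T \<subseteq> T"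
  by (auto simp: vertices_of_def extreme_point_of_def)

lemma yf_lattice:
  assumes "p \<in> lattice_pts N"
  shows "yf p = y p"
proof -
  obtain E where "E \<in> M" "p \<in> vertices_of E" using lattice_pt_is_vertex[OF N assms] by auto
  then show ?thesis using yf_interpolant by (simp add: pw_affine_interpolant_def)
qed

lemma Iy_vertex: "T \<in> Th \<Longrightarrow> p \<in> vertices_of T \<Longrightarrow> Iy p = y p"
  using Th_subset_mesh_per Iy_interpolant by (auto simp: pw_affine_interpolant_def)

lemma coarse_vertex: "T \<in> Th \<Longrightarrow> p \<in> vertices_of T \<Longrightarrow> p \<in> lattice_pts N"
  using coarse by (auto simp: coarse_mesh_def)

lemma grad_yf: "E \<in> M \<Longrightarrow> x \<in> interior E \<Longrightarrow> grad yf x = G E"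
  using yf_affine[of E] interior_subset[of E] by (meson grad_affine open_interior subsetD)

lemma grad_error:
  assumes "E \<in> M" "T \<in> Th" "x \<in> interior E" "x \<in> interior T"
  shows "grad (\<lambda>x. yf x - Iy x) x = G E - GI T"
proof -
  obtain b where b: "\<forall>x\<in>E. yf x = G E *v x + b" using yf_affine assms by blast
  obtain c where c: "\<forall>x\<in>T. Iy x = GI T *v x + c" using Iy_affine assms by blast
  show ?thesis
  proof (rule grad_affine)
    show "open (interior E \<inter> interior T)" by auto
    show "x \<in> interior E \<inter> interior T" using assms by auto
    show "yf z - Iy z = (G E - GI T) *v z + (b - c)" if z: "z \<in> interior E \<inter> interior T" for z
    proof -
      have "z \<in> E" "z \<in> T" using z interior_subset[of E] interior_subset[of T] by auto
      then show ?thesis using b c by (simp add: matrix_vector_mult_diff_rdistrib)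
    qed
  qed
qed

lemma grad_coincide:
  assumes "T \<in> Th" "T \<in> M"
  shows "G T = GI T"
proof -
  obtain b where b: "\<forall>x\<in>T. yf x = G T *v x + b" using yf_affine assms by blast
  obtain c where c: "\<forall>x\<in>T. Iy x = GI T *v x + c" using Iy_affine assms by blast
  have "G T *v u + b = GI T *v u + c" if "u \<in> vertices_of T" for u
    using that assms b c vertices_subset[of T] Iy_vertex[of T u] coarse_vertex[of T u] yf_lattice[of u]
    by (metis subsetD)
  then have eq: "G T *v u + b = GI T *v u + c" if "u \<in> T" for u
    using affine_eq_on_hull[of "vertices_of T"] that simplex_vertices(4)[OF Th_simplex[OF assms(1)]] by blast
  obtain x where x: "x \<in> interior T" using simplex_interior[OF Th_simplex[OF assms(1)]] by auto
  have "grad yf x = GI T"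
  proof (rule grad_affine[OF open_interior x])
    show "yf z = GI T *v z + c" if "z \<in> interior T" for z
      using that interior_subset[of T] b eq by auto
  qed
  then show ?thesis using grad_yf[OF assms(2) x] by simp
qed

text \<open>Only those fine elements are collected which reach the interior of \<open>T\<close>; one that merely touches the
  boundary may lie outside the continuum region.\<close>

definition F :: "(real^'n) set \<Rightarrow> (real^'n) set set" where
  "F T = {E\<in>M. E \<inter> interior T \<noteq> {}}"

lemma F_M: "E \<in> F T \<Longrightarrow> E \<in> M" by (simp add: F_def)

lemma finite_F: assumes "T \<in> Th" shows "finite (F T)"
proof -
  have "bounded (interior T)"
    using compact_simplex[OF Th_simplex[OF assms]] compact_imp_bounded bounded_interior by blast
  then show ?thesis
    unfolding F_def by (rule regular_triangulationD(3)[OF M.regular])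
qed

lemma M_closed: "E \<in> M \<Longrightarrow> closed E"
  using closed_simplex M_simplex by blast

text \<open>The interior of \<open>T\<close> is covered by a finite union of closed sets, hence so is its closure, which is \<open>T\<close>.\<close>

lemma F_cover: assumes T: "T \<in> Th" shows "T \<subseteq> \<Union>(F T)"
proof -
  have "closed (\<Union>(F T))"
    using finite_F[OF T] M_closed by (intro closed_Union) (auto simp: F_def)
  moreover have "interior T \<subseteq> \<Union>(F T)"
    using M.cover unfolding F_def by blast
  ultimately have "closure (interior T) \<subseteq> \<Union>(F T)" by (simp add: closure_minimal)
  then show ?thesis using simplex_closure_interior[OF Th_simplex[OF T]] by simp
qed

lemma F_interior: assumes E: "E \<in> F T" shows "interior E \<inter> interior T \<noteq> {}"
proof -
  have "closure (interior E) = E" using simplex_closure_interior M_simplex F_M[OF E] by blast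
  then have "closure (interior E) \<inter> interior T \<noteq> {}" using E by (auto simp: F_def)
  then show ?thesis by (metis Int_commute open_Int_closure_eq_empty open_interior)
qed

text \<open>The number \<open>1 / e\<close> is an integer, so the sides of the cube are among the hyperplanes that no cell crosses.\<close>

lemma F_in_cube: assumes T: "T \<in> Th" and E: "E \<in> F T" shows "E \<subseteq> cbox (-1) 1"
proof -
  obtain x where x: "x \<in> E" "x \<in> interior T" using E by (auto simp: F_def)
  have "interior T \<subseteq> interior (cbox (-1) 1)" using T Th_cover by (intro interior_mono) auto
  then have box: "x \<in> box (-1) 1" using x by auto
  obtain c where c: "E = cell e L c" using M.cells F_M[OF E] by blast
  note e_pos = M.e_pos
  have eN: "e * real N = 1" using N by (simp add: eps_def)
  have "-1 \<le> q $ i \<and> q $ i \<le> 1" if q: "q \<in> E" for q i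
  proof -
    let ?c = "c (axis i 1)"
    have ax: "axis i 1 \<in> L" using axes by blast
    have in_cell: "e * of_int ?c \<le> z $ i \<and> z $ i \<le> e * (of_int ?c + 1)" if "z \<in> E" for z
      using that ax by (auto simp: c cell_def inner_axis')
    have "-1 < x $ i" "x $ i < 1" using box by (auto simp: mem_box_cart)
    then have "e * of_int ?c < e * real N" "e * (- real N) < e * (of_int ?c + 1)"
      using in_cell[OF x(1)] eN by auto
    then have "real_of_int ?c < real N" "- real N < real_of_int ?c + 1"
      using mult_less_cancel_left_pos[OF e_pos] by blast+
    then have "?c + 1 \<le> int N" "- int N \<le> ?c" by linarith+
    then have "real_of_int ?c + 1 \<le> real N" "- real N \<le> real_of_int ?c" by linarith+
    then have "e * (of_int ?c + 1) \<le> e * real N" "e * (- real N) \<le> e * of_int ?c"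
      using mult_le_cancel_left_pos[OF e_pos] by blast+
    then show ?thesis using in_cell[OF q] eN by auto
  qed
  then show ?thesis by (auto simp: mem_box_cart)
qed

lemma closed_Thc: "closed (\<Union>Thc)"
proof (rule closed_Union)
  show "finite Thc" using Thc_subset finite_Th finite_subset by blast
  show "\<forall>T\<in>Thc. closed T" using Thc_subset Th_simplex closed_simplex by blast
qed

text \<open>Let an interior point of \<open>E\<close> lie in a coarse element outside the continuum region. That element is itself a
  fine element, hence equal to \<open>E\<close>; then it reaches the interior of \<open>T\<close>, so it is \<open>T\<close>, a
  contradiction. So the interior of \<open>E\<close> lies in the closed continuum region, and \<open>E\<close> is its closure.\<close>

lemma F_continuum:
  assumes T: "T \<in> Thc" and E: "E \<in> F T"
  shows "E \<in> fine_mesh_c N Q Thc"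
proof -
  have TTh: "T \<in> Th" using T Thc_subset by auto
  have cube: "E \<subseteq> cbox (-1) 1" by (rule F_in_cube[OF TTh E])
  have "interior E \<subseteq> \<Union>Thc"
  proof
    fix p assume p: "p \<in> interior E"
    then have "p \<in> \<Union>Th" using cube interior_subset Th_cover by blast
    then obtain K where K: "K \<in> Th" "p \<in> K" by auto
    show "p \<in> \<Union>Thc"
    proof (cases "K \<in> Thc")
      case True
      then show ?thesis using K(2) by blast
    next
      case False
      then have KM: "K \<in> M" "K \<notin> Thc" using K(1) split(1) fine by (auto simp: fine_mesh_def)
      have "E = K"
        using triangulation_interiors_disjoint[OF M.regular F_M[OF E] KM(1)] p K(2) by blast
      then have "interior T \<inter> K \<noteq> {}" using E by (auto simp: F_def)
      then have "T = K" using triangulation_interiors_disjoint[OF Th_regular TTh K(1)] by blast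
      with KM(2) T show ?thesis by simp
    qed
  qed
  then have "closure (interior E) \<subseteq> \<Union>Thc" using closed_Thc by (simp add: closure_minimal)
  then have "E \<subseteq> \<Union>Thc" using simplex_closure_interior M_simplex F_M[OF E] by blast
  then show ?thesis
    using F_M[OF E] cube by (simp add: fine_mesh_c_def fine_mesh_def closure_Omega)
qed

lemma elt_mesh_size_ge:
  assumes T: "T \<in> Th" and E: "E \<in> F T"
  shows "diameter T \<le> elt_mesh_size Th E"
proof -
  obtain x where x: "x \<in> E" "x \<in> T" using E interior_subset[of T] by (auto simp: F_def)
  have ms: "mesh_size Th z \<in> diameter ` Th" if "z \<in> E" for z
  proof -
    have "z \<in> \<Union>Th" using that F_in_cube[OF T E] Th_cover by auto
    then have "{T\<in>Th. z \<in> T} \<noteq> {}" by auto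
    then have "mesh_size Th z \<in> diameter ` {T\<in>Th. z \<in> T}"
      unfolding mesh_size_def using finite_Th by (intro Max_in) auto
    then show ?thesis by auto
  qed
  have "(\<lambda>z. \<bar>mesh_size Th z\<bar>) ` E \<subseteq> abs ` diameter ` Th" using ms by auto
  then have fin: "finite ((\<lambda>z. \<bar>mesh_size Th z\<bar>) ` E)" using finite_Th finite_subset by blast
  have "diameter T \<le> mesh_size Th x"
    unfolding mesh_size_def using finite_Th T x by (intro Max_ge) auto
  also have "\<dots> \<le> \<bar>mesh_size Th x\<bar>" by simp
  also have "\<dots> \<le> elt_mesh_size Th E"
    unfolding elt_mesh_size_def using fin x by (intro Max_ge) auto
  finally show ?thesis .
qed

lemma patch_measurable: "patch_c N Q Thc E \<in> sets borel"
proof -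
  have cl: "countable (periods :: (real^'n) set)"
  proof -
    have "periods \<subseteq> range (\<lambda>k :: 'n \<Rightarrow> int. \<chi> i. 2 * real_of_int (k i))"
    proof
      fix x :: "real^'n" assume "x \<in> periods"
      then obtain k :: "'n \<Rightarrow> int" where "\<And>i. x $ i = 2 * of_int (k i)" unfolding periods_def mem_Collect_eq by metis
      then have "x = (\<chi> i. 2 * real_of_int (k i))" by (simp add: vec_eq_iff)
      then show "x \<in> range (\<lambda>k :: 'n \<Rightarrow> int. \<chi> i. 2 * real_of_int (k i))" by blast
    qed
    moreover have "countable (UNIV :: ('n \<Rightarrow> int) set)" by simp
    ultimately show ?thesis by (meson countable_image countable_subset)
  qed
  have "periodize (\<Union>Thc) \<in> sets borel"
    unfolding periodize_def
    by (rule sets.countable_UN'[OF cl]) (auto intro!: borel_closed closed_translation closed_Thc)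
  moreover have "\<Union>{T' \<in> M. E \<inter> T' \<noteq> {}} \<in> sets borel"
  proof -
    have "countable M"
    proof -
      have "M \<subseteq> (\<Union>n::nat. {T\<in>M. T \<inter> cball 0 (real n) \<noteq> {}})"
      proof
        fix T assume T: "T \<in> M"
        then obtain x where x: "x \<in> T" using simplex_interior[OF M_simplex] interior_subset by blast
        obtain n :: nat where "norm x \<le> real n" using real_arch_simple by blast
        then have "x \<in> cball 0 (real n)" by simp
        then show "T \<in> (\<Union>n::nat. {T\<in>M. T \<inter> cball 0 (real n) \<noteq> {}})" using T x by blast
      qed
      moreover have "countable {T\<in>M. T \<inter> cball 0 (real n) \<noteq> {}}" for n :: nat
      proof -
        have "finite {T\<in>M. T \<inter> cball 0 (real n) \<noteq> {}}"
          by (rule regular_triangulationD(3)[OF M.regular]) simp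
        then show ?thesis by (rule countable_finite)
      qed
      then have "countable (\<Union>n::nat. {T\<in>M. T \<inter> cball 0 (real n) \<noteq> {}})" by simp
      ultimately show ?thesis by (rule countable_subset)
    qed
    then have "countable {T' \<in> M. E \<inter> T' \<noteq> {}}" by (rule countable_subset[rotated]) auto
    then show ?thesis by (rule sets.countable_Union) (auto intro: borel_closed M_closed)
  qed
  ultimately show ?thesis unfolding patch_c_def by (rule sets.Int)
qed

text \<open>Both fine elements meet the interior of \<open>T\<close> in nonempty open sets, which lie in the patch of \<open>E\<close>. On their
  product, a set of positive measure, the difference of the gradients is constant, so that it cannot
  exceed the essential supremum.\<close>

lemma osc_ge:
  assumes T: "T \<in> Thc" and E: "E \<in> F T" "E' \<in> F T" "E \<inter> E' \<noteq> {}"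
  shows "ennreal (norm (G E' - G E)) \<le> ennreal e * osc_grad N yf (patch_c N Q Thc E)"
proof -
  let ?W = "patch_c N Q Thc E"
  let ?f = "\<lambda>(x, x'). ennreal (norm (grad yf x - grad yf x'))"
  let ?s = "esssup (lebesgue_on (?W \<times> ?W)) ?f"
  have W: "?W \<times> ?W \<in> sets lebesgue"
    using patch_measurable[of E] by (intro sets_completionI_sets) (auto intro: borel_Times)
  have patch: "interior K \<inter> interior T \<subseteq> ?W" if K: "K \<in> F T" "E \<inter> K \<noteq> {}" for K
  proof -
    have "(0 :: real^'n) \<in> periods" by (auto simp: periods_def intro: exI[of _ 0])
    then have "\<Union>Thc \<subseteq> periodize (\<Union>Thc)" unfolding periodize_def by force
    then show ?thesis
      using K F_M[OF K(1)] T interior_subset[of K] interior_subset[of T] unfolding patch_c_def by blast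
  qed
  let ?U = "(interior E' \<inter> interior T) \<times> (interior E \<inter> interior T)"
  have "E \<inter> E \<noteq> {}" using E(3) by auto
  then have sub: "?U \<subseteq> ?W \<times> ?W" using patch[OF E(2,3)] patch[OF E(1)] by blast
  have "AE p in lebesgue_on (?W \<times> ?W). ?f p \<le> ?s" by (rule esssup_AE)
  then have "AE p in lebesgue. p \<in> ?W \<times> ?W \<longrightarrow> ?f p \<le> ?s"
    using W by (simp add: AE_restrict_space_iff)
  moreover have "open ?U" by (intro open_Times open_Int open_interior)
  moreover have "?U \<noteq> {}" using F_interior[OF E(1)] F_interior[OF E(2)] by auto
  ultimately obtain p where p: "p \<in> ?U" "p \<in> ?W \<times> ?W \<longrightarrow> ?f p \<le> ?s"
    using AE_lebesgue_open_witness[of "\<lambda>p. p \<in> ?W \<times> ?W \<longrightarrow> ?f p \<le> ?s" ?U] by blast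
  then have fs: "?f p \<le> ?s" using sub by blast
  obtain a b where ab: "p = (a, b)" "a \<in> interior E'" "b \<in> interior E" using p(1) by auto
  have "?f p = ennreal (norm (G E' - G E))"
    using grad_yf[OF F_M[OF E(2)] ab(2)] grad_yf[OF F_M[OF E(1)] ab(3)] ab(1) by simp
  with fs have "ennreal (norm (G E' - G E)) \<le> ?s" by simp
  also have "?s = ennreal e * osc_grad N yf ?W"
  proof -
    have "ennreal e * (ennreal (1 / e) * ?s) = ennreal (e * (1 / e)) * ?s"
      using M.e_pos by (intro ennreal_mult_assoc) auto
    also have "e * (1 / e) = 1" using M.e_pos by simp
    finally show ?thesis by (simp add: osc_grad_def)
  qed
  finally show ?thesis .
qed

abbreviation \<kappa>' where "\<kappa>' \<equiv> max 1 (4 * \<kappa>)"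

lemma coarse_element_instance:
  assumes T: "T \<in> Thc" and osc: "osc \<in> borel_measurable borel" "\<And>x. osc x \<ge> 0"
    and osc_le: "\<And>E x. E \<in> F T \<Longrightarrow> x \<in> E \<Longrightarrow> osc_grad N yf (patch_c N Q Thc E) \<le> ennreal (osc x)"
  shows "\<exists>x0 r. coarse_element T (F T) yf G osc e (vertices_of T) x0 r (diameter T) \<kappa>' (GI T)"
proof -
  have TTh: "T \<in> Th" using T Thc_subset by auto
  note V = simplex_vertices[OF Th_simplex[OF TTh]]
  have comp: "compact T" using compact_simplex[OF Th_simplex[OF TTh]] .
  have "diameter T / inball_diameter T \<le> shape_regularity Th"
    unfolding shape_regularity_def using finite_Th TTh by (intro Max_ge) auto
  with shape have "diameter T / inball_diameter T \<le> \<kappa>" by simp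
  then obtain x0 r where r: "cball x0 r \<subseteq> T" "r > 0" "diameter T \<le> \<kappa>' * r"
    using inball_of_shape[OF comp simplex_interior[OF Th_simplex[OF TTh]]] by metis
  have diamT: "norm (x - z) \<le> diameter T" if "x \<in> T" "z \<in> T" for x z
    using diameter_bounded_bound[OF compact_imp_bounded[OF comp] that] by (simp add: dist_norm)
  have e_le: "e \<le> diameter T"
  proof -
    have "card (vertices_of T) \<ge> 2" using V(3) by simp
    then obtain v w where vw: "v \<in> vertices_of T" "w \<in> vertices_of T" "v \<noteq> w"
      by (meson card_2_iff' ex_card obtain_subset_with_card_n subsetD)
    then obtain i where i: "v $ i \<noteq> w $ i" by (auto simp: vec_eq_iff)
    obtain a b :: int where ab: "v $ i = e * of_int a" "w $ i = e * of_int b"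
      using coarse_vertex[OF TTh] vw by (fastforce simp: lattice_pts_def)
    have "a \<noteq> b" using i ab by auto
    then have "1 \<le> \<bar>real_of_int a - real_of_int b\<bar>" by linarith
    then have "e * 1 \<le> e * \<bar>real_of_int a - real_of_int b\<bar>" using M.e_pos by (intro mult_left_mono) auto
    also have "\<dots> = \<bar>(v - w) $ i\<bar>" using M.e_pos by (simp add: ab abs_mult right_diff_distrib[symmetric])
    also have "\<dots> \<le> norm (v - w)" by (rule component_le_norm_cart)
    also have "\<dots> \<le> diameter T" using vw vertices_subset by (intro diamT) auto
    finally show ?thesis by simp
  qed
  have "coarse_element T (F T) yf G osc e (vertices_of T) x0 r (diameter T) \<kappa>' (GI T)"
  proof
    show "convex T" using convex_simplex[OF Th_simplex[OF TTh]] .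
    show "0 < e" by (rule M.e_pos)
    show "T \<subseteq> \<Union>(F T)" by (rule F_cover[OF TTh])
    show "yf x - yf q = G E *v (x - q)" if "E \<in> F T" "x \<in> E" "q \<in> E" for E x q
      using that F_M by (intro yf_diff) auto
    show "norm (x - q) \<le> 2 * e" if "E \<in> F T" "x \<in> E" "q \<in> E" for E x q
      using that F_M by (intro M.diam_le) auto
    show "E \<inter> E' \<noteq> {}" if "E \<in> F T" "E' \<in> F T" "x \<in> E" "x' \<in> E'" "norm (x' - x) \<le> e / 6" for E E' x x'
      using that F_M by (intro M.near_elements_meet[of E E' x x']) auto
    show "norm (G E' - G E) \<le> e * osc x"
      if "E \<in> F T" "E' \<in> F T" "E \<inter> E' \<noteq> {}" "x \<in> E" "x \<in> T" for E E' x
    proof -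
      have "ennreal (norm (G E' - G E)) \<le> ennreal e * osc_grad N yf (patch_c N Q Thc E)"
        using T that(1-3) by (rule osc_ge)
      also have "\<dots> \<le> ennreal e * ennreal (osc x)"
        using osc_le[OF that(1,4)] by (intro mult_left_mono) auto
      also have "\<dots> = ennreal (e * osc x)" using M.e_pos by (simp add: ennreal_mult')
      finally show ?thesis using osc(2)[of x] M.e_pos by (simp add: ennreal_le_iff)
    qed
    show "CARD('n) \<in> {1, 2}" by (rule dim)
    show "finite (vertices_of T)" by (rule V(1))
    show "card (vertices_of T) \<le> 3" using V(3) dim by auto
    show "T = convex hull vertices_of T" by (rule V(4))
    show "v \<notin> ball x0 r" if "v \<in> vertices_of T" for v
    proof -
      have "ball x0 r \<subseteq> interior T" using r(1) ball_subset_cball by (intro interior_maximal) auto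
      moreover have "v \<notin> interior T"
        using that extreme_point_not_in_interior by (auto simp: vertices_of_def)
      ultimately show ?thesis by auto
    qed
    show "cball x0 r \<subseteq> T" "0 < r" "diameter T \<le> \<kappa>' * r" by (rule r)+
    show "norm (x - z) \<le> diameter T" if "x \<in> T" "z \<in> T" for x z using that by (rule diamT)
    show "e \<le> diameter T" by (rule e_le)
    show "1 \<le> \<kappa>'" by simp
    show "GI T *v (v - v') = yf v - yf v'" if v: "v \<in> vertices_of T" "v' \<in> vertices_of T" for v v'
      using Iy_diff[OF TTh, of v v'] Iy_vertex[OF TTh] yf_lattice coarse_vertex[OF TTh] v vertices_subset[of T]
      by (metis subsetD)
    show "osc \<in> borel_measurable borel" by (rule osc(1))
    show "0 \<le> osc x" for x by (rule osc(2))
  qed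
  then show ?thesis by blast
qed

end

section \<open>The error estimates\<close>

lemma entry_norm_powr_le:
  fixes A :: "real^'n^'n"
  assumes p: "p \<ge> 1" and dim: "CARD('n) \<in> {1, 2}"
  shows "entry_norm p A powr p \<le> 4 * norm A powr p"
proof -
  let ?S = "\<Sum>i\<in>UNIV. \<Sum>j\<in>UNIV. \<bar>A $ i $ j\<bar> powr p"
  have "entry_norm p A powr p = ?S"
    using p by (simp add: entry_norm_def powr_powr sum_nonneg)
  also have "\<dots> \<le> (\<Sum>i\<in>(UNIV::'n set). \<Sum>j\<in>(UNIV::'n set). norm A powr p)"
  proof (intro sum_mono powr_mono2)
    fix i j
    have "\<bar>A $ i $ j\<bar> \<le> norm (A $ i)" by (rule component_le_norm_cart)
    also have "\<dots> \<le> norm A" by (rule Finite_Cartesian_Product.norm_nth_le)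
    finally show "\<bar>A $ i $ j\<bar> \<le> norm A" .
  qed (use p in auto)
  also have "\<dots> = (real CARD('n) * real CARD('n)) * norm A powr p" by simp
  also have "\<dots> \<le> 4 * norm A powr p"
    using dim by (intro mult_right_mono) auto
  finally show ?thesis .
qed

lemma entry_max_le_norm: "entry_max (A :: real^'n^'m) \<le> norm A"
proof -
  have "\<bar>A $ i $ j\<bar> \<le> norm A" for i j
    using component_le_norm_cart[of "A $ i" j] Finite_Cartesian_Product.norm_nth_le[of A i] by simp
  then show ?thesis unfolding entry_max_def by (subst Max_le_iff) auto
qed

lemma epowr_ennreal: "a \<ge> 0 \<Longrightarrow> epowr (ennreal a) p = ennreal (a powr p)"
  by (simp add: epowr_def)

lemma epowr_mono: "a \<le> b \<Longrightarrow> r \<ge> 0 \<Longrightarrow> epowr a r \<le> epowr b r"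
  by (auto simp: epowr_def less_top top_unique intro!: ennreal_leI powr_mono2 enn2real_mono)

lemma epowr_cmult:
  assumes "C > 0" "p \<ge> 1"
  shows "epowr (ennreal (C powr p) * S) (1 / p) = ennreal C * epowr S (1 / p)"
proof (cases S)
  case (real s)
  have "(C powr p * s) powr (1 / p) = C * s powr (1 / p)"
    using assms by (simp add: powr_mult powr_powr)
  then show ?thesis
    using real assms by (simp add: ennreal_mult'[symmetric] epowr_ennreal)
next
  case top
  then show ?thesis using assms by (simp add: epowr_def ennreal_mult_top)
qed

context coupled_mesh
begin

definition M\<^sub>\<Omega> :: "(real^'n) set set" where
  "M\<^sub>\<Omega> = {E\<in>M. E \<inter> cbox (-1) 1 \<noteq> {}}"

text \<open>A null set off which a point of the cube lies in the interior of exactly one coarse and one fine element.\<close>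

definition skeleton :: "(real^'n) set" where
  "skeleton = (\<Union>T\<in>Th. frontier T) \<union> (\<Union>E\<in>M\<^sub>\<Omega>. frontier E)"

lemma finite_M\<^sub>\<Omega>: "finite M\<^sub>\<Omega>"
  unfolding M\<^sub>\<Omega>_def by (rule regular_triangulationD(3)[OF M.regular]) simp

lemma AE_off_skeleton: "AE x in lborel. x \<notin> skeleton"
proof -
  have "negligible (\<Union>T\<in>Th. frontier T)"
    using finite_Th convex_simplex[OF Th_simplex]
    by (intro negligible_Union) (auto intro: negligible_convex_frontier)
  moreover have "negligible (\<Union>E\<in>M\<^sub>\<Omega>. frontier E)"
    using finite_M\<^sub>\<Omega> convex_simplex[OF M_simplex]
    by (intro negligible_Union) (auto simp: M\<^sub>\<Omega>_def intro: negligible_convex_frontier)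
  ultimately have "negligible skeleton" unfolding skeleton_def by (rule negligible_Un)
  then have "AE x in lebesgue. x \<notin> skeleton" by (simp add: negligible_iff_null_sets AE_not_in)
  then show ?thesis by (simp add: AE_completion_iff)
qed

definition generic :: "real^'n \<Rightarrow> (real^'n) set \<Rightarrow> (real^'n) set \<Rightarrow> bool" where
  "generic x T E \<longleftrightarrow> T \<in> Th \<and> E \<in> F T \<and> x \<in> interior T \<and> x \<in> interior E \<and>
     (\<forall>T'\<in>Th. x \<in> T' \<longrightarrow> T' = T) \<and> (\<forall>E'\<in>M. x \<in> E' \<longrightarrow> E' = E)"

lemma genericD:
  assumes "generic x T E"
  shows "T \<in> Th" "E \<in> F T" "x \<in> interior T" "x \<in> interior E" "x \<in> T" "x \<in> E"
    "T' \<in> Th \<Longrightarrow> x \<in> T' \<Longrightarrow> T' = T" "E' \<in> M \<Longrightarrow> x \<in> E' \<Longrightarrow> E' = E"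
    "grad (\<lambda>x. yf x - Iy x) x = G E - GI T"
proof -
  show g: "T \<in> Th" "E \<in> F T" "x \<in> interior T" "x \<in> interior E"
    using assms by (simp_all add: generic_def)
  show "x \<in> T" "x \<in> E" using g(3,4) interior_subset by auto
  show "T' \<in> Th \<Longrightarrow> x \<in> T' \<Longrightarrow> T' = T" "E' \<in> M \<Longrightarrow> x \<in> E' \<Longrightarrow> E' = E"
    using assms by (simp_all add: generic_def)
  show "grad (\<lambda>x. yf x - Iy x) x = G E - GI T"
    by (rule grad_error[OF F_M[OF g(2)] g(1,4,3)])
qed

lemma off_skeleton:
  assumes x: "x \<in> cbox (-1) 1" "x \<notin> skeleton"
  shows "\<exists>T E. generic x T E"
proof -
  have "x \<in> \<Union>Th" using x(1) Th_cover by simp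
  then obtain T where T: "T \<in> Th" "x \<in> T" by blast
  have "x \<in> \<Union>M" using M.cover by simp
  then obtain E where E: "E \<in> M" "x \<in> E" by blast
  have EO: "E \<in> M\<^sub>\<Omega>" using E x(1) by (auto simp: M\<^sub>\<Omega>_def)
  have "x \<notin> frontier T" "x \<notin> frontier E" using x(2) T(1) EO unfolding skeleton_def by auto
  then have xi: "x \<in> interior T" "x \<in> interior E"
    using T(2) E(2) closure_subset unfolding frontier_def by blast+
  have "T' = T" if "T' \<in> Th" "x \<in> T'" for T'
    using triangulation_interiors_disjoint[OF Th_regular T(1) that(1)] xi(1) that(2) by blast
  moreover have "E' = E" if "E' \<in> M" "x \<in> E'" for E'
    using triangulation_interiors_disjoint[OF M.regular E(1) that(1)] xi(2) that(2) by blast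
  moreover have "E \<in> F T" using E xi(1) by (auto simp: F_def)
  ultimately show ?thesis unfolding generic_def using T(1) xi by blast
qed

lemma Omega_generic:
  assumes "x \<in> Omega" "x \<notin> skeleton"
  shows "\<exists>T E. generic x T E"
proof (rule off_skeleton)
  show "x \<in> cbox (-1) 1" using assms(1) closure_Omega closure_subset by blast
qed (rule assms(2))

lemma error_vanishes:
  assumes T: "T \<in> Th" "T \<notin> Thc" and E: "E \<in> F T"
  shows "G E - GI T = 0"
proof -
  have TM: "T \<in> M" using T split(1) fine by (auto simp: fine_mesh_def)
  have "interior E \<inter> T \<noteq> {}" using F_interior[OF E] interior_subset by blast
  then have "E = T" by (rule triangulation_interiors_disjoint[OF M.regular F_M[OF E] TM])
  then show ?thesis using grad_coincide[OF T(1) TM] by simp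
qed

abbreviation h where "h E \<equiv> elt_mesh_size Th E"
abbreviation osc where "osc E \<equiv> osc_grad N yf (patch_c N Q Thc E)"
abbreviation "continuum \<equiv> fine_mesh_c N Q Thc"

lemma diameter_pos: assumes "T \<in> Th" shows "diameter T > 0"
proof -
  have "bounded T" using compact_simplex[OF Th_simplex[OF assms]] by (rule compact_imp_bounded)
  obtain x where "x \<in> interior T" using simplex_interior[OF Th_simplex[OF assms]] by auto
  then obtain r where r: "r > 0" "cball x r \<subseteq> T" by (auto simp: mem_interior_cball)
  then have "diameter (cball x r) \<le> diameter T" using \<open>bounded T\<close> by (intro diameter_subset)
  then show ?thesis using r by simp
qed

lemma h_pos: "T \<in> Th \<Longrightarrow> E \<in> F T \<Longrightarrow> h E > 0"
  using elt_mesh_size_ge[of T E] diameter_pos[of T] by simp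

lemma finite_continuum: "finite continuum"
proof -
  have "continuum \<subseteq> M\<^sub>\<Omega>"
  proof
    fix E assume "E \<in> continuum"
    then have E: "E \<in> M" "E \<subseteq> cbox (-1) 1" by (auto simp: fine_mesh_c_def fine_mesh_def closure_Omega)
    moreover have "E \<noteq> {}" using simplex_interior[OF M_simplex[OF E(1)]] by auto
    ultimately show "E \<in> M\<^sub>\<Omega>" by (auto simp: M\<^sub>\<Omega>_def)
  qed
  then show ?thesis using finite_M\<^sub>\<Omega> finite_subset by blast
qed

lemma M_borel: "E \<in> M \<Longrightarrow> E \<in> sets borel"
  using M_closed by (rule borel_closed)

lemma Th_borel: "T \<in> Th \<Longrightarrow> T \<in> sets borel"
  using closed_simplex[OF Th_simplex] by (rule borel_closed)

lemma Th_in_cube: "T \<in> Th \<Longrightarrow> T \<subseteq> cbox (-1) 1"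
  using Th_cover by blast

text \<open>An infinite oscillation becomes \<open>0\<close> here, so finiteness has to be known wherever this is used.\<close>

definition osc_real :: "(real^'n) set \<Rightarrow> real" where
  "osc_real E = enn2real (osc E)"

text \<open>At a point \<open>x\<close> of \<open>T\<close> off the skeleton this is the oscillation around the fine element that contains \<open>x\<close>; on the boundaries,
  where several terms are added, it still dominates the oscillation of each of the elements.\<close>

definition osc_fun :: "(real^'n) set \<Rightarrow> real^'n \<Rightarrow> real" where
  "osc_fun T x = (\<Sum>E\<in>F T. indicator E x * osc_real E)"

lemma osc_fun_nonneg: "osc_fun T x \<ge> 0"
  unfolding osc_fun_def osc_real_def by (intro sum_nonneg mult_nonneg_nonneg) auto

lemma osc_fun_measurable: "osc_fun T \<in> borel_measurable borel"
proof -
  have "(\<lambda>x. indicator E x * osc_real E :: real) \<in> borel_measurable borel" if "E \<in> F T" for E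
    using M_borel[OF F_M[OF that]] by measurable
  then show ?thesis unfolding osc_fun_def by (rule borel_measurable_sum)
qed

definition error_const :: real where "error_const = 9632 * \<kappa>' ^ 4"

lemma error_const_ge: "error_const \<ge> 9632" "error_const \<ge> 588 * \<kappa>'"
proof -
  have "\<kappa>' ^ 1 \<le> \<kappa>' ^ 4" by (rule power_increasing) auto
  then have "\<kappa>' \<le> \<kappa>' ^ 4" "1 \<le> \<kappa>'" by simp_all
  then show "error_const \<ge> 9632" "error_const \<ge> 588 * \<kappa>'" unfolding error_const_def by linarith+
qed

text \<open>Almost everywhere a single coarse and a single fine element contribute. Thus the sum over \<open>T\<close> of the
  element estimates has an integrand that is dominated by the step function whose integral is the
  right-hand side.\<close>

lemma Lp_bound_finite:
  assumes p: "p \<ge> 1" and fin: "\<And>T E. T \<in> Thc \<Longrightarrow> E \<in> F T \<Longrightarrow> osc E \<noteq> top"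
  shows "(\<integral>\<^sup>+x\<in>Omega. epowr (ennreal (entry_norm p (grad (\<lambda>x. yf x - Iy x) x))) p \<partial>lebesgue)
    \<le> ennreal (4 * error_const powr p) * (\<Sum>E\<in>continuum. emeasure lebesgue E * epowr (ennreal (h E) * osc E) p)"
proof -
  let ?R = "\<lambda>w. \<Sum>E\<in>continuum. epowr (ennreal (h E) * osc E) p * indicator E w"
  let ?\<phi> = "\<lambda>x. epowr (ennreal (entry_norm p (grad (\<lambda>x. yf x - Iy x) x))) p"
  have osc_eq: "osc E = ennreal (osc_real E)" if "T \<in> Thc" "E \<in> F T" for T E
    using fin[OF that] by (simp add: osc_real_def less_top)
  have finThc: "finite Thc" using Thc_subset finite_Th finite_subset by blast
  have "\<forall>T\<in>Thc. \<exists>g. g \<in> borel_measurable borel \<and>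
    (\<forall>x\<in>T. \<forall>E\<in>F T. x \<in> E \<longrightarrow> ennreal (norm (GI T - G E) powr p) \<le> g x) \<and>
    (\<integral>\<^sup>+x. indicator T x * g x \<partial>lborel)
      \<le> ennreal ((error_const * diameter T) powr p) * (\<integral>\<^sup>+w. ennreal (indicator T w * osc_fun T w powr p) \<partial>lborel)"
  proof
    fix T assume T: "T \<in> Thc"
    have le: "osc E \<le> ennreal (osc_fun T x)" if "E \<in> F T" "x \<in> E" for E x
    proof -
      have "finite (F T)" using finite_F T Thc_subset by auto
      moreover have "0 \<le> osc_real E'" for E' by (simp add: osc_real_def)
      ultimately have "indicator E x * osc_real E \<le> osc_fun T x"
        unfolding osc_fun_def using that(1) by (intro member_le_sum) auto
      then show ?thesis using that(2) osc_eq[OF T that(1)] by (simp add: ennreal_leI)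
    qed
    obtain x0 r where "coarse_element T (F T) yf G (osc_fun T) e (vertices_of T) x0 r (diameter T) \<kappa>' (GI T)"
      using coarse_element_instance[OF T osc_fun_measurable osc_fun_nonneg le] by blast
    from coarse_element.gradient_error_Lp[OF this p]
    show "\<exists>g. g \<in> borel_measurable borel \<and>
      (\<forall>x\<in>T. \<forall>E\<in>F T. x \<in> E \<longrightarrow> ennreal (norm (GI T - G E) powr p) \<le> g x) \<and>
      (\<integral>\<^sup>+x. indicator T x * g x \<partial>lborel)
        \<le> ennreal ((error_const * diameter T) powr p) * (\<integral>\<^sup>+w. ennreal (indicator T w * osc_fun T w powr p) \<partial>lborel)"
      unfolding error_const_def .
  qed
  from bchoice[OF this] obtain g where g_meas: "\<And>T. T \<in> Thc \<Longrightarrow> g T \<in> borel_measurable borel"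
    and g_ge: "\<And>T x E. T \<in> Thc \<Longrightarrow> x \<in> T \<Longrightarrow> E \<in> F T \<Longrightarrow> x \<in> E \<Longrightarrow> ennreal (norm (GI T - G E) powr p) \<le> g T x"
    and g_int: "\<And>T. T \<in> Thc \<Longrightarrow> (\<integral>\<^sup>+x. indicator T x * g T x \<partial>lborel)
      \<le> ennreal ((error_const * diameter T) powr p) * (\<integral>\<^sup>+w. ennreal (indicator T w * osc_fun T w powr p) \<partial>lborel)"
    by blast
  have T_borel: "T \<in> sets borel" if "T \<in> Thc" for T using that Thc_subset Th_borel by auto
  have "(\<integral>\<^sup>+x\<in>Omega. ?\<phi> x \<partial>lebesgue) = (\<integral>\<^sup>+x. ?\<phi> x * indicator Omega x \<partial>lborel)"
    by (rule nn_integral_completion)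
  also have "\<dots> \<le> (\<integral>\<^sup>+x. (\<Sum>T\<in>Thc. 4 * (indicator T x * g T x)) \<partial>lborel)"
  proof (rule nn_integral_mono_AE)
    show "AE x in lborel. ?\<phi> x * indicator Omega x \<le> (\<Sum>T\<in>Thc. 4 * (indicator T x * g T x))"
      using AE_off_skeleton
    proof eventually_elim
      case (elim x)
      show ?case
      proof (cases "x \<in> Omega")
        case True
        then obtain T E where "generic x T E" using Omega_generic elim by blast
        note TE = genericD(1,2)[OF this] and x = genericD(5,6)[OF this] and grad = genericD(9)[OF this]
        show ?thesis
        proof (cases "T \<in> Thc")
          case False
          then have "?\<phi> x = 0"
            using error_vanishes[OF TE(1) _ TE(2)] p by (simp add: grad entry_norm_def epowr_def)
          then show ?thesis by simp
        next
          case T: True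
          have "?\<phi> x = ennreal (entry_norm p (G E - GI T) powr p)"
            unfolding grad by (rule epowr_ennreal) (simp add: entry_norm_def)
          also have "\<dots> \<le> ennreal (4 * norm (G E - GI T) powr p)"
            by (intro ennreal_leI entry_norm_powr_le p dim)
          also have "\<dots> = 4 * ennreal (norm (GI T - G E) powr p)"
            by (simp add: ennreal_mult' norm_minus_commute)
          also have "\<dots> \<le> 4 * (indicator T x * g T x)"
            using g_ge[OF T x(1) TE(2) x(2)] x(1) by (intro mult_left_mono) auto
          also have "\<dots> \<le> (\<Sum>T\<in>Thc. 4 * (indicator T x * g T x))"
            using T finThc by (intro member_le_sum) auto
          finally show ?thesis using True by simp
        qed
      qed simp
    qed
  qed
  also have "\<dots> = (\<Sum>T\<in>Thc. 4 * (\<integral>\<^sup>+x. indicator T x * g T x \<partial>lborel))"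
  proof -
    have "(\<lambda>x. indicator T x * g T x) \<in> borel_measurable lborel" if "T \<in> Thc" for T
      using g_meas[OF that] T_borel[OF that] by measurable
    from nn_integral_sum_cmult[OF this, where c = "\<lambda>_. 4"] show ?thesis .
  qed
  also have "\<dots> \<le> (\<Sum>T\<in>Thc. 4 * (ennreal ((error_const * diameter T) powr p)
      * (\<integral>\<^sup>+w. ennreal (indicator T w * osc_fun T w powr p) \<partial>lborel)))"
    using g_int by (intro sum_mono mult_left_mono) auto
  also have "\<dots> = (\<integral>\<^sup>+w. (\<Sum>T\<in>Thc. 4 * (ennreal ((error_const * diameter T) powr p)
      * ennreal (indicator T w * osc_fun T w powr p))) \<partial>lborel)"
  proof -
    have "(\<lambda>w. ennreal (indicator T w * osc_fun T w powr p)) \<in> borel_measurable lborel" if "T \<in> Thc" for T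
      using osc_fun_measurable[of T] T_borel[OF that] by measurable
    then have "(\<integral>\<^sup>+w. (\<Sum>T\<in>Thc. (4 * ennreal ((error_const * diameter T) powr p))
          * ennreal (indicator T w * osc_fun T w powr p)) \<partial>lborel)
        = (\<Sum>T\<in>Thc. (4 * ennreal ((error_const * diameter T) powr p))
          * (\<integral>\<^sup>+w. ennreal (indicator T w * osc_fun T w powr p) \<partial>lborel))"
      by (rule nn_integral_sum_cmult)
    then show ?thesis by (simp only: mult.assoc)
  qed
  also have "\<dots> \<le> (\<integral>\<^sup>+w. ennreal (4 * error_const powr p) * ?R w \<partial>lborel)"
  proof (rule nn_integral_mono_AE)
    show "AE w in lborel. (\<Sum>T\<in>Thc. 4 * (ennreal ((error_const * diameter T) powr p)
      * ennreal (indicator T w * osc_fun T w powr p)))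
      \<le> ennreal (4 * error_const powr p) * ?R w"
      using AE_off_skeleton
    proof eventually_elim
      case (elim w)
      let ?t = "\<lambda>T. 4 * (ennreal ((error_const * diameter T) powr p) * ennreal (indicator T w * osc_fun T w powr p))"
      show ?case
      proof (cases "\<exists>T\<in>Thc. w \<in> T")
        case False
        then have "(\<Sum>T\<in>Thc. ?t T) = 0" by (intro sum.neutral) auto
        then show ?thesis by simp
      next
        case True
        then obtain T where T: "T \<in> Thc" "w \<in> T" by auto
        then have TTh: "T \<in> Th" using Thc_subset by auto
        have "w \<in> cbox (-1) 1" using Th_in_cube[OF TTh] T(2) by auto
        then obtain T' E where gen: "generic w T' E" using off_skeleton elim by blast
        then have "T' = T" using genericD(7)[OF gen TTh T(2)] by simp
        note gen = gen[unfolded this]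
        note E = genericD(2)[OF gen] and wE = genericD(6)[OF gen]
          and uT = genericD(7)[OF gen] and uE = genericD(8)[OF gen]
        have "(\<Sum>T\<in>Thc. ?t T) = (\<Sum>T\<in>{T}. ?t T)"
        proof (rule sum.mono_neutral_right)
          show "\<forall>T''\<in>Thc - {T}. ?t T'' = 0"
          proof
            fix T'' assume "T'' \<in> Thc - {T}"
            then have "w \<notin> T''" using uT[of T''] Thc_subset by auto
            then show "?t T'' = 0" by simp
          qed
        qed (use finThc T in auto)
        also have "\<dots> = 4 * (ennreal ((error_const * diameter T) powr p) * ennreal (osc_fun T w powr p))"
          using T(2) by simp
        also have "osc_fun T w = osc_real E"
        proof -
          have "osc_fun T w = (\<Sum>E'\<in>{E}. indicator E' w * osc_real E')"
            unfolding osc_fun_def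
          proof (rule sum.mono_neutral_right)
            show "\<forall>E'\<in>F T - {E}. indicator E' w * osc_real E' = 0"
              using uE F_M by (auto simp: indicator_def)
          qed (use finite_F[OF TTh] E in auto)
          then show ?thesis using wE by simp
        qed
        also have "4 * (ennreal ((error_const * diameter T) powr p) * ennreal (osc_real E powr p))
            = ennreal (4 * ((error_const * diameter T) powr p * osc_real E powr p))"
          by (simp add: ennreal_mult')
        also have "\<dots> \<le> ennreal (4 * error_const powr p * (h E * osc_real E) powr p)"
        proof (rule ennreal_leI)
          have "diameter T powr p \<le> h E powr p"
            using elt_mesh_size_ge[OF TTh E] diameter_pos[OF TTh] p by (intro powr_mono2) auto
          then have "4 * error_const powr p * (diameter T powr p * osc_real E powr p) \<le> 4 * error_const powr p * (h E powr p * osc_real E powr p)"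
            by (intro mult_left_mono mult_right_mono) auto
          then show "4 * ((error_const * diameter T) powr p * osc_real E powr p) \<le> 4 * error_const powr p * (h E * osc_real E) powr p"
            by (simp add: powr_mult mult_ac)
        qed
        also have "\<dots> = ennreal (4 * error_const powr p) * (epowr (ennreal (h E) * osc E) p * indicator E w)"
        proof -
          have "0 \<le> h E * osc_real E" using h_pos[OF TTh E] by (simp add: osc_real_def)
          then show ?thesis
            using wE h_pos[OF TTh E] unfolding osc_eq[OF T(1) E]
            by (simp add: ennreal_mult'[symmetric] epowr_ennreal)
        qed
        also have "\<dots> \<le> ennreal (4 * error_const powr p) * ?R w"
          using F_continuum[OF T(1) E] finite_continuum
          by (intro mult_left_mono member_le_sum[of E continuum "\<lambda>E. epowr (ennreal (h E) * osc E) p * indicator E w"]) auto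
        finally show ?thesis .
      qed
    qed
  qed
  also have "\<dots> = ennreal (4 * error_const powr p) * (\<Sum>E\<in>continuum. emeasure lebesgue E * epowr (ennreal (h E) * osc E) p)"
  proof -
    have E: "E \<in> sets borel" if "E \<in> continuum" for E
      using that M_borel by (auto simp: fine_mesh_c_def fine_mesh_def)
    then have m: "(indicator E :: real^'n \<Rightarrow> ennreal) \<in> borel_measurable lborel" if "E \<in> continuum" for E
      using that by measurable
    have "?R \<in> borel_measurable lborel"
    proof (rule borel_measurable_sum)
      fix E assume "E \<in> continuum"
      from m[OF this] show "(\<lambda>w. epowr (ennreal (h E) * osc E) p * indicator E w) \<in> borel_measurable lborel"
        by measurable
    qed
    then have "(\<integral>\<^sup>+w. ennreal (4 * error_const powr p) * ?R w \<partial>lborel)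
      = ennreal (4 * error_const powr p) * (\<integral>\<^sup>+w. ?R w \<partial>lborel)"
      by (rule nn_integral_cmult)
    also have "(\<integral>\<^sup>+w. ?R w \<partial>lborel)
      = (\<Sum>E\<in>continuum. epowr (ennreal (h E) * osc E) p * (\<integral>\<^sup>+w. indicator E w \<partial>lborel))"
      using m by (rule nn_integral_sum_cmult)
    also have "\<dots> = (\<Sum>E\<in>continuum. emeasure lebesgue E * epowr (ennreal (h E) * osc E) p)"
      using E by (intro sum.cong) (auto simp: mult.commute)
    finally show ?thesis .
  qed
  finally show ?thesis .
qed

text \<open>If a relevant oscillation is infinite, so is the right-hand side: a fine element has positive measure
  and positive mesh size.\<close>

lemma Lp_estimate:
  assumes p: "p \<ge> 1"
  shows "grad_Lp_norm p Omega (\<lambda>x. yf x - Iy x) \<le> ennreal (4 * error_const) *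
    epowr (\<Sum>E\<in>continuum. emeasure lebesgue E * epowr (ennreal (h E) * osc E) p) (1 / p)"
proof -
  let ?S = "\<Sum>E\<in>continuum. emeasure lebesgue E * epowr (ennreal (h E) * osc E) p"
  let ?I = "\<integral>\<^sup>+x\<in>Omega. epowr (ennreal (entry_norm p (grad (\<lambda>x. yf x - Iy x) x))) p \<partial>lebesgue"
  have error_const: "error_const > 0" using error_const_ge by simp
  have "?I \<le> ennreal ((4 * error_const) powr p) * ?S"
  proof (cases "?S = top")
    case True
    then show ?thesis using error_const by (simp add: ennreal_mult_top)
  next
    case False
    have "osc E \<noteq> top" if TE: "T \<in> Thc" "E \<in> F T" for T E
    proof
      assume top: "osc E = top"
      have E: "E \<in> continuum" by (rule F_continuum[OF TE])
      have TTh: "T \<in> Th" using TE Thc_subset by auto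
      have "interior E \<noteq> {}" using simplex_interior M_simplex F_M[OF TE(2)] by blast
      then have "\<not> negligible E"
        using open_not_negligible[OF open_interior] negligible_subset[OF _ interior_subset] by blast
      then have "emeasure lebesgue E \<noteq> 0"
        using M_borel[OF F_M[OF TE(2)]] by (auto simp: negligible_iff_null_sets null_sets_def)
      then have "emeasure lebesgue E * epowr (ennreal (h E) * osc E) p = top"
        using h_pos[OF TTh TE(2)] by (simp add: top ennreal_mult_top epowr_def ennreal_mult_eq_top_iff)
      moreover have "emeasure lebesgue E * epowr (ennreal (h E) * osc E) p \<le> ?S"
        using E finite_continuum
        by (intro member_le_sum[of E continuum "\<lambda>E. emeasure lebesgue E * epowr (ennreal (h E) * osc E) p"]) auto
      ultimately show False using False by (simp add: top_unique)
    qed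
    then have "?I \<le> ennreal (4 * error_const powr p) * ?S" by (rule Lp_bound_finite[OF p])
    also have "\<dots> \<le> ennreal ((4 * error_const) powr p) * ?S"
    proof (intro mult_right_mono ennreal_leI)
      have "4 powr 1 \<le> (4::real) powr p" using p by (intro powr_mono) auto
      then show "4 * error_const powr p \<le> (4 * error_const) powr p" by (simp add: powr_mult mult_right_mono)
    qed simp
    finally show ?thesis .
  qed
  then have "epowr ?I (1 / p) \<le> epowr (ennreal ((4 * error_const) powr p) * ?S) (1 / p)"
    using p by (intro epowr_mono) auto
  also have "\<dots> = ennreal (4 * error_const) * epowr ?S (1 / p)"
    using error_const p by (intro epowr_cmult) auto
  finally show ?thesis by (simp add: grad_Lp_norm_def)
qed

text \<open>On \<open>T\<close> the supremum bounds every relevant oscillation by \<open>s / diameter T\<close>, so the element estimate applies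
  with a constant function in place of the oscillation.\<close>

lemma error_sup:
  assumes T: "T \<in> Th" and E: "E \<in> F T" and S: "(SUP E\<in>continuum. ennreal (h E) * osc E) = ennreal s" "s \<ge> 0"
  shows "norm (G E - GI T) \<le> 588 * \<kappa>' * s"
proof (cases "T \<in> Thc")
  case False
  then show ?thesis using error_vanishes[OF T False E] S(2) by simp
next
  case Tc: True
  let ?m = "s / diameter T"
  have d: "diameter T > 0" by (rule diameter_pos[OF T])
  have m0: "?m \<ge> 0" using d S(2) by simp
  have le: "osc E' \<le> ennreal ?m" if E': "E' \<in> F T" for E'
  proof -
    have "ennreal (diameter T) * osc E' \<le> ennreal (h E') * osc E'"
      using elt_mesh_size_ge[OF T E'] by (intro mult_right_mono ennreal_leI) auto
    also have "\<dots> \<le> ennreal s"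
      unfolding S(1)[symmetric] using F_continuum[OF Tc E'] by (rule SUP_upper)
    finally have "ennreal (1 / diameter T) * (ennreal (diameter T) * osc E') \<le> ennreal (1 / diameter T) * ennreal s"
      by (rule mult_left_mono) simp
    also have "ennreal (1 / diameter T) * (ennreal (diameter T) * osc E') = osc E'"
      using d by (subst ennreal_mult_assoc) auto
    also have "ennreal (1 / diameter T) * ennreal s = ennreal ?m"
      using d by (simp add: ennreal_mult'[symmetric])
    finally show ?thesis .
  qed
  obtain x0 r where ce: "coarse_element T (F T) yf G (\<lambda>_. ?m) e (vertices_of T) x0 r (diameter T) \<kappa>' (GI T)"
    using coarse_element_instance[OF Tc, of "\<lambda>_. ?m"] m0 le by auto
  obtain x where x: "x \<in> E" "x \<in> interior T" using E by (auto simp: F_def)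
  then have "x \<in> T" using interior_subset by auto
  from coarse_element.gradient_error_sup[OF ce this E x(1) order_refl]
  have "norm (GI T - G E) \<le> 588 * \<kappa>' * diameter T * ?m" .
  also have "\<dots> = 588 * \<kappa>' * s" using d by simp
  finally show ?thesis by (simp add: norm_minus_commute)
qed

text \<open>Almost everywhere the error gradient equals a step function.\<close>

lemma entry_max_measurable:
  "(\<lambda>x. ennreal (entry_max (grad (\<lambda>x. yf x - Iy x) x))) \<in> borel_measurable (lebesgue_on Omega)"
proof -
  let ?f = "\<lambda>x. entry_max (grad (\<lambda>x. yf x - Iy x) x)"
  let ?g = "\<lambda>T x. \<Sum>E\<in>F T. indicator (interior T \<inter> interior E) x * entry_max (G E - GI T)"
  define g where "g x = (\<Sum>T\<in>Th. ?g T x)" for x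
  have "g \<in> borel_measurable borel"
    unfolding g_def by (intro borel_measurable_sum borel_measurable_times borel_measurable_indicator) auto
  then have "(\<lambda>x. indicator Omega x * g x) \<in> borel_measurable borel"
    using Omega_borel by measurable
  then have "(\<lambda>x. indicator Omega x * g x) \<in> borel_measurable lebesgue"
    by (intro measurable_completion) simp
  moreover have "AE x in lebesgue. indicator Omega x * g x = indicator Omega x * ?f x"
    unfolding AE_completion_iff using AE_off_skeleton
  proof eventually_elim
    case (elim x)
    show ?case
    proof (cases "x \<in> Omega")
      case True
      then obtain T E where gen: "generic x T E" using Omega_generic elim by blast
      note TE = genericD(1-4)[OF gen] and uT = genericD(7)[OF gen] and uE = genericD(8)[OF gen]
      have "g x = (\<Sum>T\<in>{T}. ?g T x)"
        unfolding g_def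
      proof (rule sum.mono_neutral_right)
        show "\<forall>T'\<in>Th - {T}. ?g T' x = 0"
        proof
          fix T' assume "T' \<in> Th - {T}"
          then have "x \<notin> T'" using uT by auto
          then have "x \<notin> interior T'" using interior_subset by auto
          then show "?g T' x = 0"
            by (intro sum.neutral) auto
        qed
      qed (use finite_Th TE in auto)
      also have "\<dots> = ?g T x" by simp
      also have "\<dots> = (\<Sum>E\<in>{E}. indicator (interior T \<inter> interior E) x * entry_max (G E - GI T))"
      proof (rule sum.mono_neutral_right)
        show "\<forall>E'\<in>F T - {E}. indicator (interior T \<inter> interior E') x * entry_max (G E' - GI T) = 0"
        proof
          fix E' assume E': "E' \<in> F T - {E}"
          then have "x \<notin> E'" using uE F_M by auto
          then have "x \<notin> interior E'" using interior_subset by auto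
          then show "indicator (interior T \<inter> interior E') x * entry_max (G E' - GI T) = 0" by simp
        qed
      qed (use finite_F TE in auto)
      also have "\<dots> = ?f x"
        using TE genericD(9)[OF gen] by simp
      finally show ?thesis by simp
    qed simp
  qed
  ultimately have "(\<lambda>x. indicator Omega x * ?f x) \<in> borel_measurable lebesgue"
    by (rule borel_measurable_AE)
  then have "(\<lambda>x. indicator Omega x * ?f x) \<in> borel_measurable (lebesgue_on Omega)"
    by (rule measurable_restrict_space1)
  moreover have "indicator Omega x * ?f x = ?f x" if "x \<in> space (lebesgue_on Omega)" for x
    using that by (simp add: space_restrict_space)
  ultimately have "?f \<in> borel_measurable (lebesgue_on Omega)"
    using measurable_cong[of "lebesgue_on Omega" "\<lambda>x. indicator Omega x * ?f x" ?f borel] by blast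
  then show ?thesis by measurable
qed

lemma Linf_estimate:
  "grad_Linf_norm Omega (\<lambda>x. yf x - Iy x) \<le> ennreal (4 * error_const) * (SUP E\<in>continuum. ennreal (h E) * osc E)"
proof (cases "(SUP E\<in>continuum. ennreal (h E) * osc E)")
  case top
  show ?thesis unfolding top using error_const_ge by (simp add: ennreal_mult_top)
next
  case (real s)
  have Om: "Omega \<in> sets lebesgue" using Omega_borel by (intro sets_completionI_sets) simp
  have "AE x in lebesgue. x \<in> Omega \<longrightarrow>
      ennreal (entry_max (grad (\<lambda>x. yf x - Iy x) x)) \<le> ennreal (4 * error_const * s)"
    unfolding AE_completion_iff using AE_off_skeleton
  proof eventually_elim
    case (elim x)
    show ?case
    proof
      assume "x \<in> Omega"
      then obtain T E where gen: "generic x T E" using Omega_generic elim by blast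
      note TE = genericD(1,2)[OF gen]
      have "entry_max (grad (\<lambda>x. yf x - Iy x) x) = entry_max (G E - GI T)"
        using genericD(9)[OF gen] by simp
      also have "\<dots> \<le> norm (G E - GI T)" by (rule entry_max_le_norm)
      also have "\<dots> \<le> 588 * \<kappa>' * s" using TE(1,2) real(2,1) by (rule error_sup)
      also have "\<dots> \<le> error_const * s" using error_const_ge(2) real(1) by (rule mult_right_mono)
      also have "\<dots> \<le> 4 * error_const * s" using error_const_ge(1) real(1) by simp
      finally show "ennreal (entry_max (grad (\<lambda>x. yf x - Iy x) x)) \<le> ennreal (4 * error_const * s)"
        by (rule ennreal_leI)
    qed
  qed
  then have "AE x in lebesgue_on Omega. ennreal (entry_max (grad (\<lambda>x. yf x - Iy x) x)) \<le> ennreal (4 * error_const * s)"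
    by (subst AE_restrict_space_iff) (use Om in simp_all)
  then have "grad_Linf_norm Omega (\<lambda>x. yf x - Iy x) \<le> ennreal (4 * error_const * s)"
    unfolding grad_Linf_norm_def by (intro esssup_I entry_max_measurable)
  also have "\<dots> = ennreal (4 * error_const) * (SUP E\<in>continuum. ennreal (h E) * osc E)"
    using error_const_ge(1) real by (simp add: ennreal_mult'')
  finally show ?thesis .
qed

end

theorem lemma3p2:
  fixes \<kappa> :: real
  assumes "CARD('n::finite) \<in> {1, 2}"
  shows "\<exists>C_I > 0. \<forall>(N::nat) (Q :: (real^'n) set set) Th Tha Thi Thc.
    N \<ge> 1 \<and> unit_cube_subdivision Q \<and> coarse_mesh N Th \<and>
    Th = Tha \<union> Thi \<union> Thc \<and> Tha \<inter> Thi = {} \<and> Tha \<inter> Thc = {} \<and> Thi \<inter> Thc = {} \<and>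
    Tha \<union> Thi \<subseteq> fine_mesh N Q \<and> shape_regularity Th \<le> \<kappa> \<longrightarrow>
    (\<forall>y \<in> deformations N.
       let yf = interp (fine_mesh_per N Q) y;
           Ihy = interp (mesh_per Th) y
       in
         (\<forall>p\<ge>1. grad_Lp_norm p Omega (\<lambda>x. yf x - Ihy x) \<le>
            ennreal C_I *
            epowr (\<Sum>T\<in>fine_mesh_c N Q Thc.
                     emeasure lebesgue T *
                     epowr (ennreal (elt_mesh_size Th T) * osc_grad N yf (patch_c N Q Thc T)) p)
                  (1 / p)) \<and>
         grad_Linf_norm Omega (\<lambda>x. yf x - Ihy x) \<le>
            ennreal C_I *
            (SUP T\<in>fine_mesh_c N Q Thc.
               ennreal (elt_mesh_size Th T) * osc_grad N yf (patch_c N Q Thc T)))"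
\<comment> \<open>\<open>4 \<kappa>\<close> bounds the ratio of diameter to inscribed radius; one factor \<open>4\<close> is for the entrywise norm\<close>
proof (intro exI[of _ "4 * (9632 * max 1 (4 * \<kappa>) ^ 4)"] conjI allI impI ballI, goal_cases)
  case 1
  then show ?case by simp
next
  case (2 N Q Th Tha Thi Thc y)
  then obtain L where L: "reference_cells L Q" using unit_cube_subdivision_reference_cells by blast
  interpret reference_cells L Q by (rule L)
  interpret coupled_mesh L Q N Th Tha Thi Thc \<kappa> y
    using 2 by unfold_locales auto
  show ?case
    using Lp_estimate Linf_estimate unfolding error_const_def Let_def by blast
qed

end
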